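(* Let $m\ge2$. For all $\mathfrak t\in\mathfrak S$, $$L_{V_m,\mathfrak t}=\sum_{\mathfrak s\in\mathfrak S}a_{\mathfrak s,\mathfrak t}\,\ell_{V_m}^{\mathfrak s}\,L_{V_m}^{\mathfrak s}.$$
   Context: **General notation.** $p$ is an odd prime; embeddings $\iota_\infty:\overline{\mathbb Q}\to\mathbb C$, $\iota_p:\overline{\mathbb Q}\to\overline{\mathbb Q}_p$ are fixed and used to view algebraic numbers in $\mathbb C$ and in $\mathbb C_p$. $\chi$ is the $p$-adic cyclotomic character, $\mathrm{Frob}_\ell$ an arithmetic Frobenius. A Dirichlet character $\eta$ is identified with the Galois character with $\eta(\mathrm{Frob}_\ell)=\eta(\ell)$; $\tau(\cdot)$ is the Gauss sum. **The form.** $f$ is a normalised cuspidal newform of weight $k\ge2$, level $\Gamma_1(N)$ with $p\nmid N$, Nebentypus $\epsilon$, with complex multiplication: $L(f,s)=L(\psi,s)$ for a Hecke character $\psi$ of an imaginary quadratic field $K$ in which $p$ is inert (so $a_p(f)=0$). $\epsilon_K$ is the quadratic character of $K$. $\pm\alpha$ are the roots of $x^2+\epsilon(p)p^{k-1}$. $E$ is a finite extension of $\mathbb Q_p$ containing the values of $\psi$ on $\mathbb A_{K,f}^\times$ and $\alpha$. $r=\lfloor m/2\rfloor$, $\tilde r=\lceil m/2\rceil$, and $V_m=\mathrm{Sym}^m(V_f)\otimes\det(\rho_f)^{-r}$, with $\rho_f:G_{\mathbb Q}\to GL(V_f)$ the 2-dimensional $E$-linear representation attached to $f$ ($\mathrm{tr}\,\rho_f(\mathrm{Frob}_\ell)=a_\ell(f)$,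 $\det\rho_f=\epsilon\chi^{k-1}$). **The forms $f_i$.** For $0\le i\le\tilde r-1$, $f_i$ is the newform with $V_{f_i}\cong \mathrm{Ind}_K^{\mathbb Q}(V_{\psi^{m-2i}})\otimes\epsilon_K^i\epsilon^{i-r}$, where $V_{\psi^{m-2i}}$ is the one-dimensional representation of $G_K$ on which $\mathrm{Frob}_v$ acts by $\psi^{m-2i}(v)$ for almost all $v$. It has weight $k_i=(m-2i)(k-1)+1$, level prime to $p$, Nebentypus $\epsilon_i$ and $a_p(f_i)=0$. The roots of $x^2+\epsilon_i(p)p^{k_i-1}$ are $\alpha_{i,\pm}=\pm p^{(r-i)(k-1)}$ if $m$ is even and $\alpha_{i,\pm}=\pm\alpha p^{(r-i)(k-1)}$ if $m$ is odd. **Power series.** $G_\infty=\mathrm{Gal}(\mathbb Q_p(\mu_{p^\infty})/\mathbb Q_p)\cong\Delta\times\Gamma$, identified with $\mathbb Z_p^\times$ by $\chi$, $\Delta\cong\mu_{p-1}$, $\Gamma\cong 1+p\mathbb Z_p$ with topological generator $\gamma_0$. $\Lambda_E(G_\infty)=\mathcal O_E[[G_\infty]]\otimes E$. $\mathcal H_{h,E}(G_\infty)$ is the set of $\sum_{n\ge0,\sigma\in\Delta}c_{n,\sigma}\sigma(\gamma_0-1)^n$ with $c_{n,\sigma}\in E$ and $\sup_{n\ge1}|c_{n,\sigma}|_p/n^h<\infty$ for every $\sigma$. A continuous character $\lambda:G_\infty\to\mathbb C_p^\times$ is evaluated by $\lambda(\sum c_{n,\sigma}\sigma(\gamma_0-1)^n)=\sum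 c_{n,\sigma}\lambda(\sigma)(\lambda(\gamma_0)-1)^n$. $\mathrm{Tw}_n$ is the $E$-linear map sending $\sigma\mapsto\chi(\sigma)^n\sigma$ for $\sigma\in G_\infty$. **$p$-adic $L$-functions of newforms.** Let $g$ be a newform of weight $\kappa$, prime-to-$p$ level, Nebentypus $\epsilon_g$ and $a_p(g)=0$. For each root $\beta$ of $x^2+\epsilon_g(p)p^{\kappa-1}$, with other root $\bar\beta=-\beta$, there are (Amice–Vélu) fixed periods $\Omega_g^\pm\in\mathbb C^\times$ and a unique $L_{g,\beta}\in\mathcal H_{(\kappa-1)/2,E}(G_\infty)$ such that for all integers $1\le j\le\kappa-1$ and all Dirichlet characters $\theta$ of conductor $p^n$, $$\theta\chi^j(L_{g,\beta})=\Big(\frac{p^j}{\beta}\Big)^n(1-\theta^{-1}(p)\bar\beta p^{-j})\Big(1-\frac{\theta(p)p^{j-1}}{\beta}\Big)\frac{\Gamma(j)\,L(g,\theta^{-1},j)}{\tau(\theta^{-1})(-2\pi i)^j\Omega_g^\delta},\quad \delta=(-1)^j\theta(-1).$$ With $\Phi_l$ the $p^l$-th cyclotomic polynomial, $\log_b^+=\prod_{a=1}^b\prod_{n\ge1}\Phi_{2n}(\chi(\gamma_0)^{-a}\gamma_0)/p$ and $\log_b^-=\prod_{a=1}^b\prod_{n\ge1}\Phi_{2n-1}(\chi(\gamma_0)^{-a}\gamma_0)/p$. Pollack's $L_g^\pm\in\Lambda_E(G_\infty)$ are the elements, independent of $\beta$, with $L_{g,\beta}=L_g^+\log_{\kappa-1}^++\beta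 L_g^-\log_{\kappa-1}^-$ for both roots $\beta$. Write $L_{f_i,\pm}:=L_{f_i,\alpha_{i,\pm}}$ (not to be confused with $L_{f_i}^\pm$). **$p$-adic $L$-functions of characters.** For $\eta\in\{\mathbf 1,\epsilon_K\}$, $L_\eta$ denotes the Kubota–Leopoldt/Iwasawa $p$-adic $L$-function: the unique element of $\Lambda_{\mathcal O_E}(G_\infty)$ (for $\eta=\mathbf 1$: of its total ring of fractions, with $(\gamma_0-1)(\gamma_0-\chi(\gamma_0))L_{\mathbf 1}\in\Lambda_{\mathcal O_E}(G_\infty)$) such that for every integer $j$ and every $\theta$ of conductor $p^n$ with $\theta\chi^j(-1)=\mathrm{sgn}(j-\frac12)\eta(-1)$, $\theta\chi^j(L_\eta)$ equals $(1-p^{-j}(\eta\theta^{-1})(p))L(\eta\theta^{-1},j)$ if $j\le0$, and $\big(\frac{p^j}{\eta(p)}\big)^n(1-p^{j-1}(\eta^{-1}\theta)(p))\frac{2\Gamma(j)\mathfrak f_\eta^j}{\tau(\theta^{-1})(-2\pi i)^j\theta^{-1}(\mathfrak f_\eta)\tau(\eta)}L(\eta\theta^{-1},j)$ if $j\ge1$, where $\mathfrak f_\eta$ is the conductor of $\eta$. **Objects for $V_m$.** $\mathfrak S=\{+,-\}^{\tilde r}$, with $\mathfrak s_i$ ($0\le i\le\tilde r-1$) the $i$th sign of $\mathfrak s$. - $L_{V_m}^{\mathfrak s}=\prod_{i=0}^{\tilde r-1}\mathrm{Tw}_{(r-i)(k-1)}(L_{f_i}^{\mathfrak s_i})$, times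 $L_{\epsilon_K^r}$ if $m$ is even. - $L_{V_m,\mathfrak s}=\prod_{i=0}^{\tilde r-1}\mathrm{Tw}_{(r-i)(k-1)}(L_{f_i,\mathfrak s_i})$, times $L_{\epsilon_K^r}$ if $m$ is even. - $\ell_i^+=\log^+_{k_i-1}$, $\ell_i^-=\alpha_{i,+}\log^-_{k_i-1}$ and $\ell_{V_m}^{\mathfrak s}=\prod_{i=0}^{\tilde r-1}\mathrm{Tw}_{(r-i)(k-1)}(\ell_i^{\mathfrak s_i})$. - $a_{\mathfrak s,\mathfrak t}=(-1)^{b_{\mathfrak s,\mathfrak t}}$, where $b_{\mathfrak s,\mathfrak t}$ is the number of $i\in[0,\tilde r-1]$ with $\mathfrak s_i=\mathfrak t_i=-$. *)

theory Defs
  imports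
    "HOL-Complex_Analysis.Complex_Analysis"
    "HOL-Algebra.Algebraic_Closure_Type"
    "HOL-Algebra.Ideal_Product"
    "HOL-Algebra.QuotRing"
    "HOL-Number_Theory.Cong"
begin

no_notation fps_nth (infixl \<open>$\<close> 75)
hide_const (open) Divisibility.prime

section \<open>Algebraic numbers, complex numbers and \<open>p\<close>-adic numbers\<close>

type_synonym qbar = "rat alg_closure"

definition field_embedding :: "('a::field \<Rightarrow> 'b::field) \<Rightarrow> bool" where
  "field_embedding h \<longleftrightarrow>
     h 1 = 1 \<and> (\<forall>x y. h (x + y) = h x + h y) \<and> (\<forall>x y. h (x * y) = h x * h y)"

text \<open>
  The type \<open>'c\<close> (with its absolute value \<open>\<lambda>x. dist x 0\<close>) is the field of \<open>p\<close>-adic complex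
  numbers: an algebraically closed field of characteristic 0, complete for a non-archimedean
  absolute value normalised by \<open>|p| = 1/p\<close>, in which the algebraic numbers are dense.  This
  determines it up to isometric isomorphism; algebraic closedness, completeness and
  characteristic 0 are in the sort.
\<close>

definition padic_complex_field ::
  "nat \<Rightarrow> 'c::{alg_closed_field,field_char_0,complete_space} itself \<Rightarrow> bool" where
  "padic_complex_field p (_ :: 'c itself) \<longleftrightarrow>
     (\<forall>x y :: 'c. dist x y = dist (x - y) 0) \<and>
     (\<forall>x y :: 'c. dist (x * y) 0 = dist x 0 * dist y 0) \<and>
     (\<forall>x y :: 'c. dist (x + y) 0 \<le> max (dist x 0) (dist y 0)) \<and>
     dist (of_nat p :: 'c) 0 = 1 / real p \<and>
     closure {x :: 'c. algebraic x} = UNIV"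

text \<open>An algebraic complex number viewed in \<open>'c\<close>; meaningful only on \<^term>\<open>range iinf\<close>.\<close>

definition to_padic :: "(qbar \<Rightarrow> complex) \<Rightarrow> (qbar \<Rightarrow> 'c) \<Rightarrow> complex \<Rightarrow> 'c" where
  "to_padic iinf ip z = ip (inv_into UNIV iinf z)"

definition Qp :: "'c::{field_char_0,metric_space} set" where
  "Qp = closure \<rat>"

definition Zp :: "'c::{field_char_0,metric_space} set" where
  "Zp = {x \<in> Qp. dist x 0 \<le> 1}"

definition one_units :: "nat \<Rightarrow> 'c::{field_char_0,metric_space} set" where
  "one_units p = {x \<in> Qp. dist x 1 \<le> 1 / real p}"

definition is_subfield :: "'c::field set \<Rightarrow> bool" where
  "is_subfield E \<longleftrightarrow> 1 \<in> E \<and> (\<forall>x\<in>E. \<forall>y\<in>E. x - y \<in> E \<and> x * y \<in> E \<and> inverse x \<in> E)"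

definition finite_extension_of_Qp :: "'c::{field_char_0,metric_space} set \<Rightarrow> bool" where
  "finite_extension_of_Qp E \<longleftrightarrow>
     is_subfield E \<and> Qp \<subseteq> E \<and>
     (\<exists>B. finite B \<and> B \<subseteq> E \<and> (\<forall>x\<in>E. \<exists>c\<in>B \<rightarrow> Qp. x = (\<Sum>b\<in>B. c b * b)))"


section \<open>Dirichlet characters and values of Dirichlet series\<close>

definition dirichlet_character :: "nat \<Rightarrow> (int \<Rightarrow> complex) \<Rightarrow> bool" where
  "dirichlet_character n \<eta> \<longleftrightarrow>
     n > 0 \<and> (\<forall>a b. [a = b] (mod int n) \<longrightarrow> \<eta> a = \<eta> b) \<and>
     (\<forall>a b. \<eta> (a * b) = \<eta> a * \<eta> b) \<and> (\<forall>a. \<eta> a \<noteq> 0 \<longleftrightarrow> coprime a (int n))"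

definition primitive_character :: "nat \<Rightarrow> (int \<Rightarrow> complex) \<Rightarrow> bool" where
  "primitive_character n \<eta> \<longleftrightarrow>
     dirichlet_character n \<eta> \<and>
     (\<forall>d. d dvd n \<and> (\<forall>a. coprime a (int n) \<and> [a = 1] (mod int d) \<longrightarrow> \<eta> a = 1) \<longrightarrow> d = n)"

text \<open>As usual \<open>\<eta>\<inverse>\<close> vanishes where \<open>\<eta>\<close> does; recall \<^prop>\<open>inverse 0 = (0::complex)\<close>.\<close>

definition inv_char :: "(int \<Rightarrow> complex) \<Rightarrow> int \<Rightarrow> complex" where
  "inv_char \<eta> a = inverse (\<eta> a)"

definition gauss_sum :: "nat \<Rightarrow> (int \<Rightarrow> complex) \<Rightarrow> complex" where
  "gauss_sum n \<eta> = (\<Sum>a<n. \<eta> (int a) * exp (2 * of_real pi * \<i> * of_nat a / of_nat n))"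

text \<open>
  The value at \<open>s\<close> of the analytic continuation of \<open>\<Sum>n\<ge>1. a n / n\<^sup>s\<close> (finitely many
  poles away from \<open>s\<close> are allowed, so that the Riemann zeta function is covered).
\<close>

definition L_continues_to :: "(nat \<Rightarrow> complex) \<Rightarrow> complex \<Rightarrow> complex \<Rightarrow> bool" where
  "L_continues_to a s v \<longleftrightarrow>
     (\<exists>F P c. finite P \<and> s \<notin> P \<and> F holomorphic_on (- P) \<and>
        (\<forall>w. Re w > c \<longrightarrow> (\<lambda>n. a (Suc n) * of_nat (Suc n) powr (- w)) sums F w) \<and> F s = v)"

definition L_value :: "(nat \<Rightarrow> complex) \<Rightarrow> complex \<Rightarrow> complex" where
  "L_value a s = (THE v. L_continues_to a s v)"


section \<open>Newforms\<close>

definition upper_half_plane :: "complex set" where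
  "upper_half_plane = {z. Im z > 0}"

definition SL2Z :: "(int^2^2) set" where
  "SL2Z = {\<gamma>. det \<gamma> = 1}"

definition Gamma0 :: "nat \<Rightarrow> (int^2^2) set" where
  "Gamma0 N = {\<gamma> \<in> SL2Z. [\<gamma>$2$1 = 0] (mod int N)}"

definition Gamma1 :: "nat \<Rightarrow> (int^2^2) set" where
  "Gamma1 N = {\<gamma> \<in> Gamma0 N. [\<gamma>$1$1 = 1] (mod int N) \<and> [\<gamma>$2$2 = 1] (mod int N)}"

definition slash :: "nat \<Rightarrow> (complex \<Rightarrow> complex) \<Rightarrow> int^2^2 \<Rightarrow> complex \<Rightarrow> complex" where
  "slash k g \<gamma> z =
     g ((of_int (\<gamma>$1$1) * z + of_int (\<gamma>$1$2)) / (of_int (\<gamma>$2$1) * z + of_int (\<gamma>$2$2)))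
       / (of_int (\<gamma>$2$1) * z + of_int (\<gamma>$2$2)) ^ k"

definition cusp_form :: "nat \<Rightarrow> nat \<Rightarrow> (complex \<Rightarrow> complex) \<Rightarrow> bool" where
  "cusp_form k N g \<longleftrightarrow>
     g holomorphic_on upper_half_plane \<and>
     (\<forall>\<gamma>\<in>Gamma1 N. \<forall>z\<in>upper_half_plane. slash k g \<gamma> z = g z) \<and>
     (\<forall>\<gamma>\<in>SL2Z. (slash k g \<gamma> \<longlongrightarrow> 0) (filtercomap Im at_top))"

definition fourier_coeff :: "(complex \<Rightarrow> complex) \<Rightarrow> nat \<Rightarrow> complex" where
  "fourier_coeff g = (THE a. \<forall>z\<in>upper_half_plane.
     (\<lambda>n. a n * exp (2 * of_real pi * \<i> * of_nat n * z)) sums g z)"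

text \<open>
  The Petersson product for \<open>\<Gamma>\<^sub>1(N)\<close>, up to a positive factor depending only on \<open>N\<close>: the
  integral over a fundamental domain is spread over the cosets \<open>\<Gamma>\<^sub>1(N)\<gamma>\<close> in \<open>SL\<^sub>2(\<int>)\<close>.
  Only orthogonality for it is used below.
\<close>

definition std_fundamental_domain :: "complex set" where
  "std_fundamental_domain = {z. Im z > 0 \<and> \<bar>Re z\<bar> \<le> 1/2 \<and> norm z \<ge> 1}"

definition petersson ::
  "nat \<Rightarrow> nat \<Rightarrow> (complex \<Rightarrow> complex) \<Rightarrow> (complex \<Rightarrow> complex) \<Rightarrow> complex" where
  "petersson k N g h =
     (\<Sum>C \<in> (\<lambda>\<gamma>. (\<lambda>\<delta>. \<delta> ** \<gamma>) ` Gamma1 N) ` SL2Z.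
        let \<gamma> = (SOME \<gamma>. \<gamma> \<in> C) in
        (LINT z:std_fundamental_domain|lborel.
           slash k g \<gamma> z * cnj (slash k h \<gamma> z) * of_real (Im z) ^ k / of_real (Im z) ^ 2))"

text \<open>The Hecke operator \<open>T\<^sub>l\<close> on forms of Nebentypus \<open>eps\<close>, where \<open>eps l = 0\<close> if \<open>l | N\<close>.\<close>

definition hecke_operator ::
  "nat \<Rightarrow> (int \<Rightarrow> complex) \<Rightarrow> nat \<Rightarrow> (complex \<Rightarrow> complex) \<Rightarrow> complex \<Rightarrow> complex" where
  "hecke_operator k eps l g z =
     (\<Sum>j<l. g ((z + of_nat j) / of_nat l)) / of_nat l
       + eps (int l) * of_nat l ^ (k - 1) * g (of_nat l * z)"

definition newform :: "nat \<Rightarrow> nat \<Rightarrow> (int \<Rightarrow> complex) \<Rightarrow> (complex \<Rightarrow> complex) \<Rightarrow> bool" where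
  "newform k N eps g \<longleftrightarrow>
     dirichlet_character N eps \<and> cusp_form k N g \<and>
     (\<forall>\<gamma>\<in>Gamma0 N. \<forall>z\<in>upper_half_plane. slash k g \<gamma> z = eps (\<gamma>$2$2) * g z) \<and>
     fourier_coeff g 1 = 1 \<and>
     (\<forall>l. prime l \<longrightarrow> (\<exists>c. \<forall>z\<in>upper_half_plane. hecke_operator k eps l g z = c * g z)) \<and>
     (\<forall>M d h. M * d dvd N \<and> M < N \<and> cusp_form k M h \<longrightarrow>
        petersson k N g (\<lambda>z. h (of_nat d * z)) = 0)"


section \<open>Number fields inside the algebraic numbers\<close>

definition ring_of_integers :: "qbar set \<Rightarrow> qbar ring" where
  "ring_of_integers K =
     \<lparr>carrier = {x \<in> K. algebraic_int x}, mult = (*), one = 1, zero = 0, add = (+)\<rparr>"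

definition principal :: "qbar set \<Rightarrow> qbar \<Rightarrow> qbar set" where
  "principal K x = PIdl\<^bsub>ring_of_integers K\<^esub> x"

definition ideal_norm :: "qbar set \<Rightarrow> qbar set \<Rightarrow> nat" where
  "ideal_norm K I = card (carrier (ring_of_integers K Quot I))"

definition imaginary_quadratic :: "qbar set \<Rightarrow> bool" where
  "imaginary_quadratic K \<longleftrightarrow>
     (\<exists>d s. d > 0 \<and> squarefree (d::nat) \<and> s ^ 2 = - of_nat d \<and>
        K = {of_rat a + of_rat b * s | a b. True})"

definition inert :: "qbar set \<Rightarrow> nat \<Rightarrow> bool" where
  "inert K l \<longleftrightarrow> primeideal (principal K (of_nat l)) (ring_of_integers K)"

definition ramified :: "qbar set \<Rightarrow> nat \<Rightarrow> bool" where
  "ramified K l \<longleftrightarrow>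
     (\<exists>P. primeideal P (ring_of_integers K) \<and>
        principal K (of_nat l) = ideal_prod (ring_of_integers K) P P)"

definition quadratic_character_of :: "qbar set \<Rightarrow> nat \<Rightarrow> (int \<Rightarrow> complex) \<Rightarrow> bool" where
  "quadratic_character_of K D \<eta> \<longleftrightarrow>
     primitive_character D \<eta> \<and>
     (\<forall>l. prime l \<longrightarrow> \<eta> (int l) = (if inert K l then -1 else if ramified K l then 0 else 1))"

definition ideals_prime_to :: "qbar set \<Rightarrow> qbar set \<Rightarrow> qbar set set" where
  "ideals_prime_to K \<mm> =
     {I. ideal I (ring_of_integers K) \<and> I \<noteq> {0} \<and>
        I <+>\<^bsub>ring_of_integers K\<^esub> \<mm> = carrier (ring_of_integers K)}"

text \<open>
  Hecke characters (Groessencharaktere) of an imaginary quadratic field in terms of ideals;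
  \<open>\<psi>inf\<close> is the infinity type, a continuous character of \<open>\<complex>\<^sup>\<times>\<close>.
\<close>

definition hecke_character_mod ::
  "(qbar \<Rightarrow> complex) \<Rightarrow> qbar set \<Rightarrow> qbar set \<Rightarrow> (complex \<Rightarrow> complex) \<Rightarrow>
   (qbar set \<Rightarrow> complex) \<Rightarrow> bool" where
  "hecke_character_mod iinf K \<mm> \<psi>inf \<psi> \<longleftrightarrow>
     ideal \<mm> (ring_of_integers K) \<and> \<mm> \<noteq> {0} \<and>
     continuous_on (- {0}) \<psi>inf \<and> (\<forall>z. z \<noteq> 0 \<longrightarrow> \<psi>inf z \<noteq> 0) \<and>
     (\<forall>z w. z \<noteq> 0 \<and> w \<noteq> 0 \<longrightarrow> \<psi>inf (z * w) = \<psi>inf z * \<psi>inf w) \<and>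
     (\<forall>I \<in> ideals_prime_to K \<mm>. \<psi> I \<noteq> 0) \<and>
     (\<forall>I \<in> ideals_prime_to K \<mm>. \<forall>J \<in> ideals_prime_to K \<mm>.
        \<psi> (ideal_prod (ring_of_integers K) I J) = \<psi> I * \<psi> J) \<and>
     (\<forall>x \<in> carrier (ring_of_integers K). x \<noteq> 0 \<and> x - 1 \<in> \<mm> \<longrightarrow>
        \<psi> (principal K x) = \<psi>inf (iinf x))"

definition hecke_character ::
  "(qbar \<Rightarrow> complex) \<Rightarrow> qbar set \<Rightarrow> qbar set \<Rightarrow> (complex \<Rightarrow> complex) \<Rightarrow>
   (qbar set \<Rightarrow> complex) \<Rightarrow> bool" where
  "hecke_character iinf K \<ff> \<psi>inf \<psi> \<longleftrightarrow>
     hecke_character_mod iinf K \<ff> \<psi>inf \<psi> \<and>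
     (\<forall>\<mm> \<psi>'. \<ff> \<subseteq> \<mm> \<and> hecke_character_mod iinf K \<mm> \<psi>inf \<psi>' \<and>
        (\<forall>I \<in> ideals_prime_to K \<ff>. \<psi>' I = \<psi> I) \<longrightarrow> \<mm> = \<ff>)"

text \<open>
  The idelic character attached to \<open>\<psi>\<close> is trivial on \<open>K\<^sup>\<times>\<close> and equals \<open>\<psi>inf\<inverse>\<close> at infinity, so
  it takes the value \<open>\<psi>inf x\<close> at the finite part of \<open>x \<in> K\<^sup>\<times>\<close>; by weak approximation its values
  on the finite ideles are the products of these with the values of \<open>\<psi>\<close> on fractional ideals.
\<close>

definition contains_finite_idele_values ::
  "(qbar \<Rightarrow> complex) \<Rightarrow> (qbar \<Rightarrow> 'c) \<Rightarrow> qbar set \<Rightarrow> qbar set \<Rightarrow> (complex \<Rightarrow> complex) \<Rightarrow>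
   (qbar set \<Rightarrow> complex) \<Rightarrow> 'c set \<Rightarrow> bool" where
  "contains_finite_idele_values iinf ip K \<ff> \<psi>inf \<psi> E \<longleftrightarrow>
     (\<forall>x\<in>K. x \<noteq> 0 \<longrightarrow> \<psi>inf (iinf x) \<in> range iinf \<and> to_padic iinf ip (\<psi>inf (iinf x)) \<in> E) \<and>
     (\<forall>I \<in> ideals_prime_to K \<ff>. \<psi> I \<in> range iinf \<and> to_padic iinf ip (\<psi> I) \<in> E)"

text \<open>The identity \<open>L(g, s) = L(\<psi>, s)\<close>, in a half-plane of absolute convergence.\<close>

definition same_L_function ::
  "qbar set \<Rightarrow> qbar set \<Rightarrow> (qbar set \<Rightarrow> complex) \<Rightarrow> (complex \<Rightarrow> complex) \<Rightarrow> bool" where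
  "same_L_function K \<ff> \<psi> g \<longleftrightarrow>
     (\<exists>c. \<forall>s. Re s > c \<longrightarrow>
        (\<exists>v. (\<lambda>n. fourier_coeff g (Suc n) * of_nat (Suc n) powr (- s)) sums v \<and>
             ((\<lambda>I. \<psi> I * of_nat (ideal_norm K I) powr (- s)) has_sum v) (ideals_prime_to K \<ff>)))"


section \<open>Galois representations\<close>

definition Gal :: "qbar set \<Rightarrow> (qbar \<Rightarrow> qbar) set" where
  "Gal K = {\<sigma>. bij \<sigma> \<and> field_embedding \<sigma> \<and> (\<forall>x\<in>K. \<sigma> x = x)}"

text \<open>The Krull topology is the topology of pointwise convergence.\<close>

definition krull_topology :: "qbar set \<Rightarrow> (qbar \<Rightarrow> qbar) topology" where
  "krull_topology K =
     subtopology (product_topology (\<lambda>_. discrete_topology UNIV) UNIV) (Gal K)"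

text \<open>Arithmetic Frobenius elements and inertia, for all places of \<open>\<bar>\<rat>\<close> above \<open>v\<close> at once.\<close>

definition is_frobenius :: "qbar set \<Rightarrow> qbar set \<Rightarrow> (qbar \<Rightarrow> qbar) \<Rightarrow> bool" where
  "is_frobenius K v \<sigma> \<longleftrightarrow>
     \<sigma> \<in> Gal K \<and>
     (\<exists>P. maximalideal P (ring_of_integers UNIV) \<and> P \<inter> K = v \<and>
        (\<forall>x. algebraic_int x \<longrightarrow> \<sigma> x - x ^ ideal_norm K v \<in> P))"

definition in_inertia :: "qbar set \<Rightarrow> qbar set \<Rightarrow> (qbar \<Rightarrow> qbar) \<Rightarrow> bool" where
  "in_inertia K v \<sigma> \<longleftrightarrow>
     \<sigma> \<in> Gal K \<and>
     (\<exists>P. maximalideal P (ring_of_integers UNIV) \<and> P \<inter> K = v \<and>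
        (\<forall>x. algebraic_int x \<longrightarrow> \<sigma> x - x \<in> P))"

text \<open>
  A Dirichlet character modulo \<open>n\<close> as a Galois character: it sends an automorphism acting as
  \<open>\<zeta> \<mapsto> \<zeta>\<^sup>a\<close> on the \<open>n\<close>-th roots of unity to \<open>\<eta> a\<close>.
\<close>

definition gal_char ::
  "(qbar \<Rightarrow> complex) \<Rightarrow> (qbar \<Rightarrow> 'c) \<Rightarrow> nat \<Rightarrow> (int \<Rightarrow> complex) \<Rightarrow> (qbar \<Rightarrow> qbar) \<Rightarrow> 'c" where
  "gal_char iinf ip n \<eta> \<sigma> =
     to_padic iinf ip (\<eta> (int (SOME a. \<forall>\<zeta>. \<zeta> ^ n = 1 \<longrightarrow> \<sigma> \<zeta> = \<zeta> ^ a)))"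

definition cyclotomic_character ::
  "nat \<Rightarrow> (qbar \<Rightarrow> qbar) \<Rightarrow> 'c::{field_char_0,metric_space}" where
  "cyclotomic_character p \<sigma> =
     (THE x. x \<in> Zp \<and> (\<forall>n a. dist x (of_nat a) \<le> 1 / real p ^ n \<longrightarrow>
        (\<forall>\<zeta>. \<zeta> ^ (p ^ n) = 1 \<longrightarrow> \<sigma> \<zeta> = \<zeta> ^ a)))"

definition vectors_over :: "'c set \<Rightarrow> ('c^2) set" where
  "vectors_over E = {v. \<forall>a. v $ a \<in> E}"

text \<open>
  \<open>\<rho>\<close> is the 2-dimensional \<open>E\<close>-linear representation of \<open>G\<^sub>\<rat>\<close> attached to the newform \<open>g\<close>.
\<close>

definition attached_representation ::
  "nat \<Rightarrow> (qbar \<Rightarrow> complex) \<Rightarrow> (qbar \<Rightarrow> 'c::{field_char_0,metric_space}) \<Rightarrow> 'c set \<Rightarrow>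
   nat \<Rightarrow> nat \<Rightarrow> (int \<Rightarrow> complex) \<Rightarrow> (complex \<Rightarrow> complex) \<Rightarrow>
   ((qbar \<Rightarrow> qbar) \<Rightarrow> 'c^2^2) \<Rightarrow> bool" where
  "attached_representation p iinf ip E k N eps g \<rho> \<longleftrightarrow>
     (\<forall>\<sigma>\<in>Gal \<rat>. \<forall>a b. \<rho> \<sigma> $ a $ b \<in> E) \<and>
     \<rho> id = mat 1 \<and> (\<forall>\<sigma>\<in>Gal \<rat>. \<forall>\<tau>\<in>Gal \<rat>. \<rho> (\<sigma> \<circ> \<tau>) = \<rho> \<sigma> ** \<rho> \<tau>) \<and>
     continuous_map (krull_topology \<rat>) euclidean \<rho> \<and>
     (\<forall>v \<in> vectors_over E. v \<noteq> 0 \<longrightarrow> (\<exists>\<sigma>\<in>Gal \<rat>. \<forall>c\<in>E. \<rho> \<sigma> *v v \<noteq> c *s v)) \<and>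
     (\<forall>l \<sigma>. prime l \<and> \<not> l dvd N * p \<and> in_inertia \<rat> (principal \<rat> (of_nat l)) \<sigma> \<longrightarrow>
        \<rho> \<sigma> = mat 1) \<and>
     (\<forall>l \<sigma>. prime l \<and> \<not> l dvd N * p \<and> is_frobenius \<rat> (principal \<rat> (of_nat l)) \<sigma> \<longrightarrow>
        fourier_coeff g l \<in> range iinf \<and>
        trace (\<rho> \<sigma>) = to_padic iinf ip (fourier_coeff g l)) \<and>
     (\<forall>\<sigma>\<in>Gal \<rat>.
        det (\<rho> \<sigma>) = gal_char iinf ip N eps \<sigma> * cyclotomic_character p \<sigma> ^ (k - 1))"

text \<open>\<open>\<phi>\<close> is the character of \<open>G\<^sub>K\<close> on which \<open>Frob\<^sub>v\<close> acts by \<open>\<psi>\<^sup>n(v)\<close> for almost all \<open>v\<close>.\<close>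

definition galois_character_of_hecke ::
  "(qbar \<Rightarrow> complex) \<Rightarrow> (qbar \<Rightarrow> 'c::{field_char_0,metric_space}) \<Rightarrow> 'c set \<Rightarrow> qbar set \<Rightarrow>
   qbar set \<Rightarrow> (qbar set \<Rightarrow> complex) \<Rightarrow> nat \<Rightarrow> ((qbar \<Rightarrow> qbar) \<Rightarrow> 'c) \<Rightarrow> bool" where
  "galois_character_of_hecke iinf ip E K \<ff> \<psi> n \<phi> \<longleftrightarrow>
     (\<forall>\<sigma>\<in>Gal K. \<phi> \<sigma> \<in> E - {0}) \<and>
     (\<forall>\<sigma>\<in>Gal K. \<forall>\<tau>\<in>Gal K. \<phi> (\<sigma> \<circ> \<tau>) = \<phi> \<sigma> * \<phi> \<tau>) \<and>
     continuous_map (krull_topology K) euclidean \<phi> \<and>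
     (\<exists>S. finite S \<and>
        (\<forall>v \<sigma>. v \<in> ideals_prime_to K \<ff> - S \<and> primeideal v (ring_of_integers K) \<and>
           is_frobenius K v \<sigma> \<longrightarrow> \<phi> \<sigma> = to_padic iinf ip (\<psi> v ^ n)))"

text \<open>
  The space of the representation of \<open>G\<^sub>\<rat>\<close> induced from the character \<open>\<phi>\<close> of \<open>G\<^sub>K\<close>
  (functions are extended by 0 outside \<open>G\<^sub>\<rat>\<close>); \<open>\<sigma>\<close> acts by \<open>h \<mapsto> (x \<mapsto> h (x \<circ> \<sigma>))\<close>.
\<close>

definition induced_space ::
  "'c::field set \<Rightarrow> qbar set \<Rightarrow> ((qbar \<Rightarrow> qbar) \<Rightarrow> 'c) \<Rightarrow> ((qbar \<Rightarrow> qbar) \<Rightarrow> 'c) set" where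
  "induced_space E K \<phi> =
     {h. (\<forall>\<sigma>\<in>Gal \<rat>. h \<sigma> \<in> E) \<and> (\<forall>\<sigma>. \<sigma> \<notin> Gal \<rat> \<longrightarrow> h \<sigma> = 0) \<and>
         (\<forall>\<tau>\<in>Gal K. \<forall>\<sigma>\<in>Gal \<rat>. h (\<tau> \<circ> \<sigma>) = \<phi> \<tau> * h \<sigma>)}"

definition isomorphic_to_twisted_induced ::
  "'c::field set \<Rightarrow> ((qbar \<Rightarrow> qbar) \<Rightarrow> 'c^2^2) \<Rightarrow> qbar set \<Rightarrow> ((qbar \<Rightarrow> qbar) \<Rightarrow> 'c) \<Rightarrow>
   ((qbar \<Rightarrow> qbar) \<Rightarrow> 'c) \<Rightarrow> bool" where
  "isomorphic_to_twisted_induced E \<rho> K \<phi> \<eta> \<longleftrightarrow>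
     (\<exists>T. bij_betw T (vectors_over E) (induced_space E K \<phi>) \<and>
        (\<forall>v\<in>vectors_over E. \<forall>w\<in>vectors_over E. \<forall>x. T (v + w) x = T v x + T w x) \<and>
        (\<forall>c\<in>E. \<forall>v\<in>vectors_over E. \<forall>x. T (c *s v) x = c * T v x) \<and>
        (\<forall>\<sigma>\<in>Gal \<rat>. \<forall>v\<in>vectors_over E. \<forall>x\<in>Gal \<rat>. T (\<rho> \<sigma> *v v) x = \<eta> \<sigma> * T v (x \<circ> \<sigma>)))"


section \<open>Distributions on \<open>G\<^sub>\<infinity>\<close>\<close>

text \<open>
  \<open>G\<^sub>\<infinity>\<close> is identified with \<open>\<int>\<^sub>p\<^sup>\<times>\<close> by \<open>\<chi>\<close>, so that \<open>\<Delta>\<close> becomes the group of \<open>(p-1)\<close>-st roots of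
  unity and \<open>u = \<chi>(\<gamma>\<^sub>0)\<close> is a topological generator of \<open>1 + p\<int>\<^sub>p\<close>.  The element
  \<open>\<Sum>c\<^bsub>n,\<sigma>\<^esub> \<sigma> (\<gamma>\<^sub>0 - 1)\<^sup>n\<close> is represented by the family \<open>\<sigma> \<mapsto> \<Sum>c\<^bsub>n,\<sigma>\<^esub> X\<^sup>n\<close> of power series,
  extended by 0 outside \<open>\<Delta>\<close>.
\<close>

type_synonym 'c dist = "'c \<Rightarrow> 'c fps"

definition Delta :: "nat \<Rightarrow> 'c::field set" where
  "Delta p = {\<sigma>. \<sigma> ^ (p - 1) = 1}"

definition topological_generator :: "nat \<Rightarrow> 'c::{field_char_0,metric_space} \<Rightarrow> bool" where
  "topological_generator p u \<longleftrightarrow> closure (range (\<lambda>n::int. u powi n)) = one_units p"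

definition E_dist :: "nat \<Rightarrow> 'c::field set \<Rightarrow> 'c dist set" where
  "E_dist p E = {F. (\<forall>\<sigma>. \<sigma> \<notin> Delta p \<longrightarrow> F \<sigma> = 0) \<and> (\<forall>\<sigma> n. fps_nth (F \<sigma>) n \<in> E)}"

definition H_set :: "nat \<Rightarrow> 'c::{field,metric_space} set \<Rightarrow> real \<Rightarrow> 'c dist set" where
  "H_set p E h =
     {F \<in> E_dist p E. \<forall>\<sigma>\<in>Delta p. \<exists>B. \<forall>n\<ge>1. dist (fps_nth (F \<sigma>) n) 0 / real n powr h \<le> B}"

definition Lambda_int :: "nat \<Rightarrow> 'c::{field,metric_space} set \<Rightarrow> 'c dist set" where
  "Lambda_int p E = {F \<in> E_dist p E. \<forall>\<sigma> n. dist (fps_nth (F \<sigma>) n) 0 \<le> 1}"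

definition dist_scale :: "'c::field \<Rightarrow> 'c dist \<Rightarrow> 'c dist" where
  "dist_scale c F = (\<lambda>\<sigma>. fps_const c * F \<sigma>)"

definition Lambda_E :: "nat \<Rightarrow> 'c::{field,metric_space} set \<Rightarrow> 'c dist set" where
  "Lambda_E p E = {dist_scale c F | c F. c \<in> E \<and> F \<in> Lambda_int p E}"

definition of_series :: "'c::field fps \<Rightarrow> 'c dist" where
  "of_series s = (\<lambda>\<sigma>. if \<sigma> = 1 then s else 0)"

definition dist_mult :: "nat \<Rightarrow> 'c::field dist \<Rightarrow> 'c dist \<Rightarrow> 'c dist" where
  "dist_mult p F G =
     (\<lambda>\<sigma>. if \<sigma> \<in> Delta p then (\<Sum>\<tau>\<in>Delta p. F \<tau> * G (\<sigma> / \<tau>)) else 0)"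

definition H_ring :: "nat \<Rightarrow> 'c::{field,metric_space} set \<Rightarrow> 'c dist ring" where
  "H_ring p E = \<lparr>carrier = (\<Union>h. H_set p E h), mult = dist_mult p, one = of_series 1,
     zero = (\<lambda>_. 0), add = (\<lambda>F G \<sigma>. F \<sigma> + G \<sigma>)\<rparr>"

text \<open>The value of a character \<open>lam\<close> of \<open>G\<^sub>\<infinity>\<close> at an element of \<^const>\<open>H_ring\<close>.\<close>

definition dist_eval ::
  "nat \<Rightarrow> 'c::{field,metric_space} \<Rightarrow> ('c \<Rightarrow> 'c) \<Rightarrow> 'c dist \<Rightarrow> 'c" where
  "dist_eval p u lam F =
     (\<Sum>\<sigma>\<in>Delta p. lam \<sigma> * (\<Sum>n. fps_nth (F \<sigma>) n * (lam u - 1) ^ n))"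

text \<open>
  The character \<open>\<theta>\<chi>\<^sup>j\<close> of \<open>G\<^sub>\<infinity> = \<int>\<^sub>p\<^sup>\<times>\<close>, for \<open>\<theta>\<close> of conductor \<open>p\<^sup>n\<close>; the natural number chosen is any
  \<open>a\<close> congruent to \<open>x\<close> modulo \<open>p\<^sup>n\<close>.
\<close>

definition theta_chi ::
  "nat \<Rightarrow> (qbar \<Rightarrow> complex) \<Rightarrow> (qbar \<Rightarrow> 'c::{field,metric_space}) \<Rightarrow> nat \<Rightarrow>
   (int \<Rightarrow> complex) \<Rightarrow> int \<Rightarrow> 'c \<Rightarrow> 'c" where
  "theta_chi p iinf ip n \<theta> j x =
     to_padic iinf ip (\<theta> (int (SOME a. dist x (of_nat a) \<le> 1 / real p ^ n))) * x powi j"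

definition gamma0 :: "'c::field fps" where
  "gamma0 = 1 + fps_X"

text \<open>
  \<open>Tw\<^sub>n\<close> replaces \<open>\<sigma>\<close> by \<open>\<sigma>\<^sup>n \<sigma>\<close> and \<open>\<gamma>\<^sub>0\<close> by \<open>u\<^sup>n \<gamma>\<^sub>0\<close>; the coefficients of the resulting series are
  convergent sums in \<open>'c\<close>.
\<close>

definition Tw :: "'c::{field,metric_space} \<Rightarrow> int \<Rightarrow> 'c dist \<Rightarrow> 'c dist" where
  "Tw u n F =
     (\<lambda>\<sigma>. fps_const (\<sigma> powi n) * Abs_fps (\<lambda>j. \<Sum>i. fps_nth (F \<sigma>) i *
        fps_nth ((fps_const (u powi n) * gamma0 - 1) ^ i) j))"

definition cyclotomic_poly :: "nat \<Rightarrow> 'c::field poly" where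
  "cyclotomic_poly n =
     (\<Prod>\<zeta> \<in> {\<zeta>. \<zeta> ^ n = 1 \<and> (\<forall>d. 0 < d \<and> d < n \<longrightarrow> \<zeta> ^ d \<noteq> 1)}. [:- \<zeta>, 1:])"

definition log_factor :: "nat \<Rightarrow> 'c::field \<Rightarrow> nat \<Rightarrow> nat \<Rightarrow> 'c fps" where
  "log_factor p u a l =
     fps_const (1 / of_nat p) *
       poly (map_poly fps_const (cyclotomic_poly (p ^ l))) (fps_const (u powi (- int a)) * gamma0)"

text \<open>Infinite products of power series, with coefficientwise \<open>p\<close>-adic convergence.\<close>

definition fps_infprod :: "(nat \<Rightarrow> 'c::{field,metric_space} fps) \<Rightarrow> 'c fps" where
  "fps_infprod s = Abs_fps (\<lambda>j. lim (\<lambda>M. fps_nth (\<Prod>n=1..M. s n) j))"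

datatype sign = Plus | Minus

definition log_pm :: "nat \<Rightarrow> 'c::{field,metric_space} \<Rightarrow> nat \<Rightarrow> sign \<Rightarrow> 'c dist" where
  "log_pm p u b s = of_series (\<Prod>a=1..b. fps_infprod (\<lambda>n.
     log_factor p u a (case s of Plus \<Rightarrow> 2 * n | Minus \<Rightarrow> 2 * n - 1)))"


section \<open>Total rings of fractions\<close>

definition regular_elements :: "('a, 'b) ring_scheme \<Rightarrow> 'a set" where
  "regular_elements R =
     {b \<in> carrier R. \<forall>x \<in> carrier R. b \<otimes>\<^bsub>R\<^esub> x = \<zero>\<^bsub>R\<^esub> \<longrightarrow> x = \<zero>\<^bsub>R\<^esub>}"

definition fraction :: "('a, 'b) ring_scheme \<Rightarrow> 'a \<Rightarrow> 'a \<Rightarrow> ('a \<times> 'a) set" where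
  "fraction R a b =
     {(c, d). c \<in> carrier R \<and> d \<in> regular_elements R \<and> a \<otimes>\<^bsub>R\<^esub> d = c \<otimes>\<^bsub>R\<^esub> b}"

definition total_fractions :: "('a, 'b) ring_scheme \<Rightarrow> ('a \<times> 'a) set ring" where
  "total_fractions R =
     \<lparr>carrier = {fraction R a b | a b. a \<in> carrier R \<and> b \<in> regular_elements R},
      mult = (\<lambda>x y. \<Union>(a, b)\<in>x. \<Union>(c, d)\<in>y. fraction R (a \<otimes>\<^bsub>R\<^esub> c) (b \<otimes>\<^bsub>R\<^esub> d)),
      one = fraction R \<one>\<^bsub>R\<^esub> \<one>\<^bsub>R\<^esub>,
      zero = fraction R \<zero>\<^bsub>R\<^esub> \<one>\<^bsub>R\<^esub>,
      add = (\<lambda>x y. \<Union>(a, b)\<in>x. \<Union>(c, d)\<in>y.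
        fraction R ((a \<otimes>\<^bsub>R\<^esub> d) \<oplus>\<^bsub>R\<^esub> (c \<otimes>\<^bsub>R\<^esub> b)) (b \<otimes>\<^bsub>R\<^esub> d))\<rparr>"

type_synonym 'c frac_dist = "('c dist \<times> 'c dist) set"

definition FracH :: "nat \<Rightarrow> 'c::{field,metric_space} set \<Rightarrow> 'c frac_dist ring" where
  "FracH p E = total_fractions (H_ring p E)"

definition to_frac :: "nat \<Rightarrow> 'c::{field,metric_space} set \<Rightarrow> 'c dist \<Rightarrow> 'c frac_dist" where
  "to_frac p E F = fraction (H_ring p E) F (of_series 1)"

text \<open>\<open>lam\<close> has the value \<open>v\<close> at \<open>x\<close>: for some way of writing \<open>x\<close> as a fraction \<open>lam\<close> does not
  vanish at the denominator.\<close>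

definition frac_eval ::
  "nat \<Rightarrow> 'c::{field,metric_space} \<Rightarrow> ('c \<Rightarrow> 'c) \<Rightarrow> 'c frac_dist \<Rightarrow> 'c \<Rightarrow> bool" where
  "frac_eval p u lam x v \<longleftrightarrow>
     (\<exists>(A, B) \<in> x. dist_eval p u lam B \<noteq> 0 \<and>
        v = dist_eval p u lam A / dist_eval p u lam B)"


section \<open>\<open>p\<close>-adic \<open>L\<close>-functions\<close>

text \<open>
  The interpolation property characterising \<open>L\<^bsub>g,\<beta>\<^esub>\<close>, for a newform \<open>g\<close> of weight \<open>\<kappa>\<close> with periods
  \<open>\<Omega>\<close> and \<open>a\<^sub>p(g) = 0\<close> (so the other root is \<open>- \<beta>\<close>).
\<close>

definition is_padic_L ::
  "nat \<Rightarrow> (qbar \<Rightarrow> complex) \<Rightarrow> (qbar \<Rightarrow> 'c::{field,metric_space}) \<Rightarrow> 'c \<Rightarrow> 'c set \<Rightarrow>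
   nat \<Rightarrow> (complex \<Rightarrow> complex) \<Rightarrow> (sign \<Rightarrow> complex) \<Rightarrow> complex \<Rightarrow> 'c dist \<Rightarrow> bool" where
  "is_padic_L p iinf ip u E \<kappa> g \<Omega> \<beta> F \<longleftrightarrow>
     F \<in> H_set p E ((real \<kappa> - 1) / 2) \<and>
     (\<forall>j n \<theta>. 1 \<le> j \<and> j \<le> \<kappa> - 1 \<and> primitive_character (p ^ n) \<theta> \<longrightarrow>
        (let \<delta> = (if (-1) ^ j * \<theta> (-1) = 1 then Plus else Minus);
             v = (of_nat p ^ j / \<beta>) ^ n *
                 (1 - inv_char \<theta> (int p) * (- \<beta>) / of_nat p ^ j) *
                 (1 - \<theta> (int p) * of_nat p ^ (j - 1) / \<beta>) *
                 (Gamma (of_nat j) *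
                    L_value (\<lambda>l. fourier_coeff g l * inv_char \<theta> (int l)) (of_nat j) /
                    (gauss_sum (p ^ n) (inv_char \<theta>) * (- 2 * of_real pi * \<i>) ^ j * \<Omega> \<delta>))
         in v \<in> range iinf \<and>
            dist_eval p u (theta_chi p iinf ip n \<theta> (int j)) F = to_padic iinf ip v))"

definition hecke_roots :: "nat \<Rightarrow> nat \<Rightarrow> (int \<Rightarrow> complex) \<Rightarrow> complex set" where
  "hecke_roots p \<kappa> eps = {\<beta>. \<beta> ^ 2 + eps (int p) * of_nat p ^ (\<kappa> - 1) = 0}"

text \<open>Pollack's decomposition, characterising \<open>L\<^sub>g\<^sup>\<plusminus>\<close> in terms of the family \<open>\<beta> \<mapsto> L\<^bsub>g,\<beta>\<^esub>\<close>.\<close>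

definition pollack_decomposition ::
  "nat \<Rightarrow> (qbar \<Rightarrow> complex) \<Rightarrow> (qbar \<Rightarrow> 'c::{field,metric_space}) \<Rightarrow> 'c \<Rightarrow> 'c set \<Rightarrow>
   nat \<Rightarrow> (int \<Rightarrow> complex) \<Rightarrow> (complex \<Rightarrow> 'c dist) \<Rightarrow> (sign \<Rightarrow> 'c dist) \<Rightarrow> bool" where
  "pollack_decomposition p iinf ip u E \<kappa> eps Lroot Lpm \<longleftrightarrow>
     Lpm Plus \<in> Lambda_E p E \<and> Lpm Minus \<in> Lambda_E p E \<and>
     (\<forall>\<beta> \<in> hecke_roots p \<kappa> eps.
        Lroot \<beta> =
          (Lpm Plus \<otimes>\<^bsub>H_ring p E\<^esub> log_pm p u (\<kappa> - 1) Plus) \<oplus>\<^bsub>H_ring p E\<^esub>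
          dist_scale (to_padic iinf ip \<beta>)
            (Lpm Minus \<otimes>\<^bsub>H_ring p E\<^esub> log_pm p u (\<kappa> - 1) Minus))"

text \<open>
  The Kubota--Leopoldt \<open>p\<close>-adic \<open>L\<close>-function of a character \<open>\<eta>\<close> of conductor \<open>c\<close> prime to \<open>p\<close>.  It is
  a measure unless \<open>\<eta> = 1\<close>, that is \<open>c = 1\<close>.  The products \<open>\<eta>\<theta>\<inverse>\<close> below are primitive since \<open>c\<close>
  is prime to \<open>p\<close>.
\<close>

definition is_kubota_leopoldt ::
  "nat \<Rightarrow> (qbar \<Rightarrow> complex) \<Rightarrow> (qbar \<Rightarrow> 'c::{field,metric_space}) \<Rightarrow> 'c \<Rightarrow> 'c set \<Rightarrow>
   nat \<Rightarrow> (int \<Rightarrow> complex) \<Rightarrow> 'c frac_dist \<Rightarrow> bool" where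
  "is_kubota_leopoldt p iinf ip u E c \<eta> x \<longleftrightarrow>
     x \<in> carrier (FracH p E) \<and>
     (if c = 1
      then to_frac p E (of_series ((gamma0 - 1) * (gamma0 - fps_const u))) \<otimes>\<^bsub>FracH p E\<^esub> x
             \<in> to_frac p E ` Lambda_int p E
      else x \<in> to_frac p E ` Lambda_int p E) \<and>
     (\<forall>(j::int) n \<theta>. primitive_character (p ^ n) \<theta> \<and>
        \<theta> (-1) * (-1) powi j = of_real (sgn (of_int j - 1/2)) * \<eta> (-1) \<longrightarrow>
        (let L = L_value (\<lambda>l. \<eta> (int l) * inv_char \<theta> (int l)) (of_int j);
             v = (if j \<le> 0
                  then (1 - of_nat p powi (- j) * (\<eta> (int p) * inv_char \<theta> (int p))) * L
                  else (of_nat p powi j / \<eta> (int p)) ^ n *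
                       (1 - of_nat p powi (j - 1) * (inv_char \<eta> (int p) * \<theta> (int p))) *
                       (2 * Gamma (of_int j) * of_nat c powi j /
                          (gauss_sum (p ^ n) (inv_char \<theta>) * (- 2 * of_real pi * \<i>) powi j *
                           inv_char \<theta> (int c) * gauss_sum c \<eta>)) * L)
         in v \<in> range iinf \<and>
            frac_eval p u (theta_chi p iinf ip n \<theta> j) x (to_padic iinf ip v)))"


section \<open>The symmetric power \<open>V\<^sub>m\<close>\<close>

definition r_lo :: "nat \<Rightarrow> nat" where "r_lo m = m div 2"

definition r_hi :: "nat \<Rightarrow> nat" where "r_hi m = (m + 1) div 2"

definition Signs :: "nat \<Rightarrow> (nat \<Rightarrow> sign) set" where
  "Signs m = {..<r_hi m} \<rightarrow>\<^sub>E UNIV"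

definition weight_i :: "nat \<Rightarrow> nat \<Rightarrow> nat \<Rightarrow> nat" where
  "weight_i k m i = (m - 2 * i) * (k - 1) + 1"

text \<open>Here \<open>i \<le> r_lo m\<close> for all indices \<open>i\<close> occurring, so the subtraction is not truncated.\<close>

definition twist_i :: "nat \<Rightarrow> nat \<Rightarrow> nat \<Rightarrow> nat" where
  "twist_i k m i = (r_lo m - i) * (k - 1)"

definition alpha_i :: "nat \<Rightarrow> nat \<Rightarrow> nat \<Rightarrow> complex \<Rightarrow> nat \<Rightarrow> sign \<Rightarrow> complex" where
  "alpha_i p k m \<alpha> i s =
     (case s of Plus \<Rightarrow> 1 | Minus \<Rightarrow> -1) * (if even m then 1 else \<alpha>) * of_nat p ^ twist_i k m i"

text \<open>
  In the next two definitions \<open>Leta\<close> stands for \<open>L\<^sub>\<eta>\<close> with \<open>\<eta> = \<epsilon>\<^sub>K\<^sup>r\<close>, a factor which is present only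
  for even \<open>m\<close>.
\<close>

definition L_V_pm ::
  "nat \<Rightarrow> 'c::{field,metric_space} \<Rightarrow> 'c set \<Rightarrow> nat \<Rightarrow> nat \<Rightarrow> (nat \<Rightarrow> sign \<Rightarrow> 'c dist) \<Rightarrow>
   'c frac_dist \<Rightarrow> (nat \<Rightarrow> sign) \<Rightarrow> 'c frac_dist" where
  "L_V_pm p u E k m Lpm Leta s =
     (\<Otimes>\<^bsub>FracH p E\<^esub>i\<in>{..<r_hi m}. to_frac p E (Tw u (int (twist_i k m i)) (Lpm i (s i))))
       \<otimes>\<^bsub>FracH p E\<^esub> (if even m then Leta else \<one>\<^bsub>FracH p E\<^esub>)"

definition L_V_root ::
  "nat \<Rightarrow> 'c::{field,metric_space} \<Rightarrow> 'c set \<Rightarrow> nat \<Rightarrow> nat \<Rightarrow> complex \<Rightarrow>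
   (nat \<Rightarrow> complex \<Rightarrow> 'c dist) \<Rightarrow> 'c frac_dist \<Rightarrow> (nat \<Rightarrow> sign) \<Rightarrow> 'c frac_dist" where
  "L_V_root p u E k m \<alpha> Lroot Leta s =
     (\<Otimes>\<^bsub>FracH p E\<^esub>i\<in>{..<r_hi m}.
        to_frac p E (Tw u (int (twist_i k m i)) (Lroot i (alpha_i p k m \<alpha> i (s i)))))
       \<otimes>\<^bsub>FracH p E\<^esub> (if even m then Leta else \<one>\<^bsub>FracH p E\<^esub>)"

definition ell_i ::
  "nat \<Rightarrow> (qbar \<Rightarrow> complex) \<Rightarrow> (qbar \<Rightarrow> 'c::{field,metric_space}) \<Rightarrow> 'c \<Rightarrow> nat \<Rightarrow> nat \<Rightarrow>
   complex \<Rightarrow> nat \<Rightarrow> sign \<Rightarrow> 'c dist" where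
  "ell_i p iinf ip u k m \<alpha> i s =
     (case s of
        Plus \<Rightarrow> log_pm p u (weight_i k m i - 1) Plus
      | Minus \<Rightarrow> dist_scale (to_padic iinf ip (alpha_i p k m \<alpha> i Plus))
                   (log_pm p u (weight_i k m i - 1) Minus))"

definition ell_V ::
  "nat \<Rightarrow> (qbar \<Rightarrow> complex) \<Rightarrow> (qbar \<Rightarrow> 'c::{field,metric_space}) \<Rightarrow> 'c \<Rightarrow> 'c set \<Rightarrow>
   nat \<Rightarrow> nat \<Rightarrow> complex \<Rightarrow> (nat \<Rightarrow> sign) \<Rightarrow> 'c dist" where
  "ell_V p iinf ip u E k m \<alpha> s =
     (\<Otimes>\<^bsub>H_ring p E\<^esub>i\<in>{..<r_hi m}.
        Tw u (int (twist_i k m i)) (ell_i p iinf ip u k m \<alpha> i (s i)))"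

definition sign_coeff :: "nat \<Rightarrow> (nat \<Rightarrow> sign) \<Rightarrow> (nat \<Rightarrow> sign) \<Rightarrow> 'c::field" where
  "sign_coeff m s t = (-1) ^ card {i \<in> {..<r_hi m}. s i = Minus \<and> t i = Minus}"

end

theory Submission
  imports Defs "HOL-Number_Theory.Residues"
begin

text \<open>
  For each \<open>i\<close> Pollack's decomposition of the \<open>p\<close>-adic \<open>L\<close>-function of \<open>f\<^sub>i\<close> at a root \<open>\<plusminus>\<alpha>\<^sub>i\<close> reads
  \<open>L\<^sup>+ log\<^sup>+ \<plusminus> \<alpha>\<^sub>i L\<^sup>- log\<^sup>-\<close>, that is \<open>L\<^sup>+ \<ell>\<^sup>+ \<plusminus> L\<^sup>- \<ell>\<^sup>-\<close>.  Twisting is a ring homomorphism, so the same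
  holds after applying \<open>Tw\<close>.  Multiplying the twisted two-term sums over all \<open>i\<close> and expanding gives one
  summand for every sign vector \<open>s\<close>; it carries a factor \<open>-1\<close> for each \<open>i\<close> at which both \<open>s\<close> and the
  given vector are negative, which is the coefficient \<open>a\<close>.  The factor coming from a Dirichlet character
  multiplies both sides.

  What has to be proved for this computation to make sense is that it takes place in commutative
  rings, and that all the quantities lie in them.

  The distributions of polynomial growth form a ring because polynomial growth can be
  tested on Gauss norms: \<open>F\<close> has coefficients \<open>O(n\<^sup>h)\<close> for some \<open>h\<close> exactly when
  its Gauss norm at radius \<open>1 - 1/n\<close> is \<open>O(n\<^sup>h)\<close> for some \<open>h\<close>
  (\<open>poly_growth_imp_coeff_bound\<close>, \<open>coeff_bound_imp_poly_growth\<close>), and Gauss norms are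
  submultiplicative.

  The twist is built from the substitution \<open>1 + Z \<mapsto> v(1 + Z)\<close>, where \<open>Z\<close> is the variable and \<open>|v - 1| \<le> 1/p\<close>.
  It does not increase Gauss norms at radii between \<open>1/2\<close> and 1, hence preserves growth, and its multiplicativity
  (\<open>subst_gamma_mult\<close>) follows from that of polynomial substitution by continuity.  That
  twisted coefficients stay in \<open>E\<close> uses that \<open>E\<close> is closed (\<open>finite_extension_closed\<close>) and contains the
  \<open>(p-1)\<close>-st roots of unity (\<open>roots_of_unity_in_Qp\<close>).

  The half-logarithms belong to the ring because the factor \<open>\<Phi>\<^sub>l/p\<close> of the product has
  Gauss norm at most \<open>p\<close> at all radii \<open>1/2 \<le> \<rho> < 1\<close>, where moreover it differs from \<open>1\<close> by at most
  \<open>p\<^bsup>2-l\<^esup>/(1-\<rho>)\<close> (\<open>gauss_le_log_factor\<close>).  At radius \<open>1 - 1/n\<close> only about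
  \<open>log\<^sub>p n\<close> factors can exceed \<open>1\<close>, so the product is \<open>O(n)\<close> there (\<open>fps_infprod_bounds\<close>).

  Finally the roots \<open>\<plusminus>\<alpha>\<^sub>i\<close> are algebraic numbers (\<open>hecke_root_in_range\<close>), so that passing
  to the \<open>p\<close>-adic side is compatible with the change of sign; and the total ring of fractions, needed
  for the Kubota--Leopoldt factor, is a commutative ring receiving the ring of distributions
  (\<open>total_fractions_cring\<close>, \<open>fraction_one_ring_hom\<close>).
\<close>

section \<open>Total rings of fractions\<close>

lemma UN_pairs_const:
  assumes "(a, b) \<in> A" "(c, d) \<in> B"
    and "\<And>a' b' c' d'. (a', b') \<in> A \<Longrightarrow> (c', d') \<in> B \<Longrightarrow> F a' b' c' d' = Z"
  shows "(\<Union>(a', b')\<in>A. \<Union>(c', d')\<in>B. F a' b' c' d') = Z"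
proof
  show "Z \<subseteq> (\<Union>(a', b')\<in>A. \<Union>(c', d')\<in>B. F a' b' c' d')"
    using assms(1,2) assms(3)[OF assms(1,2)] by blast
qed (use assms(3) in blast)

context cring
begin

lemma regular_closed: "b \<in> regular_elements R \<Longrightarrow> b \<in> carrier R"
  by (simp add: regular_elements_def)

lemma regularD: "b \<in> regular_elements R \<Longrightarrow> x \<in> carrier R \<Longrightarrow> b \<otimes> x = \<zero> \<Longrightarrow> x = \<zero>"
  by (auto simp: regular_elements_def)

lemma regular_cancel:
  assumes "b \<in> regular_elements R" "x \<in> carrier R" "y \<in> carrier R" "b \<otimes> x = b \<otimes> y"
  shows "x = y"
proof -
  have b: "b \<in> carrier R" using assms(1) by (rule regular_closed)
  have "b \<otimes> (x \<ominus> y) = \<zero>"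
    using assms b by (simp add: minus_eq r_distr r_minus r_neg)
  then have "x \<ominus> y = \<zero>"
    using assms by (auto simp: regular_elements_def)
  then show ?thesis
    using assms by simp
qed

lemma regular_one: "\<one> \<in> regular_elements R"
  by (simp add: regular_elements_def)

lemma regular_mult:
  assumes "a \<in> regular_elements R" "b \<in> regular_elements R"
  shows "a \<otimes> b \<in> regular_elements R"
proof -
  have [simp]: "a \<in> carrier R" "b \<in> carrier R"
    using assms by (auto intro: regular_closed)
  have "x = \<zero>" if "x \<in> carrier R" "a \<otimes> b \<otimes> x = \<zero>" for x
  proof -
    have "a \<otimes> (b \<otimes> x) = \<zero>"
      using that by (simp add: m_assoc)
    then have "b \<otimes> x = \<zero>"
      by (rule regularD[OF assms(1), rotated]) (simp add: that)
    then show ?thesis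
      by (rule regularD[OF assms(2), rotated]) (simp add: that)
  qed
  then show ?thesis
    unfolding regular_elements_def mem_Collect_eq by simp
qed

text \<open>
  Cross-multiplication is an equivalence relation on pairs with regular denominators because regular
  elements can be cancelled; the set \<open>fraction R a b\<close> is the class of \<open>(a, b)\<close>.
\<close>

lemma fraction_eq_iff:
  assumes "a \<in> carrier R" "b \<in> regular_elements R" "c \<in> carrier R" "d \<in> regular_elements R"
  shows "fraction R a b = fraction R c d \<longleftrightarrow> a \<otimes> d = c \<otimes> b"
proof
  assume "fraction R a b = fraction R c d"
  moreover have "(c, d) \<in> fraction R c d"
    using assms by (auto simp: fraction_def)
  ultimately show "a \<otimes> d = c \<otimes> b"
    by (auto simp: fraction_def)
next
  have sub: "fraction R a b \<subseteq> fraction R c d"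
    if A: "a \<in> carrier R" "b \<in> regular_elements R" "c \<in> carrier R" "d \<in> regular_elements R"
      and eq: "a \<otimes> d = c \<otimes> b" for a b c d
  proof safe
    fix e f assume "(e, f) \<in> fraction R a b"
    then have e: "e \<in> carrier R" "f \<in> regular_elements R" "a \<otimes> f = e \<otimes> b"
      by (auto simp: fraction_def)
    note [simp] = A e(1,2) regular_closed
    have "b \<otimes> (c \<otimes> f) = (c \<otimes> b) \<otimes> f" by (simp add: m_ac)
    also have "\<dots> = (a \<otimes> f) \<otimes> d" by (simp add: m_ac flip: eq)
    also have "\<dots> = b \<otimes> (e \<otimes> d)" by (simp add: e m_ac)
    finally have "c \<otimes> f = e \<otimes> d"
      by (rule regular_cancel[of b, rotated 3]) auto
    then show "(e, f) \<in> fraction R c d"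
      by (auto simp: fraction_def)
  qed
  assume "a \<otimes> d = c \<otimes> b"
  then show "fraction R a b = fraction R c d"
    using assms by (intro equalityI sub) auto
qed

lemma mem_fraction_self:
  "a \<in> carrier R \<Longrightarrow> b \<in> regular_elements R \<Longrightarrow> (a, b) \<in> fraction R a b"
  by (auto simp: fraction_def)

text \<open>
  The product of two classes is defined as a union over all representatives; it is a single class
  because all these products of representatives are equivalent.
\<close>

lemma fraction_mult:
  assumes "a \<in> carrier R" "b \<in> regular_elements R" "c \<in> carrier R" "d \<in> regular_elements R"
  shows "fraction R a b \<otimes>\<^bsub>total_fractions R\<^esub> fraction R c d = fraction R (a \<otimes> c) (b \<otimes> d)"
proof -
  have eq: "fraction R (a' \<otimes> c') (b' \<otimes> d') = fraction R (a \<otimes> c) (b \<otimes> d)"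
    if "(a', b') \<in> fraction R a b" "(c', d') \<in> fraction R c d" for a' b' c' d'
  proof -
    have A: "a' \<in> carrier R" "b' \<in> regular_elements R" "a \<otimes> b' = a' \<otimes> b"
      "c' \<in> carrier R" "d' \<in> regular_elements R" "c \<otimes> d' = c' \<otimes> d"
      using that by (auto simp: fraction_def)
    note [simp] = A(1,2,4,5) assms regular_mult
      A(2,5)[THEN regular_closed] assms(2,4)[THEN regular_closed]
    have "a \<otimes> c \<otimes> (b' \<otimes> d') = (a \<otimes> b') \<otimes> (c \<otimes> d')" by (simp add: m_ac)
    also have "\<dots> = a' \<otimes> c' \<otimes> (b \<otimes> d)" by (simp add: A m_ac)
    finally show ?thesis
      by (subst fraction_eq_iff) auto
  qed
  show ?thesis
    unfolding total_fractions_def ring_record_simps monoid.select_convs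
    using mem_fraction_self[OF assms(1,2)] mem_fraction_self[OF assms(3,4)] eq
    by (rule UN_pairs_const)
qed

lemma fraction_add:
  assumes "a \<in> carrier R" "b \<in> regular_elements R" "c \<in> carrier R" "d \<in> regular_elements R"
  shows "fraction R a b \<oplus>\<^bsub>total_fractions R\<^esub> fraction R c d =
    fraction R (a \<otimes> d \<oplus> c \<otimes> b) (b \<otimes> d)"
proof -
  have eq: "fraction R (a' \<otimes> d' \<oplus> c' \<otimes> b') (b' \<otimes> d') = fraction R (a \<otimes> d \<oplus> c \<otimes> b) (b \<otimes> d)"
    if "(a', b') \<in> fraction R a b" "(c', d') \<in> fraction R c d" for a' b' c' d'
  proof -
    have A: "a' \<in> carrier R" "b' \<in> regular_elements R" "a \<otimes> b' = a' \<otimes> b"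
      "c' \<in> carrier R" "d' \<in> regular_elements R" "c \<otimes> d' = c' \<otimes> d"
      using that by (auto simp: fraction_def)
    note [simp] = A(1,2,4,5) assms regular_mult
      A(2,5)[THEN regular_closed] assms(2,4)[THEN regular_closed]
    have "(a \<otimes> d \<oplus> c \<otimes> b) \<otimes> (b' \<otimes> d') = (a \<otimes> b') \<otimes> (d \<otimes> d') \<oplus> (c \<otimes> d') \<otimes> (b \<otimes> b')"
      by (simp add: l_distr r_distr m_ac)
    also have "\<dots> = (a' \<otimes> d' \<oplus> c' \<otimes> b') \<otimes> (b \<otimes> d)"
      unfolding A(3) A(6) by (simp add: l_distr r_distr m_ac)
    finally show ?thesis
      by (subst fraction_eq_iff) auto
  qed
  show ?thesis
    unfolding total_fractions_def ring_record_simps monoid.select_convs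
    using mem_fraction_self[OF assms(1,2)] mem_fraction_self[OF assms(3,4)] eq
    by (rule UN_pairs_const)
qed

lemma total_fractions_carrier_cases:
  assumes "x \<in> carrier (total_fractions R)"
  obtains a b where "a \<in> carrier R" "b \<in> regular_elements R" "x = fraction R a b"
  using assms by (auto simp: total_fractions_def)

lemma fraction_in_carrier:
  "a \<in> carrier R \<Longrightarrow> b \<in> regular_elements R \<Longrightarrow> fraction R a b \<in> carrier (total_fractions R)"
  by (auto simp: total_fractions_def)

lemma total_fractions_zero: "\<zero>\<^bsub>total_fractions R\<^esub> = fraction R \<zero> \<one>"
  and total_fractions_one: "\<one>\<^bsub>total_fractions R\<^esub> = fraction R \<one> \<one>"
  by (simp_all add: total_fractions_def)

lemma total_fractions_cring: "cring (total_fractions R)"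
proof (rule cringI)
  note [simp] = fraction_mult fraction_add regular_mult regular_closed regular_one
    fraction_in_carrier total_fractions_zero total_fractions_one fraction_eq_iff
  show "abelian_group (total_fractions R)"
  proof (rule abelian_groupI)
    fix x assume "x \<in> carrier (total_fractions R)"
    then obtain a b where x: "a \<in> carrier R" "b \<in> regular_elements R" "x = fraction R a b"
      by (rule total_fractions_carrier_cases)
    have "fraction R (\<ominus> a) b \<oplus>\<^bsub>total_fractions R\<^esub> x = \<zero>\<^bsub>total_fractions R\<^esub>"
      using x by (simp add: l_minus l_neg)
    then show "\<exists>y\<in>carrier (total_fractions R). y \<oplus>\<^bsub>total_fractions R\<^esub> x = \<zero>\<^bsub>total_fractions R\<^esub>"
      using x by (intro bexI[of _ "fraction R (\<ominus> a) b"]) auto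
  qed (auto elim!: total_fractions_carrier_cases simp: l_distr r_distr m_ac a_ac)
  show "comm_monoid (total_fractions R)"
    by (rule comm_monoidI) (auto elim!: total_fractions_carrier_cases simp: m_ac)
  fix x y z
  assume "x \<in> carrier (total_fractions R)" "y \<in> carrier (total_fractions R)"
    "z \<in> carrier (total_fractions R)"
  then obtain a b c d e f where
    "a \<in> carrier R" "b \<in> regular_elements R" "x = fraction R a b"
    "c \<in> carrier R" "d \<in> regular_elements R" "y = fraction R c d"
    "e \<in> carrier R" "f \<in> regular_elements R" "z = fraction R e f"
    by (elim total_fractions_carrier_cases) blast
  then show "(x \<oplus>\<^bsub>total_fractions R\<^esub> y) \<otimes>\<^bsub>total_fractions R\<^esub> z =
      x \<otimes>\<^bsub>total_fractions R\<^esub> z \<oplus>\<^bsub>total_fractions R\<^esub> y \<otimes>\<^bsub>total_fractions R\<^esub> z"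
    by (simp add: l_distr r_distr m_ac)
qed

lemma fraction_one_ring_hom: "(\<lambda>a. fraction R a \<one>) \<in> ring_hom R (total_fractions R)"
  by (rule ring_hom_memI)
    (auto simp: fraction_in_carrier regular_one fraction_mult fraction_add total_fractions_one)

end

section \<open>Expanding a product of two-term sums\<close>

text \<open>
  Induction on \<open>I\<close>: the functions on \<open>insert j I\<close> fall into two classes according to their value at \<open>j\<close>,
  and each class is in bijection with the functions on \<open>I\<close>.
\<close>

lemma (in cring) finprod_add_expand:
  fixes G :: "'i \<Rightarrow> sign \<Rightarrow> 'a"
  assumes "finite I" "\<And>i s. i \<in> I \<Longrightarrow> G i s \<in> carrier R"
  shows "(\<Otimes>i\<in>I. G i Plus \<oplus> G i Minus) = (\<Oplus>s\<in>I \<rightarrow>\<^sub>E UNIV. \<Otimes>i\<in>I. G i (s i))"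
  using assms
proof (induction I rule: finite_induct)
  case empty
  show ?case by simp
next
  case (insert j I)
  let ?S = "I \<rightarrow>\<^sub>E (UNIV :: sign set)"
  let ?P = "\<lambda>s. \<Otimes>i\<in>I. G i (s i)"
  let ?Q = "\<lambda>s. \<Otimes>i\<in>insert j I. G i (s i)"
  have fin: "finite ?S"
  proof -
    have "(UNIV :: sign set) = {Plus, Minus}"
      using sign.exhaust by auto
    then have "finite (UNIV :: sign set)"
      by (metis finite.emptyI finite.insertI)
    then show ?thesis
      using insert.hyps(1) by (auto intro: finite_PiE)
  qed
  have P: "?P s \<in> carrier R" for s
    using insert.prems by (auto intro!: finprod_closed)
  have Q: "?Q s \<in> carrier R" for s
    using insert.prems by (auto intro!: finprod_closed)
  have Gj: "G j s \<in> carrier R" for s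
    using insert.prems by auto
  have half: "(\<Oplus>s\<in>(\<lambda>g. g(j := x)) ` ?S. ?Q s) = G j x \<otimes> (\<Oplus>s\<in>?S. ?P s)" for x
  proof -
    have inj: "inj_on (\<lambda>g. g(j := x)) ?S"
    proof (rule inj_onI)
      fix g h assume gh: "g \<in> ?S" "h \<in> ?S" "g(j := x) = h(j := x)"
      have "g i = h i" for i
        using gh insert.hyps(2) by (cases "i = j") (auto simp: PiE_def extensional_def fun_eq_iff split: if_splits)
      then show "g = h" by auto
    qed
    have "(\<Oplus>s\<in>(\<lambda>g. g(j := x)) ` ?S. ?Q s) = (\<Oplus>s\<in>?S. ?Q (s(j := x)))"
      by (rule finsum_reindex) (use inj Q in auto)
    also have "\<dots> = (\<Oplus>s\<in>?S. G j x \<otimes> ?P s)"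
    proof (rule finsum_cong')
      fix s assume "s \<in> ?S"
      have "?Q (s(j := x)) = G j ((s(j := x)) j) \<otimes> (\<Otimes>i\<in>I. G i ((s(j := x)) i))"
        by (rule finprod_insert) (use insert in auto)
      also have "(\<Otimes>i\<in>I. G i ((s(j := x)) i)) = ?P s"
        by (rule finprod_cong') (use insert in auto)
      finally show "?Q (s(j := x)) = G j x \<otimes> ?P s" by simp
    qed (use P Gj in auto)
    also have "\<dots> = G j x \<otimes> (\<Oplus>s\<in>?S. ?P s)"
      by (rule finsum_rdistr [symmetric]) (use fin P Gj in auto)
    finally show ?thesis .
  qed
  have split: "insert j I \<rightarrow>\<^sub>E UNIV =
    (\<lambda>g. g(j := Plus)) ` ?S \<union> (\<lambda>g. g(j := Minus)) ` ?S"
  proof -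
    have "(UNIV :: sign set) = {Plus, Minus}"
      using sign.exhaust by auto
    then have "insert j I \<rightarrow>\<^sub>E (UNIV :: sign set) = (\<lambda>(y, g). g(j := y)) ` ({Plus, Minus} \<times> ?S)"
      by (simp add: PiE_insert_eq)
    then show ?thesis
      by auto
  qed
  have disj: "(\<lambda>g. g(j := Plus)) ` ?S \<inter> (\<lambda>g. g(j := Minus)) ` ?S = {}"
    by (auto dest!: fun_cong[of _ _ j])
  have "(\<Oplus>s\<in>insert j I \<rightarrow>\<^sub>E UNIV. ?Q s)
      = (\<Oplus>s\<in>(\<lambda>g. g(j := Plus)) ` ?S. ?Q s) \<oplus> (\<Oplus>s\<in>(\<lambda>g. g(j := Minus)) ` ?S. ?Q s)"
    unfolding split by (rule finsum_Un_disjoint) (use fin disj Q in auto)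
  also have "\<dots> = (G j Plus \<oplus> G j Minus) \<otimes> (\<Oplus>s\<in>?S. ?P s)"
    unfolding half by (rule l_distr [symmetric]) (use P Gj in \<open>auto intro!: finsum_closed\<close>)
  also have "(\<Oplus>s\<in>?S. ?P s) = (\<Otimes>i\<in>I. G i Plus \<oplus> G i Minus)"
    using insert by auto
  also have "(G j Plus \<oplus> G j Minus) \<otimes> (\<Otimes>i\<in>I. G i Plus \<oplus> G i Minus)
      = (\<Otimes>i\<in>insert j I. G i Plus \<oplus> G i Minus)"
    by (rule finprod_insert [symmetric]) (use insert in auto)
  finally show ?case by simp
qed

section \<open>Roots of unity and cyclotomic polynomials\<close>

text \<open>
  In characteristic 0 the polynomial \<open>x\<^sup>n - 1\<close> has no common root with its derivative, so over an
  algebraically closed field it splits into distinct linear factors.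
\<close>

lemma roots_of_unity_card_prod:
  assumes "n > 0"
  shows "finite {z :: 'a::{alg_closed_field,field_char_0}. z ^ n = 1}"
    and "card {z :: 'a. z ^ n = 1} = n"
    and "(\<Prod>z | z ^ n = 1. [:- z, 1 :: 'a:]) = Polynomial.monom 1 n - 1"
proof -
  let ?P = "Polynomial.monom 1 n - 1 :: 'a poly"
  have coeff_n: "poly.coeff ?P n = 1"
    using assms by (simp add: coeff_1)
  have nz: "?P \<noteq> 0"
    using coeff_n by force
  have deg: "Polynomial.degree ?P = n"
  proof (rule antisym)
    show "Polynomial.degree ?P \<le> n"
      using assms by (intro degree_diff_le degree_monom_le) auto
    show "n \<le> Polynomial.degree ?P"
      by (rule le_degree) (use coeff_n in force)
  qed
  have roots: "poly ?P z = 0 \<longleftrightarrow> z ^ n = 1" for z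
    by (simp add: poly_monom)
  obtain A where A: "size A = Polynomial.degree ?P" "?P = Polynomial.smult (poly.coeff ?P (Polynomial.degree ?P)) (\<Prod>x\<in>#A. [:-x, 1:])"
    using alg_closed_imp_factorization[OF nz] by blast
  have P_eq: "?P = (\<Prod>x\<in>#A. [:-x, 1:])"
    using A(2) by (simp only: deg coeff_n smult_1_left)
  have "proots ?P = proots (\<Prod>x\<in>#A. [:-x, 1:])"
    by (simp only: P_eq)
  also have "\<dots> = A"
  proof (induction A)
    case (add x A)
    have "proots [:- x, 1:] = {#x#}"
      by simp
    moreover have "(\<Prod>x\<in>#A. [:- x, 1 :: 'a:]) \<noteq> 0"
      by (auto simp: prod_mset_zero_iff)
    ultimately show ?case
      using add by (simp add: proots_mult del: mult_pCons_left mult_pCons_right)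
  qed simp
  finally have proots: "proots ?P = A" .
  have "rsquarefree ?P"
    unfolding rsquarefree_roots
  proof (intro allI notI, elim conjE)
    fix a assume "poly ?P a = 0" "poly (pderiv ?P) a = 0"
    then have "a ^ n = 1" "of_nat n * a ^ (n - 1) = 0"
      by (simp_all add: poly_monom pderiv_diff pderiv_monom)
    moreover from this have "a \<noteq> 0"
      using assms by (auto simp: power_0_left)
    ultimately show False
      using assms by simp
  qed
  then have "count A z \<le> 1" for z
    using nz unfolding proots[symmetric] rsquarefree_def by (metis count_proots le_numeral_extra(4) zero_le)
  moreover have set_A: "set_mset A = {z. z ^ n = 1}"
    using nz roots by (simp flip: proots)
  ultimately have A_eq: "A = mset_set {z. z ^ n = 1}"
    using finite_set_mset[of A]
    by (intro multiset_eqI) (metis count_eq_zero_iff count_mset_set(1,3) le_less_Suc_eq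
      less_Suc_eq_le less_one linorder_not_less not_less_eq_eq One_nat_def)
  show fin: "finite {z :: 'a. z ^ n = 1}"
    using finite_set_mset[of A] by (simp add: set_A)
  show "card {z :: 'a. z ^ n = 1} = n"
    using A(1) deg by (simp add: A_eq)
  show "(\<Prod>z | z ^ n = 1. [:- z, 1 :: 'a:]) = Polynomial.monom 1 n - 1"
    using P_eq fin by (simp add: A_eq prod_unfold_prod_mset)
qed

text \<open>
  The order of a root of unity of order dividing \<open>p\<^sup>l\<close> is a power of \<open>p\<close>, so if it does not divide
  \<open>p\<^bsup>l-1\<^esup>\<close> it is \<open>p\<^sup>l\<close>.
\<close>

lemma primitive_prime_power_root_iff:
  fixes z :: "'a::field"
  assumes "prime p" "l > 0"
  shows "z ^ (p ^ l) = 1 \<and> (\<forall>d. 0 < d \<and> d < p ^ l \<longrightarrow> z ^ d \<noteq> 1) \<longleftrightarrow>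
    z ^ (p ^ l) = 1 \<and> z ^ (p ^ (l - 1)) \<noteq> 1"
proof (intro iffI conjI; (elim conjE)?)
  have p: "p > 1" using assms(1) by (rule prime_gt_1_nat)
  assume "\<forall>d. 0 < d \<and> d < p ^ l \<longrightarrow> z ^ d \<noteq> 1"
  moreover have "p ^ (l - 1) < p ^ l" "0 < p ^ (l - 1)"
    using p assms(2) by auto
  ultimately show "z ^ (p ^ (l - 1)) \<noteq> 1"
    by blast
next
  assume z: "z ^ (p ^ l) = 1" "z ^ (p ^ (l - 1)) \<noteq> 1"
  have p: "p > 1" using assms(1) by (rule prime_gt_1_nat)
  have key: "z ^ gcd a b = 1" if ab: "z ^ a = 1" "z ^ b = 1" "a > 0" for a b :: nat
  proof -
    obtain x y where "a * x = b * y + gcd a b"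
      using bezout_nat[of a b] ab(3) by auto
    then have "z ^ (a * x) = z ^ (b * y) * z ^ gcd a b"
      by (simp flip: power_add)
    then show ?thesis
      using ab by (simp add: power_mult)
  qed
  show "\<forall>d. 0 < d \<and> d < p ^ l \<longrightarrow> z ^ d \<noteq> 1"
  proof (intro allI impI notI, elim conjE)
    fix d assume d: "0 < d" "d < p ^ l" "z ^ d = 1"
    have "gcd d (p ^ l) dvd p ^ l" by simp
    then obtain j where j: "j \<le> l" "gcd d (p ^ l) = p ^ j"
      using divides_primepow_nat[OF assms(1)] by blast
    have "p ^ j \<le> d"
      using d(1) by (metis j(2) gcd_le1_nat not_gr_zero)
    then have "j \<noteq> l"
      using d(2) by auto
    then have "p ^ j dvd p ^ (l - 1)"
      using j(1) by (intro le_imp_power_dvd) auto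
    then obtain c where c: "p ^ (l - 1) = p ^ j * c" ..
    have "z ^ (p ^ j) = 1"
      using key[of d "p ^ l"] d z j by simp
    then show False
      using z(2)[unfolded c power_mult] by simp
  qed
qed auto

text \<open>
  The product over the primitive roots is the quotient of \<open>x\<^bsup>qp\<^esup> - 1\<close> by \<open>x\<^sup>q - 1\<close>, where \<open>q = p\<^bsup>l-1\<^esup>\<close>; this
  quotient is a geometric sum.
\<close>

lemma cyclotomic_poly_prime_power:
  assumes "prime p" "l > 0"
  shows "(cyclotomic_poly (p ^ l) :: 'a::{alg_closed_field,field_char_0} poly) =
    (\<Sum>i<p. Polynomial.monom 1 (p ^ (l - 1) * i))"
proof -
  have p: "p > 1" using assms(1) by (rule prime_gt_1_nat)
  define q where "q = p ^ (l - 1)"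
  have q: "q > 0" "p ^ l = q * p"
    using p assms(2) by (auto simp: q_def simp flip: power_Suc2)
  define Old where "Old = {z :: 'a. z ^ q = 1}"
  define New where "New = {z :: 'a. z ^ (p ^ l) = 1 \<and> z ^ q \<noteq> 1}"
  have all: "{z :: 'a. z ^ (p ^ l) = 1} = Old \<union> New" "Old \<inter> New = {}"
    by (auto simp: Old_def New_def q(2) power_mult)
  have fin: "finite Old" "finite New"
    using roots_of_unity_card_prod(1)[where ?'a = 'a, of "p ^ l"] p unfolding all by auto
  have "(Polynomial.monom 1 q - 1) * cyclotomic_poly (p ^ l) =
      (\<Prod>z\<in>Old. [:- z, 1:]) * (\<Prod>z\<in>New. [:- z, 1 :: 'a:])"
    unfolding cyclotomic_poly_def primitive_prime_power_root_iff[OF assms]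
    using roots_of_unity_card_prod(3)[where ?'a = 'a, OF q(1)] by (simp add: Old_def New_def q_def)
  also have "\<dots> = (\<Prod>z | z ^ (p ^ l) = 1. [:- z, 1 :: 'a:])"
    unfolding all by (rule prod.union_disjoint [symmetric]) (use fin all in auto)
  also have "\<dots> = Polynomial.monom 1 (p ^ l) - 1"
    by (rule roots_of_unity_card_prod(3)) (use p in simp)
  also have "\<dots> = Polynomial.monom 1 q ^ p - 1"
    by (simp add: q(2) monom_power)
  also have "\<dots> = (Polynomial.monom 1 q - 1) * (\<Sum>i<p. Polynomial.monom 1 q ^ i)"
    by (rule power_diff_1_eq)
  also have "(\<Sum>i<p. Polynomial.monom 1 q ^ i) = (\<Sum>i<p. Polynomial.monom (1 :: 'a) (q * i))"
    by (simp add: monom_power)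
  finally have "(Polynomial.monom 1 q - 1) * cyclotomic_poly (p ^ l) =
      (Polynomial.monom 1 q - 1) * (\<Sum>i<p. Polynomial.monom (1 :: 'a) (q * i))" .
  moreover have "poly.coeff (Polynomial.monom 1 q - 1 :: 'a poly) q = 1"
    using q(1) by (simp add: coeff_1)
  then have "Polynomial.monom 1 q - 1 \<noteq> (0 :: 'a poly)"
    by force
  ultimately show ?thesis
    by (simp add: q_def)
qed

section \<open>Algebraic numbers in the two completions\<close>

lemma field_embedding_simps:
  assumes "field_embedding h"
  shows "h 0 = 0" "h 1 = 1" "h (x + y) = h x + h y" "h (x * y) = h x * h y"
    "h (- x) = - h x" "h (x ^ n) = h x ^ n" "h (of_nat k) = of_nat k"
proof -
  have add: "h (x + y) = h x + h y" and mult: "h (x * y) = h x * h y" and one: "h 1 = 1" for x y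
    using assms by (auto simp: field_embedding_def)
  show zero: "h 0 = 0"
    using add[of 0 0] by (metis add.right_neutral add_left_cancel)
  show "h (- x) = - h x"
    using add[of x "- x"] zero by (simp add: eq_neg_iff_add_eq_0 add.commute)
  show "h (x ^ n) = h x ^ n"
    by (induction n) (auto simp: one mult)
  show "h (of_nat k) = of_nat k"
    by (induction k) (auto simp: zero one add)
qed (use assms in \<open>auto simp: field_embedding_def\<close>)

lemma field_embedding_inj:
  fixes h :: "'a::field \<Rightarrow> 'b::field"
  assumes "field_embedding h"
  shows "inj h"
proof (rule injI)
  fix x y assume "h x = h y"
  note [simp] = field_embedding_simps[OF assms]
  have "h (x - y) = 0"
    using \<open>h x = h y\<close> field_embedding_simps(3)[OF assms, of x "- y"] by simp
  moreover have "h (x - y) * h (inverse (x - y)) = 1" if "x \<noteq> y"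
    using that by (simp flip: field_embedding_simps(4)[OF assms])
  ultimately show "x = y" by auto
qed

text \<open>
  Both fields contain exactly \<open>n\<close> roots of unity of order dividing \<open>n\<close>, so an embedding hits all of them; and
  two \<open>n\<close>-th roots of the same element differ by one.
\<close>

lemma root_in_range_embedding:
  fixes h :: "'a::{alg_closed_field,field_char_0} \<Rightarrow> 'b::{alg_closed_field,field_char_0}"
  assumes h: "field_embedding h" and n: "n > 0" and z: "z ^ n \<in> range h"
  shows "z \<in> range h"
proof -
  note [simp] = field_embedding_simps[OF h]
  obtain a where a: "z ^ n = h a" using z by auto
  obtain y where y: "y ^ n = a"
    using nth_root_exists[OF n] by blast
  have hy: "h y ^ n = z ^ n"
    using y a by (simp flip: field_embedding_simps(6)[OF h])
  show ?thesis
  proof (cases "h y = 0")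
    case True
    then have "z = 0"
      using hy n by (metis power_eq_0_iff zero_power)
    then show ?thesis
      by (metis field_embedding_simps(1)[OF h] rangeI)
  next
    case False
    have inj: "inj h" by (rule field_embedding_inj[OF h])
    have "h ` {w. w ^ n = 1} = {w. w ^ n = 1}"
    proof (rule card_subset_eq)
      show "finite {w :: 'b. w ^ n = 1}"
        by (rule roots_of_unity_card_prod(1)[OF n])
      show "h ` {w. w ^ n = 1} \<subseteq> {w. w ^ n = 1}"
        by (auto simp flip: field_embedding_simps(6)[OF h])
      show "card (h ` {w. w ^ n = 1}) = card {w :: 'b. w ^ n = 1}"
        using inj by (subst card_image) (auto intro: inj_on_subset simp: roots_of_unity_card_prod(2)[OF n])
    qed
    moreover have "(z / h y) ^ n = 1"
      using False by (simp add: power_divide flip: hy)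
    ultimately obtain w where "z / h y = h w"
      by blast
    then have "z = h (w * y)"
      using False by (simp add: field_simps)
    then show ?thesis by blast
  qed
qed

text \<open>
  The value \<open>\<epsilon>(p)\<close> is a root of unity since \<open>p\<close> is prime to the modulus, so some power of a
  root of \<open>x\<^sup>2 + \<epsilon>(p)p\<^bsup>k-1\<^esup>\<close> is an integer.
\<close>

lemma hecke_root_in_range:
  fixes \<alpha> :: complex
  assumes h: "field_embedding (iinf :: qbar \<Rightarrow> complex)" and p: "prime p" "\<not> p dvd N"
    and eps: "dirichlet_character N eps" and root: "\<alpha> \<in> hecke_roots p k eps"
  shows "\<alpha> \<in> range iinf"
proof -
  note [simp] = field_embedding_simps[OF h]
  have cop: "coprime p N"
    using p by (simp add: prime_imp_coprime)
  have eps_power: "eps (int p ^ n) = eps (int p) ^ n" for n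
  proof (induction n)
    case 0
    have mult: "\<forall>a b. eps (a * b) = eps a * eps b" and unit: "\<forall>a. eps a \<noteq> 0 \<longleftrightarrow> coprime a (int N)"
      using eps unfolding dirichlet_character_def by blast+
    have "eps 1 * eps 1 = eps 1"
      using spec[OF spec[OF mult, of 1], of 1] by simp
    moreover have "eps 1 \<noteq> 0"
      using spec[OF unit, of 1] by simp
    ultimately show ?case by simp
  next
    case (Suc n)
    then show ?case
      using eps by (simp add: dirichlet_character_def)
  qed
  have N: "N > 0" using eps by (simp add: dirichlet_character_def)
  then have tot: "totient N > 0" by simp
  have "[int p ^ totient N = 1] (mod int N)"
    using euler_theorem[OF cop] by (metis cong_int_iff of_nat_1 of_nat_power)
  then have "eps (int p ^ totient N) = eps (int p ^ 0)"
    using eps by (simp add: dirichlet_character_def)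
  then have eps1: "eps (int p) ^ totient N = 1"
    using eps_power[of 0] eps_power[of "totient N"] by simp
  have "\<alpha>\<^sup>2 = - (eps (int p) * of_nat p ^ (k - 1))"
    using root by (simp add: hecke_roots_def eq_neg_iff_add_eq_0)
  then have "\<alpha> ^ (2 * totient N) = (- (eps (int p) * of_nat p ^ (k - 1))) ^ totient N"
    by (simp add: power_mult)
  also have "\<dots> = iinf ((- (of_nat p ^ (k - 1))) ^ totient N)"
    by (simp add: power_minus[of "_ * _"] power_minus[of "_ ^ _"] power_mult_distrib eps1)
  finally have "\<alpha> ^ (2 * totient N) \<in> range iinf"
    by blast
  then show ?thesis
    by (rule root_in_range_embedding[OF h, rotated]) (use tot in simp)
qed

lemma to_padic_embedding:
  assumes "field_embedding iinf"
  shows "to_padic iinf ip (iinf x) = ip x"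
  unfolding to_padic_def using field_embedding_inj[OF assms] by simp

lemma alpha_i_Minus: "alpha_i p k m \<alpha> i Minus = - alpha_i p k m \<alpha> i Plus"
  by (simp add: alpha_i_def)

lemma alpha_i_in_range:
  assumes iinf: "field_embedding iinf" and \<alpha>: "\<alpha> \<in> range iinf"
  shows "alpha_i p k m \<alpha> i Plus \<in> range iinf"
proof -
  obtain a where a: "\<alpha> = iinf a" using \<alpha> by blast
  have "alpha_i p k m \<alpha> i Plus = iinf ((if even m then 1 else a) * of_nat p ^ twist_i k m i)"
    by (simp add: alpha_i_def a field_embedding_simps[OF iinf])
  then show ?thesis by blast
qed

lemma to_padic_alpha_i:
  assumes iinf: "field_embedding iinf" and ip: "field_embedding ip" and \<alpha>: "\<alpha> \<in> range iinf"
  shows "to_padic iinf ip (alpha_i p k m \<alpha> i Plus) =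
    (if even m then 1 else to_padic iinf ip \<alpha>) * of_nat p ^ twist_i k m i"
proof -
  obtain a where a: "\<alpha> = iinf a" using \<alpha> by blast
  have "alpha_i p k m \<alpha> i Plus = iinf ((if even m then 1 else a) * of_nat p ^ twist_i k m i)"
    by (simp add: alpha_i_def a field_embedding_simps[OF iinf])
  then show ?thesis
    by (simp add: a to_padic_embedding[OF iinf] field_embedding_simps[OF ip])
qed

lemma to_padic_minus:
  assumes iinf: "field_embedding iinf" and ip: "field_embedding ip" and "\<beta> \<in> range iinf"
  shows "to_padic iinf ip (- \<beta>) = - to_padic iinf ip \<beta>"
proof -
  obtain b where "\<beta> = iinf b" using assms(3) by blast
  then have "- \<beta> = iinf (- b)"
    by (simp add: field_embedding_simps[OF iinf])
  then show ?thesis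
    using \<open>\<beta> = iinf b\<close> by (simp only: to_padic_embedding[OF iinf] field_embedding_simps[OF ip])
qed

section \<open>Complete ultrametric fields and finite extensions of \<open>\<rat>\<^sub>p\<close>\<close>

abbreviation vnorm :: "'c::{zero,metric_space} \<Rightarrow> real" where
  "vnorm x \<equiv> dist x 0"

text \<open>
  The field \<open>\<complex>\<^sub>p\<close>.  Since its type carries only a metric, and no class relating the metric to the field
  operations, the continuity of these operations is derived here from the ultrametric absolute value.
\<close>

locale padic_field =
  fixes p :: nat and ty :: "'c::{alg_closed_field,field_char_0,complete_space} itself"
  assumes prime_p: "prime p" and Cp: "padic_complex_field p ty"
begin

lemma p_ge_2: "p \<ge> 2"
  using prime_p by (rule prime_ge_2_nat)

lemma dist_vnorm: "dist x y = vnorm (x - y)" for x y :: 'c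
  using Cp by (simp add: padic_complex_field_def)

lemma vnorm_mult: "vnorm (x * y) = vnorm x * vnorm y" for x y :: 'c
  using Cp by (simp add: padic_complex_field_def)

lemma vnorm_add: "vnorm (x + y) \<le> max (vnorm x) (vnorm y)" for x y :: 'c
  using Cp by (simp add: padic_complex_field_def)

lemma vnorm_p: "vnorm (of_nat p :: 'c) = 1 / real p"
  using Cp by (simp add: padic_complex_field_def)

lemma vnorm_one [simp]: "vnorm (1 :: 'c) = 1"
proof -
  have "vnorm (1 :: 'c) * vnorm (1 :: 'c) = vnorm (1 :: 'c) * 1"
    by (simp flip: vnorm_mult)
  then show ?thesis
    by (subst (asm) mult_left_cancel) auto
qed

lemma vnorm_minus [simp]: "vnorm (- x) = vnorm x" for x :: 'c
proof -
  have "vnorm (- 1 :: 'c) ^ 2 = 1"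
    by (simp add: power2_eq_square flip: vnorm_mult)
  then have "vnorm (- 1 :: 'c) = 1"
    using power2_eq_1_iff[of "vnorm (- 1 :: 'c)"] zero_le_dist[of "- 1 :: 'c" 0] by linarith
  then show ?thesis
    using vnorm_mult[of "- 1" x] by simp
qed

lemma vnorm_diff: "vnorm (x - y) \<le> max (vnorm x) (vnorm y)" for x y :: 'c
  using vnorm_add[of x "- y"] by simp

lemma vnorm_power: "vnorm (x ^ n) = vnorm x ^ n" for x :: 'c
  by (induction n) (auto simp: vnorm_mult)

lemma vnorm_inverse: "vnorm (inverse x) = inverse (vnorm x)" for x :: 'c
proof (cases "x = 0")
  case False
  then have "vnorm x * vnorm (inverse x) = 1"
    by (simp flip: vnorm_mult)
  then show ?thesis
    by (simp add: inverse_unique)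
qed auto

lemma vnorm_divide: "vnorm (x / y) = vnorm x / vnorm y" for x y :: 'c
  by (simp add: divide_inverse vnorm_mult vnorm_inverse)

lemma vnorm_sum:
  fixes f :: "'i \<Rightarrow> 'c"
  assumes "\<And>i. i \<in> A \<Longrightarrow> vnorm (f i) \<le> B" "B \<ge> 0"
  shows "vnorm (\<Sum>i\<in>A. f i) \<le> B"
  using assms(1)
proof (induction A rule: infinite_finite_induct)
  case (insert i A)
  have "vnorm (f i + sum f A) \<le> max (vnorm (f i)) (vnorm (sum f A))"
    by (rule vnorm_add)
  also have "\<dots> \<le> B"
    using insert by simp
  finally show ?case
    using insert by simp
qed (use assms(2) in auto)

lemma vnorm_of_nat_le: "vnorm (of_nat n :: 'c) \<le> 1"
proof -
  have "vnorm (\<Sum>i<n. 1 :: 'c) \<le> 1"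
    by (rule vnorm_sum) auto
  then show ?thesis by simp
qed

lemma vnorm_of_int_le: "vnorm (of_int n :: 'c) \<le> 1"
  by (cases n rule: int_cases2) (simp_all add: vnorm_of_nat_le)

lemma vnorm_of_int_dvd:
  assumes "int p ^ k dvd n"
  shows "vnorm (of_int n :: 'c) \<le> 1 / real p ^ k"
proof -
  obtain c where c: "n = int p ^ k * c"
    using assms by auto
  have "vnorm (of_int n :: 'c) = (1 / real p) ^ k * vnorm (of_int c :: 'c)"
    by (simp add: c vnorm_mult vnorm_power vnorm_p)
  also have "\<dots> \<le> (1 / real p) ^ k * 1"
    by (intro mult_left_mono vnorm_of_int_le) auto
  finally show ?thesis
    by (simp add: power_one_over)
qed

text \<open>
  By Bezout \<open>1\<close> is a sum of a multiple of \<open>p\<close>, of absolute value less than 1, and a multiple of \<open>n\<close>.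
\<close>

lemma vnorm_of_int_coprime:
  assumes "\<not> int p dvd n"
  shows "vnorm (of_int n :: 'c) = 1"
proof -
  have "coprime (int p) n"
    using assms prime_p by (intro prime_imp_coprime) auto
  then obtain a b where ab: "a * int p + b * n = 1"
    using bezout_int[of "int p" n] by auto
  have "(1 :: 'c) = of_int (a * int p + b * n)"
    by (simp only: ab of_int_1)
  also have "\<dots> = of_int a * of_nat p + of_int b * of_int n"
    by simp
  finally have "1 \<le> max (vnorm (of_int a * of_nat p :: 'c)) (vnorm (of_int b * of_int n :: 'c))"
    using vnorm_add[of "of_int a * of_nat p" "of_int b * of_int n"] by simp
  moreover have "vnorm (of_int a * of_nat p :: 'c) \<le> 1 * (1 / real p)"
    unfolding vnorm_mult vnorm_p by (intro mult_right_mono vnorm_of_int_le) auto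
  moreover have "1 * (1 / real p) < 1"
    using p_ge_2 by simp
  moreover have "vnorm (of_int b * of_int n :: 'c) \<le> 1 * vnorm (of_int n :: 'c)"
    unfolding vnorm_mult by (intro mult_right_mono vnorm_of_int_le) auto
  ultimately show ?thesis
    using vnorm_of_int_le[of n] by linarith
qed

text \<open>
  The absolute value of \<open>n\<close> is \<open>p\<^bsup>-e\<^esup>\<close>, where the power \<open>p\<^sup>e\<close> divides \<open>n\<close> and therefore is at most \<open>n\<close>.
\<close>

lemma vnorm_of_nat_ge:
  assumes "n > 0"
  shows "1 / real n \<le> vnorm (of_nat n :: 'c)"
proof -
  obtain m where m: "n = p ^ multiplicity p n * m" "\<not> p dvd m"
    using assms prime_p by (metis multiplicity_decompose' not_prime_unit not_gr_zero)
  have "vnorm (of_nat m :: 'c) = 1"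
    using vnorm_of_int_coprime[of "int m"] m(2) by simp
  then have "vnorm (of_nat n :: 'c) = 1 / real p ^ multiplicity p n"
    by (subst m(1)) (simp add: vnorm_mult vnorm_power vnorm_p power_one_over)
  moreover have "p ^ multiplicity p n \<le> n"
    using assms by (intro dvd_imp_le multiplicity_dvd) auto
  then have "1 / real n \<le> 1 / real p ^ multiplicity p n"
    using p_ge_2 assms by (intro divide_left_mono) (auto simp flip: of_nat_power)
  ultimately show ?thesis by simp
qed

lemma tendsto_vnorm_iff: "Z \<longlonglongrightarrow> L \<longleftrightarrow> (\<lambda>n. vnorm (Z n - L)) \<longlonglongrightarrow> 0" for L :: 'c
  unfolding tendsto_dist_iff[of Z L] by (subst dist_vnorm) (rule refl)

lemma tendsto_null_le:
  fixes Z :: "nat \<Rightarrow> 'c"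
  assumes "f \<longlonglongrightarrow> 0" "\<And>n. vnorm (Z n - L) \<le> f n"
  shows "Z \<longlonglongrightarrow> L"
  unfolding tendsto_vnorm_iff
  by (rule tendsto_sandwich[OF _ _ tendsto_const assms(1)]) (use assms(2) in auto)

lemma tendsto_padd:
  fixes Z Y :: "nat \<Rightarrow> 'c"
  assumes "Z \<longlonglongrightarrow> x" "Y \<longlonglongrightarrow> y"
  shows "(\<lambda>n. Z n + Y n) \<longlonglongrightarrow> x + y"
proof (rule tendsto_null_le)
  show "(\<lambda>n. max (vnorm (Z n - x)) (vnorm (Y n - y))) \<longlonglongrightarrow> 0"
    using tendsto_max[OF assms[unfolded tendsto_vnorm_iff]] by simp
  show "vnorm (Z n + Y n - (x + y)) \<le> max (vnorm (Z n - x)) (vnorm (Y n - y))" for n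
    using vnorm_add[of "Z n - x" "Y n - y"] by (simp add: algebra_simps)
qed

lemma tendsto_pmult_left:
  fixes Z :: "nat \<Rightarrow> 'c"
  assumes "Z \<longlonglongrightarrow> x"
  shows "(\<lambda>n. c * Z n) \<longlonglongrightarrow> c * x"
proof (rule tendsto_null_le)
  show "(\<lambda>n. vnorm c * vnorm (Z n - x)) \<longlonglongrightarrow> 0"
    using tendsto_mult_right_zero[OF assms[unfolded tendsto_vnorm_iff]] by simp
qed (simp flip: vnorm_mult right_diff_distrib)

lemma tendsto_pminus:
  fixes Z Y :: "nat \<Rightarrow> 'c"
  assumes "Z \<longlonglongrightarrow> x" "Y \<longlonglongrightarrow> y"
  shows "(\<lambda>n. Z n - Y n) \<longlonglongrightarrow> x - y"
  using tendsto_padd[OF assms(1) tendsto_pmult_left[OF assms(2), of "- 1"]] by simp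

lemma tendsto_pmult:
  fixes Z Y :: "nat \<Rightarrow> 'c"
  assumes "Z \<longlonglongrightarrow> x" "Y \<longlonglongrightarrow> y"
  shows "(\<lambda>n. Z n * Y n) \<longlonglongrightarrow> x * y"
proof -
  have "(\<lambda>n. (Z n - x) * (Y n - y)) \<longlonglongrightarrow> 0"
    using tendsto_mult[OF assms[unfolded tendsto_vnorm_iff]]
    by (subst tendsto_vnorm_iff) (simp add: vnorm_mult)
  then have "(\<lambda>n. (Z n - x) * (Y n - y) + (x * Y n + y * Z n)) \<longlonglongrightarrow> 0 + (x * y + y * x)"
    by (intro tendsto_padd tendsto_pmult_left assms)
  then have "(\<lambda>n. (Z n - x) * (Y n - y) + (x * Y n + y * Z n) - x * y) \<longlonglongrightarrow>
      (0 + (x * y + y * x)) - x * y"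
    by (intro tendsto_pminus tendsto_const)
  then show ?thesis
    by (simp add: algebra_simps)
qed

lemma tendsto_pinverse:
  fixes Z :: "nat \<Rightarrow> 'c"
  assumes "Z \<longlonglongrightarrow> x" "x \<noteq> 0"
  shows "(\<lambda>n. inverse (Z n)) \<longlonglongrightarrow> inverse x"
proof -
  have lim: "(\<lambda>n. vnorm (Z n)) \<longlonglongrightarrow> vnorm x"
    by (intro tendsto_intros assms)
  have "(\<lambda>n. vnorm (Z n - x) * inverse (vnorm (Z n) * vnorm x)) \<longlonglongrightarrow> 0 * inverse (vnorm x * vnorm x)"
    using assms(2) assms(1)[unfolded tendsto_vnorm_iff]
    by (intro tendsto_mult tendsto_inverse lim tendsto_const) auto
  moreover have "\<forall>\<^sub>F n in sequentially. Z n \<noteq> 0"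
    using assms by (intro tendsto_imp_eventually_ne)
  then have "\<forall>\<^sub>F n in sequentially.
    vnorm (Z n - x) * inverse (vnorm (Z n) * vnorm x) = vnorm (inverse (Z n) - inverse x)"
  proof eventually_elim
    case (elim n)
    then have "inverse (Z n) - inverse x = - ((Z n - x) * inverse (Z n * x))"
      using assms(2) by (simp add: field_simps)
    then show ?case
      by (simp only: vnorm_minus vnorm_mult vnorm_inverse)
  qed
  ultimately show ?thesis
    unfolding tendsto_vnorm_iff by (simp add: tendsto_cong)
qed

lemma vnorm_limit_le:
  fixes Z :: "nat \<Rightarrow> 'c"
  assumes "Z \<longlonglongrightarrow> x" "\<And>n. vnorm (Z n) \<le> B"
  shows "vnorm x \<le> B"
proof (rule tendsto_upperbound)
  show "(\<lambda>n. vnorm (Z n)) \<longlonglongrightarrow> vnorm x"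
    by (intro tendsto_intros assms)
qed (use assms in auto)

text \<open>
  By the ultrametric inequality the distance between two terms is at most the largest of the consecutive
  differences between them.
\<close>

lemma convergent_if_differences_null:
  fixes Z :: "nat \<Rightarrow> 'c"
  assumes "(\<lambda>n. vnorm (Z (Suc n) - Z n)) \<longlonglongrightarrow> 0"
  shows "convergent Z"
proof -
  have "Cauchy Z"
  proof (rule metric_CauchyI)
    fix e :: real assume e: "e > 0"
    then obtain N where N: "\<And>n. n \<ge> N \<Longrightarrow> vnorm (Z (Suc n) - Z n) < e / 2"
      using order_tendstoD(2)[OF assms, of "e / 2"] by (auto simp: eventually_sequentially)
    have le: "vnorm (Z (N + k) - Z N) \<le> e / 2" for k
    proof (induction k)
      case (Suc k)
      have "vnorm (Z (N + Suc k) - Z N) \<le>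
          max (vnorm (Z (Suc (N + k)) - Z (N + k))) (vnorm (Z (N + k) - Z N))"
        using vnorm_add[of "Z (Suc (N + k)) - Z (N + k)" "Z (N + k) - Z N"] by simp
      then show ?case
        using Suc N[of "N + k"] by simp
    qed (use e in simp)
    show "\<exists>M. \<forall>m\<ge>M. \<forall>n\<ge>M. dist (Z m) (Z n) < e"
    proof (intro exI allI impI)
      fix m n assume mn: "m \<ge> N" "n \<ge> N"
      have "vnorm (Z m - Z n) \<le> max (vnorm (Z m - Z N)) (vnorm (Z n - Z N))"
        using vnorm_diff[of "Z m - Z N" "Z n - Z N"] by simp
      then show "dist (Z m) (Z n) < e"
        using le[of "m - N"] le[of "n - N"] mn e dist_vnorm[of "Z m" "Z n"] by simp
    qed
  qed
  then show ?thesis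
    by (rule Cauchy_convergent)
qed

lemma sums_suminf_if_null:
  fixes f :: "nat \<Rightarrow> 'c"
  assumes "(\<lambda>n. vnorm (f n)) \<longlonglongrightarrow> 0"
  shows "f sums suminf f"
proof -
  have "convergent (\<lambda>n. \<Sum>i<n. f i)"
    by (rule convergent_if_differences_null) (use assms in simp)
  then have "summable f"
    by (simp add: summable_iff_convergent)
  then show ?thesis
    by (rule summable_sums)
qed

lemma sums_padd:
  fixes f g :: "nat \<Rightarrow> 'c"
  assumes "f sums a" "g sums b"
  shows "(\<lambda>n. f n + g n) sums (a + b)"
  using tendsto_padd[OF assms[unfolded sums_def]] by (simp add: sums_def sum.distrib)

lemma sums_vnorm_le:
  fixes f :: "nat \<Rightarrow> 'c"
  assumes "f sums a" "\<And>n. vnorm (f n) \<le> B"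
  shows "vnorm a \<le> B"
proof -
  have "0 \<le> vnorm (f 0)" by simp
  also have "\<dots> \<le> B" by (rule assms(2))
  finally have "0 \<le> B" .
  with assms(2) have "vnorm (\<Sum>i<n. f i) \<le> B" for n
    by (rule vnorm_sum)
  then show ?thesis
    by (rule vnorm_limit_le[OF assms(1)[unfolded sums_def]])
qed

lemma closed_limit:
  fixes S :: "'c set"
  assumes "closed S" "Z \<longlonglongrightarrow> x" "\<And>n. Z n \<in> S"
  shows "x \<in> S"
  using assms closed_sequential_limits by blast

lemma closed_Qp: "closed (Qp :: 'c set)"
  by (simp add: Qp_def)

lemma Rats_subset_Qp: "\<rat> \<subseteq> (Qp :: 'c set)"
  by (simp add: Qp_def closure_subset)

lemma Qp_sequence:
  assumes "x \<in> (Qp :: 'c set)"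
  obtains Z where "\<And>n. Z n \<in> \<rat>" "Z \<longlonglongrightarrow> x"
  using assms unfolding Qp_def closure_sequential by blast

lemma Qp_add: "x + y \<in> Qp" and Qp_mult: "x * y \<in> Qp" if "x \<in> Qp" "y \<in> Qp" for x y :: 'c
proof -
  obtain Z where Z: "\<And>n. Z n \<in> \<rat>" "Z \<longlonglongrightarrow> x"
    using \<open>x \<in> Qp\<close> by (rule Qp_sequence) blast
  obtain Y where Y: "\<And>n. Y n \<in> \<rat>" "Y \<longlonglongrightarrow> y"
    using \<open>y \<in> Qp\<close> by (rule Qp_sequence) blast
  show "x + y \<in> Qp"
    using closed_Qp tendsto_padd[OF Z(2) Y(2)]
    by (rule closed_limit) (use Z(1) Y(1) Rats_subset_Qp Rats_add in blast)
  show "x * y \<in> Qp"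
    using closed_Qp tendsto_pmult[OF Z(2) Y(2)]
    by (rule closed_limit) (use Z(1) Y(1) Rats_subset_Qp Rats_mult in blast)
qed

lemma Qp_of_int: "of_int n \<in> (Qp :: 'c set)" and Qp_of_nat: "of_nat k \<in> (Qp :: 'c set)"
  using Rats_subset_Qp by auto

lemma Qp_0: "0 \<in> (Qp :: 'c set)" and Qp_1: "1 \<in> (Qp :: 'c set)"
  using Rats_subset_Qp by auto

lemma Qp_minus: "- x \<in> Qp" if "x \<in> Qp" for x :: 'c
  using Qp_mult[OF Qp_of_int[of "- 1"] that] by simp

lemma Qp_diff: "x - y \<in> Qp" if "x \<in> Qp" "y \<in> Qp" for x y :: 'c
  using Qp_add[OF that(1) Qp_minus[OF that(2)]] by simp

lemma Qp_inverse: "inverse x \<in> Qp" if "x \<in> Qp" for x :: 'c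
proof (cases "x = 0")
  case True
  then show ?thesis by (simp add: Qp_0)
next
  case False
  obtain Z where Z: "\<And>n. Z n \<in> \<rat>" "Z \<longlonglongrightarrow> x"
    using \<open>x \<in> Qp\<close> by (rule Qp_sequence) blast
  show ?thesis
    using closed_Qp tendsto_pinverse[OF Z(2) False]
    by (rule closed_limit) (use Z(1) Rats_subset_Qp Rats_inverse in blast)
qed

text \<open>
  Finite-dimensional spaces over \<open>\<rat>\<^sub>p\<close> are complete.  When a vector \<open>b\<close> outside the closed span \<open>S\<close> is
  added, its distance \<open>\<delta>\<close> from \<open>S\<close> is positive, and \<open>|a| \<delta> \<le> |ab + s|\<close>; so in a
  convergent sequence of elements \<open>ab + s\<close> the coefficients \<open>a\<close> converge, and with them the \<open>s\<close>.
\<close>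

lemma closed_Qp_span:
  assumes "finite B"
  shows "closed {x :: 'c. \<exists>c\<in>B \<rightarrow> Qp. x = (\<Sum>b\<in>B. c b * b)}"
  using assms
proof (induction B rule: finite_induct)
  case empty
  then show ?case by simp
next
  case (insert b B)
  let ?S = "{x :: 'c. \<exists>c\<in>B \<rightarrow> Qp. x = (\<Sum>b\<in>B. c b * b)}"
  let ?T = "{x :: 'c. \<exists>c\<in>insert b B \<rightarrow> Qp. x = (\<Sum>b\<in>insert b B. c b * b)}"
  have S_add: "x + y \<in> ?S" if "x \<in> ?S" "y \<in> ?S" for x y
  proof -
    from that obtain c d where "c \<in> B \<rightarrow> Qp" "x = (\<Sum>b\<in>B. c b * b)" "d \<in> B \<rightarrow> Qp" "y = (\<Sum>b\<in>B. d b * b)"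
      by blast
    then show ?thesis
      by (intro CollectI bexI[of _ "\<lambda>b. c b + d b"]) (auto simp: sum.distrib distrib_right intro: Qp_add)
  qed
  have S_scale: "a * x \<in> ?S" if "a \<in> Qp" "x \<in> ?S" for a x
  proof -
    from that obtain c where "c \<in> B \<rightarrow> Qp" "x = (\<Sum>b\<in>B. c b * b)"
      by blast
    then show ?thesis
      using that by (intro CollectI bexI[of _ "\<lambda>b. a * c b"]) (auto simp: sum_distrib_left mult.assoc intro: Qp_mult)
  qed
  have T_iff: "x \<in> ?T \<longleftrightarrow> (\<exists>a\<in>Qp. \<exists>s\<in>?S. x = a * b + s)" for x
  proof
    assume "x \<in> ?T"
    then obtain c where "c \<in> insert b B \<rightarrow> Qp" "x = (\<Sum>b\<in>insert b B. c b * b)"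
      by blast
    then show "\<exists>a\<in>Qp. \<exists>s\<in>?S. x = a * b + s"
      using insert.hyps by (intro bexI[of _ "c b"] bexI[of _ "\<Sum>b\<in>B. c b * b"]) auto
  next
    assume "\<exists>a\<in>Qp. \<exists>s\<in>?S. x = a * b + s"
    then obtain a c where "a \<in> Qp" "c \<in> B \<rightarrow> Qp" "x = a * b + (\<Sum>b\<in>B. c b * b)"
      by blast
    moreover from this have "(\<Sum>e\<in>insert b B. (c(b := a)) e * e) = a * b + (\<Sum>e\<in>B. c e * e)"
      using insert.hyps by (simp, intro sum.cong) auto
    ultimately show "x \<in> ?T"
      by (intro CollectI bexI[of _ "c(b := a)"]) auto
  qed
  show ?case
  proof (cases "b \<in> ?S")
    case True
    have "x \<in> ?T \<longleftrightarrow> x \<in> ?S" for x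
    proof
      assume "x \<in> ?T"
      then show "x \<in> ?S"
        unfolding T_iff by (elim bexE) (simp only: S_add[OF S_scale[OF _ True]])
    next
      assume "x \<in> ?S"
      then show "x \<in> ?T"
        unfolding T_iff by (intro bexI[of _ 0] bexI[of _ x]) (auto intro: Qp_0)
    qed
    then have "?T = ?S" by blast
    with insert.IH show ?thesis by simp
  next
    case False
    then obtain \<delta> where \<delta>: "\<delta> > 0" "\<And>s. s \<in> ?S \<Longrightarrow> \<delta> \<le> dist s b"
      using closed_approachable[OF insert.IH, of b] by (meson not_le)
    have lower: "vnorm a * \<delta> \<le> vnorm (a * b + s)" if "a \<in> Qp" "s \<in> ?S" for a s
    proof (cases "a = 0")
      case a: False
      have "- inverse a * s \<in> ?S"
        using that by (intro S_scale Qp_minus Qp_inverse)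
      then have "\<delta> \<le> vnorm (b - - inverse a * s)"
        using \<delta>(2)[of "- inverse a * s"] dist_vnorm[of b "- inverse a * s"]
        by (simp add: dist_commute)
      then have "vnorm a * \<delta> \<le> vnorm a * vnorm (b - - inverse a * s)"
        by (intro mult_left_mono) auto
      also have "\<dots> = vnorm (a * b + s)"
        using a by (simp add: distrib_left mult.assoc[symmetric] flip: vnorm_mult)
      finally show ?thesis .
    qed (use that in auto)
    show ?thesis
      unfolding closed_sequential_limits
    proof (intro allI impI, elim conjE)
      fix Z l assume Z: "\<forall>n. Z n \<in> ?T" "Z \<longlonglongrightarrow> l"
      have "\<forall>n. \<exists>q. fst q \<in> Qp \<and> snd q \<in> ?S \<and> Z n = fst q * b + snd q"
      proof
        fix n
        have "Z n \<in> ?T" using Z(1) by (rule spec)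
        then show "\<exists>q. fst q \<in> Qp \<and> snd q \<in> ?S \<and> Z n = fst q * b + snd q"
          unfolding T_iff by (elim bexE, intro exI[of _ "(_, _)"] conjI) (simp_all only: fst_conv snd_conv)
      qed
      from choice[OF this] obtain q where
        q: "\<forall>n. fst (q n) \<in> Qp \<and> snd (q n) \<in> ?S \<and> Z n = fst (q n) * b + snd (q n)" ..
      define a s where "a = fst \<circ> q" and "s = snd \<circ> q"
      have as: "\<And>n. a n \<in> Qp" "\<And>n. s n \<in> ?S" "\<And>n. Z n = a n * b + s n"
        unfolding a_def s_def o_apply
        by (rule conjunct1[OF spec[OF q]] conjunct1[OF conjunct2[OF spec[OF q]]]
            conjunct2[OF conjunct2[OF spec[OF q]]])+
      have diff: "dist (a m) (a n) * \<delta> \<le> dist (Z m) (Z n)" for m n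
      proof -
        have "s m + - 1 * s n \<in> ?S"
          by (intro S_add S_scale as Qp_minus Qp_1)
        then have "vnorm (a m - a n) * \<delta> \<le> vnorm ((a m - a n) * b + (s m + - 1 * s n))"
          by (intro lower Qp_diff as)
        also have "(a m - a n) * b + (s m + - 1 * s n) = Z m - Z n"
          by (simp add: as(3) algebra_simps)
        finally show ?thesis
          using dist_vnorm[of "a m" "a n"] dist_vnorm[of "Z m" "Z n"] by simp
      qed
      have "Cauchy a"
      proof (rule metric_CauchyI)
        fix e :: real assume "e > 0"
        then have "e * \<delta> > 0" using \<delta>(1) by simp
        then obtain M where M: "\<And>m n. m \<ge> M \<Longrightarrow> n \<ge> M \<Longrightarrow> dist (Z m) (Z n) < e * \<delta>"
          using LIMSEQ_imp_Cauchy[OF Z(2)] by (meson metric_CauchyD)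
        show "\<exists>M. \<forall>m\<ge>M. \<forall>n\<ge>M. dist (a m) (a n) < e"
        proof (intro exI allI impI)
          fix m n assume "m \<ge> M" "n \<ge> M"
          then have "dist (a m) (a n) * \<delta> < e * \<delta>"
            using diff[of m n] M[of m n] by linarith
          then show "dist (a m) (a n) < e"
            using \<delta>(1) by simp
        qed
      qed
      then obtain a0 where a0: "a \<longlonglongrightarrow> a0"
        using Cauchy_convergent convergent_def by blast
      have "(\<lambda>n. Z n - a n * b) \<longlonglongrightarrow> l - a0 * b"
        by (intro tendsto_pminus Z tendsto_pmult a0 tendsto_const)
      then have "s \<longlonglongrightarrow> l - a0 * b"
        by (simp add: as(3))
      then have "l - a0 * b \<in> ?S"
        using closed_limit[OF insert.IH] as(2) by blast
      moreover have "a0 \<in> Qp"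
        using closed_limit[OF closed_Qp a0] as(1) by blast
      ultimately show "l \<in> ?T"
        unfolding T_iff by (intro bexI[of _ a0] bexI[of _ "l - a0 * b"]) auto
    qed
  qed
qed

lemma finite_extension_closed:
  assumes "finite_extension_of_Qp (E :: 'c set)"
  shows "closed E"
proof -
  obtain B where B: "finite B" "B \<subseteq> E" "\<And>x. x \<in> E \<Longrightarrow> \<exists>c\<in>B \<rightarrow> Qp. x = (\<Sum>b\<in>B. c b * b)"
    and sub: "is_subfield E" "Qp \<subseteq> E"
    using assms unfolding finite_extension_of_Qp_def by blast
  have 0: "0 \<in> E"
    using sub(2) Qp_0 by blast
  have minus: "- y \<in> E" if "y \<in> E" for y
    using sub(1) 0 that unfolding is_subfield_def by (metis diff_0)
  have add: "x + y \<in> E" if "x \<in> E" "y \<in> E" for x y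
    using sub(1) that(1) minus[OF that(2)] unfolding is_subfield_def by (metis diff_minus_eq_add)
  have "(\<Sum>b\<in>C. c b * b) \<in> E" if "finite C" "C \<subseteq> E" "c \<in> C \<rightarrow> Qp" for c C
    using that
  proof (induction C rule: finite_induct)
    case (insert b C)
    then have "c b * b \<in> E"
      using sub unfolding is_subfield_def by blast
    then show ?case
      using insert by (auto intro: add)
  qed (use 0 in auto)
  then have "E = {x. \<exists>c\<in>B \<rightarrow> Qp. x = (\<Sum>b\<in>B. c b * b)}"
    using B by blast
  then show ?thesis
    using closed_Qp_span[OF B(1)] by simp
qed

end

section \<open>Teichmueller representatives\<close>

context padic_field
begin

text \<open>
  For \<open>0 < a < p\<close> the sequence \<open>a\<^bsup>p^n\<^esup>\<close> converges in \<open>\<rat>\<^sub>p\<close>, by Euler's theorem modulo \<open>p\<^bsup>n+1\<^esup>\<close>, to a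
  \<open>(p-1)\<close>-st root of unity congruent to \<open>a\<close>.  These are \<open>p - 1\<close> distinct roots of unity, hence all of them.
\<close>

lemma roots_of_unity_in_Qp: "Delta p \<subseteq> (Qp :: 'c set)"
proof -
  have p: "p > 1" using p_ge_2 by simp
  have cong: "int p ^ Suc n dvd int a ^ (p ^ n * (p - 1)) - 1" if "a \<in> {1..<p}" for a n
  proof -
    have "coprime p a"
      using that prime_p by (intro prime_imp_coprime) (auto dest: dvd_imp_le)
    then have "coprime a p"
      by (simp add: coprime_commute)
    then have "coprime a (p ^ Suc n)"
      by simp
    from euler_theorem[OF this] have "[a ^ (p ^ n * (p - 1)) = 1] (mod (p ^ Suc n))"
      by (simp only: totient_prime_power_Suc[OF prime_p])
    then have "[int (a ^ (p ^ n * (p - 1))) = int 1] (mod int (p ^ Suc n))"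
      unfolding cong_int_iff .
    then show ?thesis
      by (simp add: cong_iff_dvd_diff)
  qed
  have null: "(\<lambda>n. 1 / real p ^ Suc n) \<longlonglongrightarrow> 0"
    using LIMSEQ_Suc[OF LIMSEQ_realpow_zero[of "1 / real p"]] p by (simp add: power_one_over)
  have ex: "\<exists>w. w \<in> Delta p \<and> w \<in> (Qp :: 'c set) \<and> vnorm (w - of_nat a) < 1"
    if a: "a \<in> {1..<p}" for a
  proof -
    define T where "T n = (of_nat a :: 'c) ^ (p ^ n)" for n
    have unit: "vnorm (T n ^ (p - 1) - 1) \<le> 1 / real p ^ Suc n" for n
      using vnorm_of_int_dvd[OF cong[OF a, of n]] by (simp add: T_def power_mult)
    have T_le: "vnorm (T n) \<le> 1" for n
      using vnorm_of_nat_le[of "a ^ (p ^ n)"] by (simp add: T_def)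
    have step: "vnorm (T (Suc n) - T n) \<le> 1 / real p ^ Suc n" for n
    proof -
      have "T (Suc n) - T n = T n * (T n ^ (p - 1) - 1)"
      proof -
        have "T (Suc n) = T n ^ p"
          by (simp add: T_def power_mult[symmetric] mult.commute)
        also have "\<dots> = T n * T n ^ (p - 1)"
          using p by (cases p) auto
        finally show ?thesis by (simp add: right_diff_distrib)
      qed
      then show ?thesis
        using mult_mono[OF T_le unit, of n n] by (simp add: vnorm_mult)
    qed
    have "(\<lambda>n. vnorm (T (Suc n) - T n)) \<longlonglongrightarrow> 0"
      by (rule tendsto_sandwich[OF _ _ tendsto_const null]) (use step in auto)
    then obtain w where w: "T \<longlonglongrightarrow> w"
      using convergent_if_differences_null convergent_def by blast
    have "(\<lambda>n. T n ^ m) \<longlonglongrightarrow> w ^ m" for m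
      by (induction m) (auto intro: tendsto_pmult w)
    moreover have "(\<lambda>n. T n ^ (p - 1)) \<longlonglongrightarrow> 1"
      using null unit by (rule tendsto_null_le)
    ultimately have "w ^ (p - 1) = 1"
      using LIMSEQ_unique by blast
    moreover have "w \<in> Qp"
      by (rule closed_limit[OF closed_Qp w]) (use Qp_of_nat[of "a ^ (p ^ _)"] in \<open>simp add: T_def\<close>)
    moreover have "vnorm (T n - of_nat a) \<le> 1 / real p" for n
    proof (induction n)
      case (Suc n)
      have "1 / real p ^ Suc n \<le> 1 / real p ^ 1"
        using p by (intro divide_left_mono power_increasing) auto
      then show ?case
        using vnorm_add[of "T (Suc n) - T n" "T n - of_nat a"] step[of n] Suc by simp
    qed (simp add: T_def)
    then have "vnorm (w - of_nat a) \<le> 1 / real p"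
      by (rule vnorm_limit_le[OF tendsto_pminus[OF w tendsto_const]])
    then have "vnorm (w - of_nat a) < 1"
      using p by (smt (verit) divide_less_eq_1 of_nat_1 of_nat_less_iff)
    ultimately show ?thesis
      by (auto simp: Delta_def)
  qed
  then obtain w where w: "\<And>a. a \<in> {1..<p} \<Longrightarrow>
      w a \<in> Delta p \<and> w a \<in> (Qp :: 'c set) \<and> vnorm (w a - of_nat a) < 1"
    by metis
  \<comment> \<open>Distinct residues a, b have |a - b| = 1, whereas equal limits would force |a - b| < 1.\<close>
  have inj: "inj_on w {1..<p}"
  proof (rule inj_onI, rule ccontr)
    fix a b assume ab: "a \<in> {1..<p}" "b \<in> {1..<p}" "w a = w b" "a \<noteq> b"
    have "\<not> int p dvd int a - int b"
      using ab dvd_imp_le_int[of "int a - int b" "int p"] by auto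
    then have "vnorm (of_nat a - of_nat b :: 'c) = 1"
      using vnorm_of_int_coprime[of "int a - int b"] by simp
    moreover have "of_nat a - of_nat b = (w b - of_nat b) - (w a - of_nat a)"
      by (simp add: ab(3))
    ultimately show False
      using vnorm_diff[of "w b - of_nat b" "w a - of_nat a"] w[OF ab(1)] w[OF ab(2)]
      by (simp add: max_def split: if_splits)
  qed
  have "w ` {1..<p} = Delta p"
  proof (rule card_subset_eq)
    show "finite (Delta p :: 'c set)"
      unfolding Delta_def using p by (intro roots_of_unity_card_prod) simp
    show "w ` {1..<p} \<subseteq> Delta p"
      using w by blast
    show "card (w ` {1..<p}) = card (Delta p :: 'c set)"
      unfolding Delta_def using p inj by (subst roots_of_unity_card_prod(2)) (auto simp: card_image)
  qed
  moreover have "w ` {1..<p} \<subseteq> Qp"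
    using w by (intro image_subsetI) simp
  ultimately show ?thesis by simp
qed

end

section \<open>Gauss norms of power series\<close>

definition fps_over :: "'c::zero set \<Rightarrow> 'c fps set" where
  "fps_over S = {f. \<forall>n. fps_nth f n \<in> S}"

lemma is_subfield_closed:
  assumes "is_subfield S"
  shows "1 \<in> S" "0 \<in> S" "x \<in> S \<Longrightarrow> - x \<in> S" "x \<in> S \<Longrightarrow> y \<in> S \<Longrightarrow> x + y \<in> S"
    "x \<in> S \<Longrightarrow> y \<in> S \<Longrightarrow> x - y \<in> S" "x \<in> S \<Longrightarrow> y \<in> S \<Longrightarrow> x * y \<in> S"
    "x \<in> S \<Longrightarrow> inverse x \<in> S"
proof -
  have diff: "x - y \<in> S" if "x \<in> S" "y \<in> S" for x y
    using assms that by (auto simp: is_subfield_def)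
  show one: "1 \<in> S"
    using assms by (simp add: is_subfield_def)
  show zero: "0 \<in> S"
    using diff[OF one one] by simp
  have minus: "- x \<in> S" if "x \<in> S" for x
    using diff[OF zero that] by simp
  show "x \<in> S \<Longrightarrow> - x \<in> S"
    by (rule minus)
  show "x \<in> S \<Longrightarrow> y \<in> S \<Longrightarrow> x + y \<in> S"
    using diff[of x "- y"] minus[of y] by simp
qed (use assms in \<open>auto simp: is_subfield_def\<close>)

lemma is_subfield_sum: "is_subfield S \<Longrightarrow> (\<And>i. i \<in> A \<Longrightarrow> f i \<in> S) \<Longrightarrow> (\<Sum>i\<in>A. f i) \<in> S"
  by (induction A rule: infinite_finite_induct) (auto intro: is_subfield_closed)

lemma is_subfield_power: "is_subfield S \<Longrightarrow> x \<in> S \<Longrightarrow> x ^ n \<in> S"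
  by (induction n) (auto intro: is_subfield_closed)

lemma is_subfield_of_nat: "is_subfield S \<Longrightarrow> of_nat n \<in> S"
  by (induction n) (auto intro: is_subfield_closed)

lemma fps_over_closed:
  assumes "is_subfield S"
  shows "f \<in> fps_over S \<Longrightarrow> g \<in> fps_over S \<Longrightarrow> f + g \<in> fps_over S"
    "f \<in> fps_over S \<Longrightarrow> g \<in> fps_over S \<Longrightarrow> f - g \<in> fps_over S"
    "f \<in> fps_over S \<Longrightarrow> g \<in> fps_over S \<Longrightarrow> f * g \<in> fps_over S"
    "c \<in> S \<Longrightarrow> fps_const c \<in> fps_over S"
    "1 \<in> fps_over S" "0 \<in> fps_over S" "gamma0 \<in> fps_over S"
  using assms
  by (auto simp: fps_over_def fps_mult_nth gamma0_def fps_X_def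
      intro!: is_subfield_closed is_subfield_sum)

lemma fps_over_power: "is_subfield S \<Longrightarrow> f \<in> fps_over S \<Longrightarrow> f ^ n \<in> fps_over S"
  by (induction n) (auto intro: fps_over_closed)

lemma fps_over_sum:
  "is_subfield S \<Longrightarrow> (\<And>i. i \<in> A \<Longrightarrow> f i \<in> fps_over S) \<Longrightarrow> (\<Sum>i\<in>A. f i) \<in> fps_over S"
  by (induction A rule: infinite_finite_induct) (auto intro: fps_over_closed)

lemma fps_over_prod:
  "is_subfield S \<Longrightarrow> (\<And>i. i \<in> A \<Longrightarrow> f i \<in> fps_over S) \<Longrightarrow> (\<Prod>i\<in>A. f i) \<in> fps_over S"
  by (induction A rule: infinite_finite_induct) (auto intro: fps_over_closed)

text \<open>
  The Gauss norm of \<open>f\<close> at radius \<open>\<rho>\<close> is at most \<open>B\<close>.  A relation is used instead of the norm itself, which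
  may be infinite.
\<close>

definition gauss_le :: "real \<Rightarrow> real \<Rightarrow> 'c::{zero,metric_space} fps \<Rightarrow> bool" where
  "gauss_le \<rho> B f \<longleftrightarrow> (\<forall>i. vnorm (fps_nth f i) * \<rho> ^ i \<le> B)"

context padic_field
begin

lemma Qp_subfield: "is_subfield (Qp :: 'c set)"
  by (auto simp: is_subfield_def intro: Qp_1 Qp_diff Qp_mult Qp_inverse)

lemma gauss_le_nonneg: "gauss_le \<rho> B f \<Longrightarrow> 0 \<le> B" for f :: "'c fps"
  unfolding gauss_le_def by (drule spec[of _ 0]) (simp, meson order_trans zero_le_dist)

lemma gauss_le_mono: "gauss_le \<rho> B f \<Longrightarrow> B \<le> C \<Longrightarrow> gauss_le \<rho> C f" for f :: "'c fps"
  unfolding gauss_le_def by (meson order_trans)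

lemma gauss_le_radius_mono: "gauss_le r B f \<Longrightarrow> 0 \<le> \<rho> \<Longrightarrow> \<rho> \<le> r \<Longrightarrow> gauss_le \<rho> B f" for f :: "'c fps"
  unfolding gauss_le_def by (meson mult_left_mono order_trans power_mono zero_le_dist)

lemma gauss_le_coeff: "gauss_le \<rho> B f \<Longrightarrow> \<rho> > 0 \<Longrightarrow> vnorm (fps_nth f i) \<le> B / \<rho> ^ i"
  for f :: "'c fps"
  by (simp add: gauss_le_def field_simps)

lemma gauss_leI: "\<rho> > 0 \<Longrightarrow> (\<And>i. vnorm (fps_nth f i) \<le> B / \<rho> ^ i) \<Longrightarrow> gauss_le \<rho> B f"
  for f :: "'c fps"
  by (simp add: gauss_le_def field_simps)

lemma gauss_le_add:
  fixes f g :: "'c fps"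
  assumes "gauss_le \<rho> B f" "gauss_le \<rho> B g" "\<rho> > 0"
  shows "gauss_le \<rho> B (f + g)"
proof (rule gauss_leI[OF assms(3)])
  fix i
  show "vnorm (fps_nth (f + g) i) \<le> B / \<rho> ^ i"
    using vnorm_add[of "fps_nth f i" "fps_nth g i"] gauss_le_coeff[OF assms(1,3), of i]
      gauss_le_coeff[OF assms(2,3), of i] by simp
qed

lemma gauss_le_uminus: "gauss_le \<rho> B f \<Longrightarrow> gauss_le \<rho> B (- f)" for f :: "'c fps"
  by (simp add: gauss_le_def)

lemma gauss_le_diff:
  "gauss_le \<rho> B f \<Longrightarrow> gauss_le \<rho> B g \<Longrightarrow> \<rho> > 0 \<Longrightarrow> gauss_le \<rho> B (f - g)" for f g :: "'c fps"
  using gauss_le_add[OF _ gauss_le_uminus[of \<rho> B g]] by simp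

lemma gauss_le_0: "0 \<le> B \<Longrightarrow> gauss_le \<rho> B (0 :: 'c fps)"
  by (simp add: gauss_le_def)

lemma gauss_le_sum:
  fixes f :: "'i \<Rightarrow> 'c fps"
  assumes "\<And>i. i \<in> A \<Longrightarrow> gauss_le \<rho> B (f i)" "0 \<le> B" "\<rho> > 0"
  shows "gauss_le \<rho> B (\<Sum>i\<in>A. f i)"
  using assms(1) by (induction A rule: infinite_finite_induct)
    (auto intro: gauss_le_0 gauss_le_add assms(2,3))

lemma gauss_le_mult:
  fixes f g :: "'c fps"
  assumes "gauss_le \<rho> B f" "gauss_le \<rho> C g" "\<rho> > 0"
  shows "gauss_le \<rho> (B * C) (f * g)"
proof (rule gauss_leI[OF assms(3)])
  fix n
  note nonneg = gauss_le_nonneg[OF assms(1)] gauss_le_nonneg[OF assms(2)]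
  show "vnorm (fps_nth (f * g) n) \<le> B * C / \<rho> ^ n"
    unfolding fps_mult_nth
  proof (rule vnorm_sum)
    fix i assume i: "i \<in> {0..n}"
    have "vnorm (fps_nth f i) * vnorm (fps_nth g (n - i)) \<le> (B / \<rho> ^ i) * (C / \<rho> ^ (n - i))"
      using nonneg assms(3) by (intro mult_mono gauss_le_coeff assms) auto
    also have "\<dots> = B * C / \<rho> ^ n"
      using i by (simp flip: power_add)
    finally show "vnorm (fps_nth f i * fps_nth g (n - i)) \<le> B * C / \<rho> ^ n"
      by (simp add: vnorm_mult)
  qed (use nonneg assms(3) in auto)
qed

lemma gauss_le_const: "vnorm c \<le> B \<Longrightarrow> gauss_le \<rho> B (fps_const c)" for c :: 'c
  by (auto simp: gauss_le_def intro: order_trans[OF zero_le_dist[of c 0]])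

lemma gauss_le_1: "gauss_le \<rho> 1 (1 :: 'c fps)"
  using gauss_le_const[of 1] by simp

lemma gauss_le_power:
  fixes f :: "'c fps"
  assumes "gauss_le \<rho> B f" "\<rho> > 0"
  shows "gauss_le \<rho> (B ^ n) (f ^ n)"
  by (induction n) (auto intro: gauss_le_1 gauss_le_mult assms)

lemma gauss_le_const_mult:
  "gauss_le \<rho> B f \<Longrightarrow> \<rho> > 0 \<Longrightarrow> gauss_le \<rho> (vnorm c * B) (fps_const c * f)" for f :: "'c fps"
  by (intro gauss_le_mult gauss_le_const) auto

lemma vnorm_one_unit: "vnorm (v - 1) \<le> 1 / real p \<Longrightarrow> vnorm v \<le> 1" for v :: 'c
proof -
  assume v: "vnorm (v - 1) \<le> 1 / real p"
  have "1 / real p \<le> 1" using p_ge_2 by simp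
  then show ?thesis
    using v vnorm_add[of "v - 1" 1] by simp
qed

lemma radius_pos: "1 / real p \<le> \<rho> \<Longrightarrow> \<rho> > 0"
proof -
  have "0 < 1 / real p" using p_ge_2 by simp
  then show "1 / real p \<le> \<rho> \<Longrightarrow> \<rho> > 0" by linarith
qed

text \<open>
  The constant coefficient of \<open>v(1 + Z) - 1\<close> has absolute value at most \<open>1/p \<le> \<rho>\<close>, and the linear one at most 1.
\<close>

lemma gauss_le_gamma:
  fixes v :: 'c
  assumes v: "vnorm (v - 1) \<le> 1 / real p" and \<rho>: "1 / real p \<le> \<rho>" "\<rho> \<le> 1"
  shows "gauss_le \<rho> \<rho> (fps_const v * gamma0 - 1)" and "gauss_le \<rho> 1 (fps_const v * gamma0)"
proof -
  have pos: "\<rho> > 0"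
    using \<rho>(1) by (rule radius_pos)
  have "vnorm v * \<rho> \<le> 1 * \<rho>"
    using vnorm_one_unit[OF v] pos by (intro mult_right_mono) auto
  then show le: "gauss_le \<rho> \<rho> (fps_const v * gamma0 - 1)"
    using v \<rho> pos by (auto simp: gauss_le_def gamma0_def distrib_left fps_X_def vnorm_mult)
  have "gauss_le \<rho> 1 ((fps_const v * gamma0 - 1) + 1)"
    using gauss_le_mono[OF le \<rho>(2)] pos by (intro gauss_le_add gauss_le_1)
  then show "gauss_le \<rho> 1 (fps_const v * gamma0)"
    by simp
qed

lemma gauss_le_gamma_power:
  fixes v :: 'c
  assumes "vnorm (v - 1) \<le> 1 / real p" "1 / real p \<le> \<rho>" "\<rho> \<le> 1"
  shows "gauss_le \<rho> (\<rho> ^ i) ((fps_const v * gamma0 - 1) ^ i)"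
proof -
  have pos: "\<rho> > 0"
    using assms(2) by (rule radius_pos)
  then show ?thesis
    by (intro gauss_le_power gauss_le_gamma assms)
qed

lemma inverse_p_le_half: "1 / real p \<le> 1 / 2"
  using p_ge_2 by (intro divide_left_mono) auto

end

section \<open>The substitution \<open>\<gamma>\<^sub>0 \<mapsto> v\<gamma>\<^sub>0\<close>\<close>

text \<open>
  The series \<open>f(v(1 + Z) - 1)\<close>.  The substituted series has a constant term, so this is not composition of
  formal power series: each coefficient is an infinite \<open>p\<close>-adic sum.
\<close>

definition subst_gamma :: "'c::{field,metric_space} \<Rightarrow> 'c fps \<Rightarrow> 'c fps" where
  "subst_gamma v f =
     Abs_fps (\<lambda>j. \<Sum>i. fps_nth f i * fps_nth ((fps_const v * gamma0 - 1) ^ i) j)"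

context padic_field
begin

text \<open>
  The sums converge since the Gauss norm at radius \<open>1/2\<close> of the \<open>i\<close>-th power is at most \<open>(1/2)\<^sup>i\<close> while the coefficients
  of \<open>f\<close> are \<open>O((3/2)\<^sup>i)\<close>.  The radius \<open>2/3\<close> could be any number strictly between \<open>1/2\<close> and 1.
\<close>

lemma subst_gamma_sums:
  fixes f :: "'c fps"
  assumes v: "vnorm (v - 1) \<le> 1 / real p" and f: "gauss_le (2/3) C f"
  shows "(\<lambda>i. fps_nth f i * fps_nth ((fps_const v * gamma0 - 1) ^ i) j) sums fps_nth (subst_gamma v f) j"
proof -
  let ?t = "\<lambda>i. fps_nth f i * fps_nth ((fps_const v * gamma0 - 1) ^ i) j"
  have le: "vnorm (?t i) \<le> C * 2 ^ j * (3/4) ^ i" for i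
  proof -
    have "vnorm (?t i) \<le> (C / (2/3) ^ i) * ((1/2) ^ i / (1/2) ^ j)"
      unfolding vnorm_mult using gauss_le_nonneg[OF f]
      by (intro mult_mono gauss_le_coeff f gauss_le_gamma_power v inverse_p_le_half) auto
    also have "\<dots> = C * 2 ^ j * (3/4) ^ i"
      by (simp add: power_divide field_simps flip: power_mult_distrib)
    finally show ?thesis .
  qed
  have "(\<lambda>i. C * 2 ^ j * (3/4 :: real) ^ i) \<longlonglongrightarrow> 0"
    by (intro tendsto_mult_right_zero LIMSEQ_realpow_zero) auto
  then have "(\<lambda>i. vnorm (?t i)) \<longlonglongrightarrow> 0"
    by (rule tendsto_sandwich[OF _ _ tendsto_const, rotated 2]) (use le in \<open>simp_all del: zero_le_mult_iff\<close>)
  then show ?thesis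
    using sums_suminf_if_null by (simp add: subst_gamma_def)
qed

text \<open>
  Since the \<open>i\<close>-th power of \<open>v(1 + Z) - 1\<close> has Gauss norm at most \<open>\<rho>\<^sup>i\<close>, just like \<open>Z\<^sup>i\<close>, no term grows.
\<close>

lemma gauss_le_subst_gamma:
  fixes f :: "'c fps"
  assumes v: "vnorm (v - 1) \<le> 1 / real p" and f: "gauss_le (2/3) C f"
    and \<rho>: "1 / 2 \<le> \<rho>" "\<rho> \<le> 1" and B: "gauss_le \<rho> B f"
  shows "gauss_le \<rho> B (subst_gamma v f)"
proof (rule gauss_leI)
  show pos: "\<rho> > 0" using \<rho> by simp
  fix j
  show "vnorm (fps_nth (subst_gamma v f) j) \<le> B / \<rho> ^ j"
  proof (rule sums_vnorm_le[OF subst_gamma_sums[OF v f]])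
    fix i
    have "vnorm (fps_nth f i * fps_nth ((fps_const v * gamma0 - 1) ^ i) j) \<le>
        (B / \<rho> ^ i) * (\<rho> ^ i / \<rho> ^ j)"
      unfolding vnorm_mult using gauss_le_nonneg[OF B] pos \<rho> inverse_p_le_half
      by (intro mult_mono gauss_le_coeff B gauss_le_gamma_power v) auto
    then show "vnorm (fps_nth f i * fps_nth ((fps_const v * gamma0 - 1) ^ i) j) \<le> B / \<rho> ^ j"
      using pos by simp
  qed
qed

lemma subst_gamma_add:
  fixes f g :: "'c fps"
  assumes v: "vnorm (v - 1) \<le> 1 / real p" and f: "gauss_le (2/3) B f" and g: "gauss_le (2/3) C g"
  shows "subst_gamma v (f + g) = subst_gamma v f + subst_gamma v g"
proof (rule fps_ext)
  fix j
  let ?Y = "\<lambda>i. fps_nth ((fps_const v * gamma0 - 1) ^ i) j"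
  have "(\<lambda>i. fps_nth f i * ?Y i + fps_nth g i * ?Y i) sums
      (fps_nth (subst_gamma v f) j + fps_nth (subst_gamma v g) j)"
    by (rule sums_padd[OF subst_gamma_sums[OF v f] subst_gamma_sums[OF v g]])
  moreover have "gauss_le (2/3) (max B C) (f + g)"
    by (intro gauss_le_add gauss_le_mono[OF f] gauss_le_mono[OF g]) auto
  from subst_gamma_sums[OF v this, of j]
  have "(\<lambda>i. fps_nth f i * ?Y i + fps_nth g i * ?Y i) sums fps_nth (subst_gamma v (f + g)) j"
    by (simp add: distrib_right)
  ultimately show "fps_nth (subst_gamma v (f + g)) j = fps_nth (subst_gamma v f + subst_gamma v g) j"
    using sums_unique2 by fastforce
qed

lemma subst_gamma_finite_support:
  fixes f :: "'c fps"
  assumes "finite A" "\<And>i. i \<notin> A \<Longrightarrow> fps_nth f i = 0"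
  shows "subst_gamma v f = (\<Sum>i\<in>A. fps_const (fps_nth f i) * (fps_const v * gamma0 - 1) ^ i)"
proof (rule fps_ext)
  fix j
  have "(\<Sum>i. fps_nth f i * fps_nth ((fps_const v * gamma0 - 1) ^ i) j) =
      (\<Sum>i\<in>A. fps_nth f i * fps_nth ((fps_const v * gamma0 - 1) ^ i) j)"
    by (rule suminf_finite) (use assms in auto)
  then show "fps_nth (subst_gamma v f) j =
      fps_nth (\<Sum>i\<in>A. fps_const (fps_nth f i) * (fps_const v * gamma0 - 1) ^ i) j"
    by (simp add: subst_gamma_def fps_sum_nth)
qed

lemma subst_gamma_0 [simp]: "subst_gamma v 0 = (0 :: 'c fps)"
  using subst_gamma_finite_support[of "{}" 0 v] by simp

lemma subst_gamma_const [simp]: "subst_gamma v (fps_const c) = fps_const (c :: 'c)"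
  using subst_gamma_finite_support[of "{0}" "fps_const c" v] by simp

lemma subst_gamma_monomial:
  "subst_gamma v (fps_const c * fps_X ^ n) = fps_const c * (fps_const v * gamma0 - 1) ^ n" for c :: 'c
  using subst_gamma_finite_support[of "{n}" "fps_const c * fps_X ^ n" v]
  by (simp add: fps_X_power_nth)

lemma subst_gamma_sum:
  fixes f :: "'i \<Rightarrow> 'c fps"
  assumes v: "vnorm (v - 1) \<le> 1 / real p" and "\<And>i. i \<in> A \<Longrightarrow> \<exists>B. gauss_le (2/3) B (f i)"
  shows "subst_gamma v (\<Sum>i\<in>A. f i) = (\<Sum>i\<in>A. subst_gamma v (f i)) \<and>
    (\<exists>B. gauss_le (2/3) B (\<Sum>i\<in>A. f i))"
  using assms(2)
proof (induction A rule: infinite_finite_induct)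
  case (insert i A)
  from insert.prems[of i] insert.IH insert.prems
  obtain B C where BC: "gauss_le (2/3) B (f i)" "gauss_le (2/3) C (\<Sum>i\<in>A. f i)"
    by blast
  then have "gauss_le (2/3) (max B C) (f i + (\<Sum>i\<in>A. f i))"
    by (intro gauss_le_add) (auto intro: gauss_le_mono)
  then show ?case
    using insert subst_gamma_add[OF v BC] by auto
qed (auto intro!: exI[of _ 0] gauss_le_0)

lemma gauss_le_half: "gauss_le (2/3) C f \<Longrightarrow> gauss_le (1/2) C f" for f :: "'c fps"
  by (rule gauss_le_radius_mono) auto

lemma fps_cutoff_eq_sum: "fps_cutoff N f = (\<Sum>i<N. fps_const (fps_nth f i) * fps_X ^ i)"
  for f :: "'c fps"
  by (simp add: fps_eq_iff fps_sum_nth fps_X_power_nth if_distrib cong: if_cong)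

lemma gauss_le_monomial: "\<exists>B. gauss_le r B (fps_const c * fps_X ^ n)" for c :: 'c
  by (rule exI[of _ "vnorm c * \<bar>r\<bar> ^ n"])
    (auto simp: gauss_le_def fps_X_power_nth power_abs[symmetric] intro!: mult_left_mono)

lemma subst_gamma_cutoff_mult:
  fixes f g :: "'c fps"
  assumes v: "vnorm (v - 1) \<le> 1 / real p"
  shows "subst_gamma v (fps_cutoff N f * fps_cutoff N g) =
    subst_gamma v (fps_cutoff N f) * subst_gamma v (fps_cutoff N g)"
proof -
  let ?Y = "fps_const v * gamma0 - 1"
  have subst_cutoff: "subst_gamma v (fps_cutoff N f) = (\<Sum>i<N. fps_const (fps_nth f i) * ?Y ^ i)"
    for f :: "'c fps"
    by (subst subst_gamma_finite_support[of "{..<N}"]) (auto simp: fps_cutoff_nth)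
  have mult: "(\<Sum>i<N. fps_const (fps_nth f i) * Z ^ i) * (\<Sum>i<N. fps_const (fps_nth g i) * Z ^ i) =
      (\<Sum>(i, j)\<in>{..<N} \<times> {..<N}. fps_const (fps_nth f i * fps_nth g j) * Z ^ (i + j))" for Z :: "'c fps"
    by (simp add: sum_product sum.cartesian_product power_add mult_ac flip: fps_const_mult)
  have "subst_gamma v (fps_cutoff N f * fps_cutoff N g) =
      (\<Sum>(i, j)\<in>{..<N} \<times> {..<N}. subst_gamma v (fps_const (fps_nth f i * fps_nth g j) * fps_X ^ (i + j)))"
    unfolding fps_cutoff_eq_sum mult
    by (subst subst_gamma_sum[OF v, THEN conjunct1])
      (auto simp: split_beta intro: gauss_le_monomial)
  also have "\<dots> = subst_gamma v (fps_cutoff N f) * subst_gamma v (fps_cutoff N g)"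
    unfolding subst_cutoff mult by (simp only: subst_gamma_monomial)
  finally show ?thesis .
qed

lemma gauss_le_cutoff:
  fixes f :: "'c fps"
  assumes "gauss_le r C f"
  shows "gauss_le r C (fps_cutoff N f)"
  using assms gauss_le_nonneg[OF assms] by (auto simp: gauss_le_def fps_cutoff_nth)

lemma gauss_le_minus_cutoff:
  fixes f :: "'c fps"
  assumes "gauss_le (2/3) C f"
  shows "gauss_le (1/2) (C * (3/4) ^ N) (f - fps_cutoff N f)"
proof (rule gauss_leI)
  fix i
  have C: "C \<ge> 0" using assms by (rule gauss_le_nonneg)
  show "vnorm (fps_nth (f - fps_cutoff N f) i) \<le> C * (3/4) ^ N / (1/2) ^ i"
  proof (cases "i < N")
    case False
    have "vnorm (fps_nth f i) \<le> C / (2/3) ^ i"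
      using assms by (rule gauss_le_coeff) simp
    also have "\<dots> = C * (3/4) ^ i / (1/2) ^ i"
      by (simp add: power_divide field_simps flip: power_mult_distrib)
    also have "\<dots> \<le> C * (3/4) ^ N / (1/2) ^ i"
      using C False by (intro divide_right_mono mult_left_mono power_decreasing) auto
    finally show ?thesis
      using False by (simp add: fps_cutoff_nth)
  qed (use C in \<open>simp add: fps_cutoff_nth\<close>)
qed simp

text \<open>
  For the truncations of \<open>f\<close> and \<open>g\<close> this is an identity between polynomials in \<open>v(1 + Z) - 1\<close>.  Replacing
  \<open>f\<close> and \<open>g\<close> by their truncations changes both sides by at most \<open>BC(3/4)\<^sup>N\<close> in the Gauss norm at radius \<open>1/2\<close>.
\<close>

lemma subst_gamma_mult:
  fixes f g :: "'c fps"
  assumes v: "vnorm (v - 1) \<le> 1 / real p"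
    and f: "gauss_le (2/3) B f" and g: "gauss_le (2/3) C g"
  shows "subst_gamma v (f * g) = subst_gamma v f * subst_gamma v g"
proof -
  let ?T = "subst_gamma v"
  define D where "D = ?T (f * g) - ?T f * ?T g"
  have fg: "gauss_le (2/3) (B * C) (f * g)"
    by (intro gauss_le_mult f g) simp
  have T_diff: "?T (a - b) = ?T a - ?T b" if "gauss_le (2/3) A a" "gauss_le (2/3) A b" for a b A
    using subst_gamma_add[OF v gauss_le_diff[OF that] that(2)] by simp
  have bound: "gauss_le (1/2) (B * C * (3/4) ^ N) D" for N
  proof -
    let ?f = "fps_cutoff N f" and ?g = "fps_cutoff N g"
    note tf = gauss_le_cutoff[OF f, of N] and tg = gauss_le_cutoff[OF g, of N]
    have product: "gauss_le (1/2) (B * C * (3/4) ^ N) (a * b - a' * b')"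
      if "gauss_le (1/2) (B * (3/4) ^ N) (a - a')" "gauss_le (1/2) (C * (3/4) ^ N) (b - b')"
        "gauss_le (1/2) B a'" "gauss_le (1/2) C b" for a a' b b' :: "'c fps"
    proof -
      have "gauss_le (1/2) (B * (3/4) ^ N * C) ((a - a') * b)"
        by (rule gauss_le_mult[OF that(1,4)]) simp
      moreover have "gauss_le (1/2) (B * (C * (3/4) ^ N)) (a' * (b - b'))"
        by (rule gauss_le_mult[OF that(3,2)]) simp
      ultimately have "gauss_le (1/2) (B * C * (3/4) ^ N) ((a - a') * b + a' * (b - b'))"
        by (intro gauss_le_add) (simp_all add: mult_ac)
      then show ?thesis by (simp add: algebra_simps)
    qed
    have tfg: "gauss_le (2/3) (B * C) (?f * ?g)"
      by (intro gauss_le_mult tf tg) simp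
    have "gauss_le (1/2) (B * C * (3/4) ^ N) (f * g - ?f * ?g)"
      by (intro product gauss_le_minus_cutoff gauss_le_half f g tf)
    then have "gauss_le (1/2) (B * C * (3/4) ^ N) (?T (f * g - ?f * ?g))"
      by (intro gauss_le_subst_gamma[OF v gauss_le_diff[OF fg tfg]]) auto
    moreover have "?T (f * g - ?f * ?g) = ?T (f * g) - ?T (?f * ?g)"
      by (rule T_diff[OF fg tfg])
    moreover have "gauss_le (1/2) (B * C * (3/4) ^ N) (?T f * ?T g - ?T ?f * ?T ?g)"
    proof (rule product)
      show "gauss_le (1/2) (B * (3/4) ^ N) (?T f - ?T ?f)"
        unfolding T_diff[OF f tf, symmetric]
        by (rule gauss_le_subst_gamma[OF v gauss_le_diff[OF f tf]])
          (auto intro: gauss_le_minus_cutoff f)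
      show "gauss_le (1/2) (C * (3/4) ^ N) (?T g - ?T ?g)"
        unfolding T_diff[OF g tg, symmetric]
        by (rule gauss_le_subst_gamma[OF v gauss_le_diff[OF g tg]])
          (auto intro: gauss_le_minus_cutoff g)
      show "gauss_le (1/2) B (?T ?f)"
        by (rule gauss_le_subst_gamma[OF v tf]) (auto intro: gauss_le_half tf)
      show "gauss_le (1/2) C (?T g)"
        by (rule gauss_le_subst_gamma[OF v g]) (auto intro: gauss_le_half g)
    qed
    ultimately have "gauss_le (1/2) (B * C * (3/4) ^ N)
        ((?T (f * g) - ?T (?f * ?g)) - (?T f * ?T g - ?T ?f * ?T ?g))"
      by - (rule gauss_le_diff; simp)
    then show ?thesis
      by (simp add: D_def subst_gamma_cutoff_mult[OF v])
  qed
  have "fps_nth D i = 0" for i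
  proof -
    have "(\<lambda>N. B * C * (3/4 :: real) ^ N) \<longlonglongrightarrow> 0"
      by (intro tendsto_mult_right_zero LIMSEQ_realpow_zero) auto
    moreover have "vnorm (fps_nth D i) * (1/2) ^ i \<le> B * C * (3/4) ^ N" for N
      using bound[of N] by (simp add: gauss_le_def)
    ultimately have "vnorm (fps_nth D i) * (1/2) ^ i \<le> 0"
      by (intro LIMSEQ_le_const) auto
    moreover have "0 < vnorm (fps_nth D i) * (1/2) ^ i" if "fps_nth D i \<noteq> 0"
      by (rule mult_pos_pos) (use that in simp_all)
    ultimately show ?thesis
      by linarith
  qed
  then show ?thesis
    by (simp add: D_def fps_eq_iff)
qed

lemma subst_gamma_over:
  fixes f :: "'c fps"
  assumes v: "vnorm (v - 1) \<le> 1 / real p" and f: "gauss_le (2/3) C f"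
    and E: "is_subfield E" "closed E" "v \<in> E" "f \<in> fps_over E"
  shows "subst_gamma v f \<in> fps_over E"
proof -
  have "fps_nth (subst_gamma v f) j \<in> E" for j
  proof (rule closed_limit[OF E(2) subst_gamma_sums[OF v f, unfolded sums_def]])
    fix n
    have "(fps_const v * gamma0 - 1) ^ i \<in> fps_over E" for i
      by (intro fps_over_power fps_over_closed E)
    then show "(\<Sum>i<n. fps_nth f i * fps_nth ((fps_const v * gamma0 - 1) ^ i) j) \<in> E"
      using E(1,4) by (intro is_subfield_sum is_subfield_closed) (auto simp: fps_over_def)
  qed
  then show ?thesis by (simp add: fps_over_def)
qed

end

section \<open>Power series of polynomial growth\<close>

text \<open>
  The coefficients are \<open>O(n\<^sup>h)\<close> for some \<open>h\<close>; this form of the condition is visibly stable under products and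
  under the substitution above.
\<close>

definition poly_growth :: "'c::{zero,metric_space} fps \<Rightarrow> bool" where
  "poly_growth f \<longleftrightarrow> (\<exists>C h. \<forall>n\<ge>2. gauss_le (1 - 1 / real n) (C * real n ^ h) f)"

lemma geometric_weight_le:
  assumes "0 \<le> x" "x < (1 :: real)"
  shows "real (Suc i) * x ^ i \<le> 1 / (1 - x)"
proof -
  have "real (Suc i) * x ^ i = (\<Sum>k\<le>i. x ^ i)"
    by simp
  also have "\<dots> \<le> (\<Sum>k\<le>i. x ^ k)"
    using assms by (intro sum_mono power_decreasing) auto
  also have "\<dots> = (1 - x ^ Suc i) / (1 - x)"
    using assms sum_gp_basic[of x i] by (simp add: field_simps)
  also have "\<dots> \<le> 1 / (1 - x)"
    using assms by (intro divide_right_mono) auto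
  finally show ?thesis .
qed

context padic_field
begin

lemma poly_growth_tame: "poly_growth f \<Longrightarrow> \<exists>C. gauss_le (2/3) C f" for f :: "'c fps"
proof -
  assume "poly_growth f"
  then obtain C h where "\<forall>n\<ge>2. gauss_le (1 - 1 / real n) (C * real n ^ h) f"
    unfolding poly_growth_def by blast
  then have "gauss_le (1 - 1 / real 3) (C * real 3 ^ h) f"
    by (elim allE[of _ 3]) simp
  then show ?thesis
    by (intro exI) simp
qed

lemma radius_half: "1 / 2 \<le> 1 - 1 / real n" "1 - 1 / real n > 0" "1 - 1 / real n < 1" if "n \<ge> 2"
  using that by (auto simp: field_simps)

lemma poly_growth_mult:
  fixes f g :: "'c fps"
  assumes "poly_growth f" "poly_growth g"
  shows "poly_growth (f * g)"
proof -
  obtain B h where B: "\<And>n. n \<ge> 2 \<Longrightarrow> gauss_le (1 - 1 / real n) (B * real n ^ h) f"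
    using assms(1) unfolding poly_growth_def by blast
  obtain C k where C: "\<And>n. n \<ge> 2 \<Longrightarrow> gauss_le (1 - 1 / real n) (C * real n ^ k) g"
    using assms(2) unfolding poly_growth_def by blast
  have "gauss_le (1 - 1 / real n) (B * C * real n ^ (h + k)) (f * g)" if "n \<ge> 2" for n
    using gauss_le_mult[OF B[OF that] C[OF that] radius_half(2)[OF that]]
    by (simp add: power_add mult_ac)
  then show ?thesis
    unfolding poly_growth_def by blast
qed

lemma poly_growth_add:
  fixes f g :: "'c fps"
  assumes "poly_growth f" "poly_growth g"
  shows "poly_growth (f + g)"
proof -
  obtain B h where B: "\<And>n. n \<ge> 2 \<Longrightarrow> gauss_le (1 - 1 / real n) (B * real n ^ h) f"
    using assms(1) unfolding poly_growth_def by blast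
  obtain C k where C: "\<And>n. n \<ge> 2 \<Longrightarrow> gauss_le (1 - 1 / real n) (C * real n ^ k) g"
    using assms(2) unfolding poly_growth_def by blast
  have nonneg: "0 \<le> A" if "0 \<le> A * real 2 ^ l" for A :: real and l
    using that zero_less_power[of "real 2" l] unfolding zero_le_mult_iff by linarith
  have "B \<ge> 0" "C \<ge> 0"
    using nonneg[OF gauss_le_nonneg[OF B[of 2]]] nonneg[OF gauss_le_nonneg[OF C[of 2]]] by simp_all
  then have "B * real n ^ h \<le> max B C * real n ^ (h + k)" "C * real n ^ k \<le> max B C * real n ^ (h + k)"
    if "n \<ge> 2" for n
    using that by (intro mult_mono power_increasing; simp)+
  then have "gauss_le (1 - 1 / real n) (max B C * real n ^ (h + k)) (f + g)" if "n \<ge> 2" for n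
    using that by (intro gauss_le_add radius_half gauss_le_mono[OF B] gauss_le_mono[OF C])
  then show ?thesis
    unfolding poly_growth_def by blast
qed

lemma poly_growth_const: "poly_growth (fps_const c)" for c :: 'c
  unfolding poly_growth_def
  by (rule exI[of _ "vnorm c"], rule exI[of _ 0]) (auto intro: gauss_le_const)

lemma poly_growth_0: "poly_growth (0 :: 'c fps)" and poly_growth_1: "poly_growth (1 :: 'c fps)"
  using poly_growth_const[of 0] poly_growth_const[of 1] by simp_all

lemma poly_growth_sum: "(\<And>i. i \<in> A \<Longrightarrow> poly_growth (f i)) \<Longrightarrow> poly_growth (\<Sum>i\<in>A. f i)"
  for f :: "'i \<Rightarrow> 'c fps"
  by (induction A rule: infinite_finite_induct) (auto intro: poly_growth_0 poly_growth_add)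

lemma poly_growth_prod: "(\<And>i. i \<in> A \<Longrightarrow> poly_growth (f i)) \<Longrightarrow> poly_growth (\<Prod>i\<in>A. f i)"
  for f :: "'i \<Rightarrow> 'c fps"
  by (induction A rule: infinite_finite_induct) (auto intro: poly_growth_1 poly_growth_mult)

lemma poly_growth_subst_gamma:
  fixes f :: "'c fps"
  assumes v: "vnorm (v - 1) \<le> 1 / real p" and f: "poly_growth f"
  shows "poly_growth (subst_gamma v f)"
proof -
  obtain C h where C: "\<And>n. n \<ge> 2 \<Longrightarrow> gauss_le (1 - 1 / real n) (C * real n ^ h) f"
    using f unfolding poly_growth_def by blast
  obtain B where B: "gauss_le (2/3) B f"
    using poly_growth_tame[OF f] by blast
  have "gauss_le (1 - 1 / real n) (C * real n ^ h) (subst_gamma v f)" if "n \<ge> 2" for n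
    using radius_half[OF that] by (intro gauss_le_subst_gamma[OF v B] C that) auto
  then show ?thesis
    unfolding poly_growth_def by blast
qed

text \<open>
  Evaluate at radius \<open>1 - 1/(2n)\<close>, whose \<open>n\<close>-th power is at least \<open>1/2\<close> by Bernoulli's inequality.
\<close>

lemma poly_growth_imp_coeff_bound:
  fixes f :: "'c fps"
  assumes "poly_growth f"
  obtains B h where "\<And>n. n \<ge> 1 \<Longrightarrow> vnorm (fps_nth f n) \<le> B * real n ^ h"
proof -
  obtain C h where C: "\<And>n. n \<ge> 2 \<Longrightarrow> gauss_le (1 - 1 / real n) (C * real n ^ h) f"
    using assms unfolding poly_growth_def by blast
  have "vnorm (fps_nth f n) \<le> (2 * C * 2 ^ h) * real n ^ h" if n: "n \<ge> 1" for n
  proof -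
    have "1 + real n * (- (1 / real (2 * n))) \<le> (1 + - (1 / real (2 * n))) ^ n"
      using n by (intro Bernoulli_inequality) (auto simp: field_simps)
    then have half: "1 / 2 \<le> (1 - 1 / real (2 * n)) ^ n"
      using n by (simp add: field_simps)
    have "vnorm (fps_nth f n) * (1 / 2) \<le> vnorm (fps_nth f n) * (1 - 1 / real (2 * n)) ^ n"
      using half by (intro mult_left_mono) auto
    also have "\<dots> \<le> C * real (2 * n) ^ h"
      using C[of "2 * n"] n by (simp add: gauss_le_def)
    finally show ?thesis
      by (simp add: power_mult_distrib mult_ac)
  qed
  then show ?thesis by (rule that)
qed

text \<open>
  With \<open>x = 1 - 1/(kn)\<close> Bernoulli's inequality gives \<open>1 - 1/n \<le> x\<^sup>k\<close>, so \<open>(i+1)\<^sup>k (1 - 1/n)\<^sup>i\<close> is at most the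
  \<open>k\<close>-th power of \<open>(i+1) x\<^sup>i \<le> 1/(1-x) = kn\<close>.
\<close>

lemma coeff_bound_imp_poly_growth:
  fixes f :: "'c fps"
  assumes bound: "\<And>n. n \<ge> 1 \<Longrightarrow> vnorm (fps_nth f n) \<le> B * real n ^ h"
  shows "poly_growth f"
proof -
  define A where "A = max B (vnorm (fps_nth f 0))"
  define k where "k = Suc h"
  have A: "A \<ge> 0" by (simp add: A_def le_max_iff_disj)
  have coeff: "vnorm (fps_nth f i) \<le> A * real (Suc i) ^ k" for i
  proof (cases "i = 0")
    case False
    have "vnorm (fps_nth f i) \<le> B * real i ^ h"
      using False by (intro bound) simp
    also have "\<dots> \<le> A * real i ^ h"
      by (intro mult_right_mono) (auto simp: A_def)
    also have "\<dots> \<le> A * real (Suc i) ^ h"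
      using A by (intro mult_left_mono power_mono) auto
    also have "\<dots> \<le> A * real (Suc i) ^ k"
      using A unfolding k_def by (intro mult_left_mono power_increasing) auto
    finally show ?thesis .
  qed (simp add: A_def)
  have "gauss_le (1 - 1 / real n) (A * real k ^ k * real n ^ k) f" if n: "n \<ge> 2" for n
    unfolding gauss_le_def
  proof
    fix i
    define x where "x = 1 - 1 / (real k * real n)"
    have kn: "real k * real n \<ge> 2"
      using n mult_mono[of 1 "real k" 2 "real n"] by (simp add: k_def)
    have x: "0 \<le> x" "x < 1"
      using kn by (auto simp: x_def field_simps)
    have "1 + real k * (- (1 / (real k * real n))) \<le> (1 + - (1 / (real k * real n))) ^ k"
      using kn by (intro Bernoulli_inequality) (auto simp: field_simps)
    then have "1 - 1 / real n \<le> x ^ k"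
      by (simp add: x_def k_def)
    then have pow: "(1 - 1 / real n) ^ i \<le> (x ^ k) ^ i"
      using radius_half[OF n] by (intro power_mono) auto
    have "vnorm (fps_nth f i) * (1 - 1 / real n) ^ i \<le> (A * real (Suc i) ^ k) * (x ^ k) ^ i"
      using coeff pow radius_half[OF n] A by (intro mult_mono) auto
    also have "\<dots> = A * (real (Suc i) * x ^ i) ^ k"
      by (simp add: power_mult_distrib power_commutes flip: power_mult) (simp add: mult.commute)
    also have "\<dots> \<le> A * (1 / (1 - x)) ^ k"
      using x A by (intro mult_left_mono power_mono geometric_weight_le) auto
    also have "1 / (1 - x) = real k * real n"
      by (simp add: x_def)
    finally show "vnorm (fps_nth f i) * (1 - 1 / real n) ^ i \<le> A * real k ^ k * real n ^ k"
      by (simp add: power_mult_distrib mult_ac)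
  qed
  then show ?thesis
    unfolding poly_growth_def by blast
qed

end

section \<open>The half-logarithms have polynomial growth\<close>

context padic_field
begin

text \<open>
  From \<open>j\<close> times the binomial coefficient being divisible by \<open>p\<^sup>s\<close>, and \<open>1/|j| \<le> j\<close>.
\<close>

lemma vnorm_binomial_le:
  assumes "j \<ge> 1"
  shows "vnorm (of_nat ((p ^ s * i) choose j) :: 'c) \<le> real j / real p ^ s"
proof -
  have "j * ((p ^ s * i) choose j) = (p ^ s * i) * ((p ^ s * i - 1) choose (j - 1))"
    using times_binomial_minus1_eq[of j "p ^ s * i"] assms by simp
  then have "of_nat j * (of_nat ((p ^ s * i) choose j) :: 'c) =
      of_nat p ^ s * (of_nat i * of_nat ((p ^ s * i - 1) choose (j - 1)))"
    by (simp only: flip: of_nat_mult of_nat_power) (simp add: mult.assoc)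
  then have "vnorm (of_nat j :: 'c) * vnorm (of_nat ((p ^ s * i) choose j) :: 'c) =
      (1 / real p ^ s) * vnorm (of_nat (i * ((p ^ s * i - 1) choose (j - 1))) :: 'c)"
    by (simp add: vnorm_power vnorm_p power_one_over flip: vnorm_mult)
      (simp add: vnorm_mult vnorm_power vnorm_p power_one_over)
  also have "\<dots> \<le> (1 / real p ^ s) * 1"
    by (intro mult_left_mono vnorm_of_nat_le) auto
  finally have "vnorm (of_nat j :: 'c) * vnorm (of_nat ((p ^ s * i) choose j) :: 'c) \<le> 1 / real p ^ s"
    by simp
  moreover have "1 / real j * vnorm (of_nat ((p ^ s * i) choose j) :: 'c) \<le>
      vnorm (of_nat j :: 'c) * vnorm (of_nat ((p ^ s * i) choose j) :: 'c)"
    using assms by (intro mult_right_mono vnorm_of_nat_ge) auto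
  ultimately have "1 / real j * vnorm (of_nat ((p ^ s * i) choose j) :: 'c) \<le> 1 / real p ^ s"
    by linarith
  then show ?thesis
    using assms by (simp add: field_simps)
qed

text \<open>
  Expand by the binomial theorem; the \<open>j\<close>-th term has norm at most \<open>p\<^bsup>-s\<^esup> j \<rho>\<^sup>j\<close>.
\<close>

lemma gauss_le_gamma_power_minus_1:
  fixes v :: 'c
  assumes v: "vnorm (v - 1) \<le> 1 / real p" and \<rho>: "1 / 2 \<le> \<rho>" "\<rho> < 1"
  shows "gauss_le \<rho> (1 / (real p ^ s * (1 - \<rho>))) ((fps_const v * gamma0) ^ (p ^ s * i) - 1)"
proof -
  let ?Y = "fps_const v * gamma0 - 1" and ?m = "p ^ s * i"
  have "(fps_const v * gamma0) ^ ?m = (?Y + 1) ^ ?m"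
    by simp
  also have "\<dots> = (\<Sum>j\<le>?m. of_nat (?m choose j) * ?Y ^ j)"
    by (simp only: binomial_ring power_one mult_1_right)
  also have "\<dots> = 1 + (\<Sum>j\<in>{1..?m}. of_nat (?m choose j) * ?Y ^ j)"
    by (simp add: sum.atMost_shift atMost_atLeast0 sum.head[of 0 ?m] sum.atLeast_Suc_atMost)
  finally have eq: "(fps_const v * gamma0) ^ ?m - 1 =
      (\<Sum>j\<in>{1..?m}. fps_const (of_nat (?m choose j)) * ?Y ^ j)"
    by (simp add: fps_of_nat)
  show ?thesis
    unfolding eq
  proof (rule gauss_le_sum)
    fix j assume j: "j \<in> {1..?m}"
    then obtain j' where j': "j = Suc j'"
      by (cases j) auto
    have "gauss_le \<rho> (vnorm (of_nat (?m choose j) :: 'c) * \<rho> ^ j)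
        (fps_const (of_nat (?m choose j)) * ?Y ^ j)"
      using \<rho> inverse_p_le_half by (intro gauss_le_const_mult gauss_le_gamma_power v) auto
    moreover have "vnorm (of_nat (?m choose j) :: 'c) * \<rho> ^ j \<le> 1 / (real p ^ s * (1 - \<rho>))"
    proof -
      have "vnorm (of_nat (?m choose j) :: 'c) * \<rho> ^ j \<le> (real j / real p ^ s) * \<rho> ^ j'"
        using vnorm_binomial_le[of j s i] j \<rho> unfolding j'
        by (intro mult_mono) (auto simp: mult_left_le_one_le)
      also have "\<dots> = (real (Suc j') * \<rho> ^ j') / real p ^ s"
        by (simp add: j')
      also have "\<dots> \<le> (1 / (1 - \<rho>)) / real p ^ s"
        using \<rho> by (intro divide_right_mono geometric_weight_le) auto
      also have "\<dots> = 1 / (real p ^ s * (1 - \<rho>))"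
        by simp
      finally show ?thesis .
    qed
    ultimately show "gauss_le \<rho> (1 / (real p ^ s * (1 - \<rho>)))
        (fps_const (of_nat (?m choose j)) * ?Y ^ j)"
      by (rule gauss_le_mono)
  qed (use \<rho> in auto)
qed

lemma log_factor_eq:
  assumes "l > 0"
  shows "log_factor p u a l = fps_const (1 / of_nat p :: 'c) *
    (\<Sum>i<p. (fps_const (u powi (- int a)) * gamma0) ^ (p ^ (l - 1) * i))"
proof -
  have "map_poly fps_const (cyclotomic_poly (p ^ l) :: 'c poly) =
      (\<Sum>i<p. Polynomial.monom 1 (p ^ (l - 1) * i))"
    unfolding cyclotomic_poly_prime_power[OF prime_p assms]
  proof (rule poly_eqI)
    fix n
    have "fps_const (\<Sum>i<p. if p ^ (l - 1) * i = n then 1 else 0 :: 'c) =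
        (\<Sum>i<p. if p ^ (l - 1) * i = n then 1 else 0)"
      by (simp add: fps_eq_iff fps_sum_nth if_distrib[of "\<lambda>f. fps_nth f _"] cong: if_cong)
    then show "poly.coeff (map_poly fps_const (\<Sum>i<p. Polynomial.monom 1 (p ^ (l - 1) * i) :: 'c poly)) n =
        poly.coeff (\<Sum>i<p. Polynomial.monom 1 (p ^ (l - 1) * i)) n"
      by (simp add: coeff_map_poly Polynomial.coeff_sum)
  qed
  then show ?thesis
    by (simp add: log_factor_def poly_sum poly_monom)
qed

text \<open>
  The factor is \<open>1/p\<close> times a sum of \<open>p\<close> powers of \<open>v(1 + Z)\<close>, each of norm at most 1.  Subtracting 1 from each
  of these powers subtracts 1 from the factor, and makes the powers small by the previous estimate.
\<close>

lemma gauss_le_log_factor: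
  fixes u :: 'c
  assumes v: "vnorm (u powi (- int a) - 1) \<le> 1 / real p" and l: "l > 0"
    and \<rho>: "1 / 2 \<le> \<rho>" "\<rho> < 1"
  shows "gauss_le \<rho> (real p) (log_factor p u a l)"
    and "gauss_le \<rho> (real p ^ 2 / (real p ^ l * (1 - \<rho>))) (log_factor p u a l - 1)"
proof -
  let ?W = "fps_const (u powi (- int a)) * gamma0"
  have p: "real p > 0" using p_ge_2 by simp
  have W: "gauss_le \<rho> 1 (?W ^ n)" for n
    using gauss_le_power[OF gauss_le_gamma(2)[OF v], of \<rho> n] \<rho> inverse_p_le_half by simp
  have inv: "vnorm (1 / of_nat p :: 'c) = real p"
    by (simp add: vnorm_divide vnorm_p)
  have "gauss_le \<rho> (real p * 1) (log_factor p u a l)"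
    unfolding log_factor_eq[OF l] using \<rho> inv
    by (intro gauss_le_mult gauss_le_const gauss_le_sum W) auto
  then show "gauss_le \<rho> (real p) (log_factor p u a l)" by simp
  have "fps_const (1 / of_nat p :: 'c) * (\<Sum>i<p. 1) = fps_const (1 / of_nat p) * fps_const (of_nat p)"
    by (simp add: fps_of_nat)
  also have "\<dots> = 1"
    using p by simp
  finally have "log_factor p u a l - 1 =
      fps_const (1 / of_nat p) * (\<Sum>i<p. ?W ^ (p ^ (l - 1) * i) - 1)"
    unfolding log_factor_eq[OF l] sum_subtractf right_diff_distrib by simp
  moreover have "gauss_le \<rho> (real p * (1 / (real p ^ (l - 1) * (1 - \<rho>)))) \<dots>"
    using \<rho> inv
    by (intro gauss_le_mult gauss_le_const gauss_le_sum gauss_le_gamma_power_minus_1 v) auto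
  moreover have "real p * (1 / (real p ^ (l - 1) * (1 - \<rho>))) = real p ^ 2 / (real p ^ l * (1 - \<rho>))"
    using l p by (cases l) (simp_all add: power2_eq_square mult.assoc)
  ultimately show "gauss_le \<rho> (real p ^ 2 / (real p ^ l * (1 - \<rho>))) (log_factor p u a l - 1)"
    by simp
qed

lemma one_units_closed:
  fixes x y :: 'c
  assumes "x \<in> one_units p" "y \<in> one_units p"
  shows "x * y \<in> one_units p" "inverse x \<in> one_units p" "x \<noteq> 0"
proof -
  have x: "x \<in> Qp" "vnorm (x - 1) \<le> 1 / real p" and y: "y \<in> Qp" "vnorm (y - 1) \<le> 1 / real p"
    using assms dist_vnorm[of x 1] dist_vnorm[of y 1] by (auto simp: one_units_def)
  have p: "1 / real p < 1" using p_ge_2 by simp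
  have norm_x: "vnorm x = 1"
  proof -
    have "1 \<le> max (vnorm x) (vnorm (x - 1))"
      using vnorm_diff[of x "x - 1"] by simp
    then show ?thesis
      using x(2) p vnorm_one_unit[OF x(2)] by simp
  qed
  then show nz: "x \<noteq> 0" by auto
  have "vnorm (x * (y - 1)) \<le> 1 / real p"
    using y(2) norm_x by (simp add: vnorm_mult)
  then have "vnorm (x * (y - 1) + (x - 1)) \<le> 1 / real p"
    using vnorm_add[of "x * (y - 1)" "x - 1"] x(2) by linarith
  moreover have "x * (y - 1) + (x - 1) = x * y - 1"
    by (simp add: algebra_simps)
  ultimately have "vnorm (x * y - 1) \<le> 1 / real p"
    by (simp only:)
  then show "x * y \<in> one_units p"
    using x(1) y(1) dist_vnorm[of "x * y" 1] by (auto simp: one_units_def intro: Qp_mult)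
  have "inverse x - 1 = - (inverse x * (x - 1))"
    using nz by (simp add: algebra_simps)
  then have "vnorm (inverse x - 1) \<le> 1 / real p"
    using x(2) norm_x by (simp only: vnorm_minus vnorm_mult vnorm_inverse) simp
  then show "inverse x \<in> one_units p"
    using x(1) dist_vnorm[of "inverse x" 1] by (auto simp: one_units_def intro: Qp_inverse)
qed

lemma one_units_powi:
  fixes x :: 'c
  assumes "x \<in> one_units p"
  shows "x powi n \<in> one_units p"
proof -
  have "1 \<in> (one_units p :: 'c set)"
    by (simp add: one_units_def Qp_1)
  then have power: "y ^ k \<in> one_units p" if "y \<in> one_units p" for y :: 'c and k
    by (induction k) (auto intro: one_units_closed that)
  show ?thesis
    unfolding power_int_def using power assms one_units_closed(2)[OF assms assms] by simp
qed

lemma topological_generator_one_unit: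
  assumes "topological_generator p (u :: 'c)"
  shows "u \<in> one_units p"
proof -
  have "u \<in> range (\<lambda>n. u powi n)"
    by (rule range_eqI[of _ _ 1]) simp
  then have "u \<in> closure (range (\<lambda>n. u powi n))"
    by (rule subsetD[OF closure_subset])
  then show ?thesis
    using assms by (simp add: topological_generator_def)
qed

lemma one_unitsD: "x \<in> one_units p \<Longrightarrow> x \<in> Qp" "x \<in> one_units p \<Longrightarrow> vnorm (x - 1) \<le> 1 / real p"
  for x :: 'c
  using dist_vnorm[of x 1] by (auto simp: one_units_def)

text \<open>
  If \<open>p\<^sup>2 \<le> p\<^sup>L(1 - \<rho>)\<close> then all factors from the \<open>L\<close>-th on have norm at most 1 at radius \<open>\<rho>\<close>, so all partial products
  are bounded by \<open>p\<^sup>L\<close>.  At \<open>\<rho> = 1 - 1/n\<close> one can take \<open>p\<^sup>L \<le> p\<^sup>3 n\<close>, which yields growth of order 1.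
  Convergence of the coefficients is read off at the radius \<open>1/2\<close>.
\<close>

lemma fps_infprod_bounds:
  fixes s :: "nat \<Rightarrow> 'c fps"
  assumes bound: "\<And>n \<rho>. n \<ge> 1 \<Longrightarrow> 1 / 2 \<le> \<rho> \<Longrightarrow> \<rho> < 1 \<Longrightarrow> gauss_le \<rho> (real p) (s n)"
    and close: "\<And>n \<rho>. n \<ge> 1 \<Longrightarrow> 1 / 2 \<le> \<rho> \<Longrightarrow> \<rho> < 1 \<Longrightarrow>
      gauss_le \<rho> (real p ^ 2 / (real p ^ n * (1 - \<rho>))) (s n - 1)"
  shows "poly_growth (fps_infprod s)"
    and "(\<And>n. n \<ge> 1 \<Longrightarrow> s n \<in> fps_over Qp) \<Longrightarrow> fps_infprod s \<in> fps_over Qp"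
proof -
  have p: "real p \<ge> 2" using p_ge_2 by simp
  define P where "P M = (\<Prod>n=1..M. s n)" for M
  have P_Suc: "P (Suc M) = P M * s (Suc M)" for M
    by (simp add: P_def)
  have P_bound: "gauss_le \<rho> (real p ^ L) (P M)"
    if \<rho>: "1 / 2 \<le> \<rho>" "\<rho> < 1" and L: "real p ^ 2 \<le> real p ^ L * (1 - \<rho>)" for \<rho> L M
  proof -
    have "gauss_le \<rho> (real p ^ min M L) (P M)"
    proof (induction M)
      case 0
      then show ?case by (simp add: P_def gauss_le_1)
    next
      case (Suc M)
      show ?case
      proof (cases "Suc M \<le> L")
        case True
        have "gauss_le \<rho> (real p ^ min M L * real p) (P M * s (Suc M))"
          using \<rho> by (intro gauss_le_mult Suc.IH bound) auto
        then show ?thesis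
          using True by (simp add: P_Suc min_absorb1 mult.commute)
      next
        case False
        have "real p ^ L * (1 - \<rho>) \<le> real p ^ Suc M * (1 - \<rho>)"
          using False p \<rho> by (intro mult_right_mono power_increasing) auto
        then have "real p ^ 2 \<le> real p ^ Suc M * (1 - \<rho>)"
          using L by linarith
        moreover have "0 < real p ^ Suc M * (1 - \<rho>)"
          using p \<rho> by (intro mult_pos_pos zero_less_power) auto
        ultimately have "real p ^ 2 / (real p ^ Suc M * (1 - \<rho>)) \<le> 1"
          by (simp only: divide_le_eq_1_pos)
        then have "gauss_le \<rho> 1 (s (Suc M) - 1)"
          using \<rho> by (intro gauss_le_mono[OF close]) auto
        then have "gauss_le \<rho> 1 ((s (Suc M) - 1) + 1)"
          using \<rho> by (intro gauss_le_add gauss_le_1) auto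
        then have "gauss_le \<rho> 1 (s (Suc M))"
          by simp
        then have "gauss_le \<rho> (real p ^ min M L * 1) (P M * s (Suc M))"
          using \<rho> by (intro gauss_le_mult Suc.IH) auto
        then show ?thesis
          using False by (simp add: P_Suc min_absorb2)
      qed
    qed
    then show ?thesis
      by (rule gauss_le_mono) (use p in \<open>auto intro: power_increasing\<close>)
  qed
  have lim: "(\<lambda>M. fps_nth (P M) j) \<longlonglongrightarrow> fps_nth (fps_infprod s) j" for j
  proof -
    \<comment> \<open>At radius 1/2 one can take L = 3, since p is at least 2.\<close>
    have L3: "real p ^ 2 \<le> real p ^ 3 * (1 - 1 / 2)"
      using p by (simp add: power2_eq_square power3_eq_cube mult_left_mono)
    have le: "vnorm (fps_nth (P (Suc M)) j - fps_nth (P M) j) \<le>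
        (2 * real p ^ 5 * 2 ^ j) * (1 / real p) ^ Suc M" for M
    proof -
      have "gauss_le (1 / 2) (real p ^ 3 * (real p ^ 2 / (real p ^ Suc M * (1 - 1 / 2)))) (P M * (s (Suc M) - 1))"
        using P_bound[OF _ _ L3] by (intro gauss_le_mult close) auto
      from gauss_le_coeff[OF this, of j] show ?thesis
        by (simp add: P_Suc algebra_simps power_one_over flip: power_add)
    qed
    have "(\<lambda>M. (2 * real p ^ 5 * 2 ^ j) * (1 / real p) ^ Suc M) \<longlonglongrightarrow> 0"
      using p by (intro tendsto_mult_right_zero LIMSEQ_Suc LIMSEQ_realpow_zero) auto
    then have "(\<lambda>M. vnorm (fps_nth (P (Suc M)) j - fps_nth (P M) j)) \<longlonglongrightarrow> 0"
      by (rule tendsto_sandwich[OF _ _ tendsto_const, rotated 2])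
        (rule always_eventually, rule allI, rule zero_le_dist, rule always_eventually, rule allI, rule le)
    from convergent_if_differences_null[OF this] show ?thesis
      by (simp add: convergent_LIMSEQ_iff fps_infprod_def P_def)
  qed
  have limit_bound: "gauss_le \<rho> (real p ^ L) (fps_infprod s)"
    if \<rho>: "1 / 2 \<le> \<rho>" "\<rho> < 1" and L: "real p ^ 2 \<le> real p ^ L * (1 - \<rho>)" for \<rho> L
  proof (rule gauss_leI)
    show pos: "\<rho> > 0" using \<rho> by simp
    show "vnorm (fps_nth (fps_infprod s) j) \<le> real p ^ L / \<rho> ^ j" for j
      using lim gauss_le_coeff[OF P_bound[OF that] pos] by (rule vnorm_limit_le)
  qed
  have "gauss_le (1 - 1 / real n) (real p ^ 3 * real n ^ 1) (fps_infprod s)" if n: "n \<ge> 2" for n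
  proof -
    \<comment> \<open>The exponent L = j + 3 is large enough and not too large: p^(j+3) lies between p^2 n and p^3 n.\<close>
    obtain j where j: "p ^ j \<le> n" "n < p ^ Suc j"
      using ex_power_ivl1[of p n] p_ge_2 n by auto
    have "real n \<le> real (p ^ Suc j)"
      using j(2) by (simp only: of_nat_le_iff less_imp_le)
    then have "real p ^ 2 * real n \<le> real p ^ 2 * real (p ^ Suc j)"
      by (intro mult_left_mono) auto
    also have "\<dots> = real p ^ (j + 3)"
      by (simp add: power2_eq_square power3_eq_cube power_add)
    finally have "real p ^ 2 \<le> real p ^ (j + 3) * (1 - (1 - 1 / real n))"
      using n by (simp add: field_simps)
    then have "gauss_le (1 - 1 / real n) (real p ^ (j + 3)) (fps_infprod s)"
      using radius_half[OF n] by (intro limit_bound) auto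
    moreover have "real p ^ (j + 3) \<le> real p ^ 3 * real n ^ 1"
    proof -
      have "real p ^ 3 * real (p ^ j) \<le> real p ^ 3 * real n"
        using j(1) by (intro mult_left_mono) (auto simp flip: of_nat_power)
      then show ?thesis by (simp add: power_add mult.commute)
    qed
    ultimately show ?thesis by (rule gauss_le_mono)
  qed
  then show "poly_growth (fps_infprod s)"
    unfolding poly_growth_def by blast
  assume over: "\<And>n. n \<ge> 1 \<Longrightarrow> s n \<in> fps_over Qp"
  have "P M \<in> fps_over Qp" for M
    unfolding P_def using over by (intro fps_over_prod Qp_subfield) auto
  then show "fps_infprod s \<in> fps_over Qp"
    using closed_limit[OF closed_Qp lim] by (auto simp: fps_over_def)
qed

text \<open>
  Here \<open>e n\<close> stands for \<open>2n\<close> or \<open>2n - 1\<close>.  Both are at least \<open>n\<close>, so the \<open>n\<close>-th factor is as close to 1 as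
  the convergence of the product requires.
\<close>

lemma log_series:
  fixes u :: 'c
  assumes u: "u \<in> one_units p" and e: "\<And>n. n \<ge> 1 \<Longrightarrow> e n \<ge> n"
  shows "poly_growth (fps_infprod (\<lambda>n. log_factor p u a (e n)))"
    and "fps_infprod (\<lambda>n. log_factor p u a (e n)) \<in> fps_over Qp"
proof -
  note v = one_units_powi[OF u, of "- int a"]
  have bound: "gauss_le \<rho> (real p) (log_factor p u a (e n))"
    and close: "gauss_le \<rho> (real p ^ 2 / (real p ^ n * (1 - \<rho>))) (log_factor p u a (e n) - 1)"
    if n: "n \<ge> 1" and \<rho>: "1 / 2 \<le> \<rho>" "\<rho> < 1" for n \<rho>
  proof -
    have l: "e n > 0" using e[OF n] n by simp
    show "gauss_le \<rho> (real p) (log_factor p u a (e n))"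
      by (rule gauss_le_log_factor(1)[OF one_unitsD(2)[OF v] l \<rho>])
    have "gauss_le \<rho> (real p ^ 2 / (real p ^ e n * (1 - \<rho>))) (log_factor p u a (e n) - 1)"
      by (rule gauss_le_log_factor(2)[OF one_unitsD(2)[OF v] l \<rho>])
    then show "gauss_le \<rho> (real p ^ 2 / (real p ^ n * (1 - \<rho>))) (log_factor p u a (e n) - 1)"
      by (rule gauss_le_mono)
        (use p_ge_2 \<rho> e[OF n] in \<open>auto intro!: divide_left_mono mult_right_mono power_increasing mult_pos_pos\<close>)
  qed
  show "poly_growth (fps_infprod (\<lambda>n. log_factor p u a (e n)))"
    using bound close by (rule fps_infprod_bounds(1))
  have "log_factor p u a (e n) \<in> fps_over Qp" if "n \<ge> 1" for n
  proof -
    have l: "e n > 0" using e[OF that] that by simp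
    have inv: "1 / of_nat p \<in> (Qp :: 'c set)"
      using Qp_inverse[OF Qp_of_nat[of p]] by (simp add: divide_inverse)
    show ?thesis
      unfolding log_factor_eq[OF l]
      by (intro fps_over_closed fps_over_sum fps_over_power Qp_subfield one_unitsD(1)[OF v] inv)
  qed
  then show "fps_infprod (\<lambda>n. log_factor p u a (e n)) \<in> fps_over Qp"
    using bound close by (intro fps_infprod_bounds(2))
qed

end

section \<open>The ring of distributions and its twists\<close>

locale padic_subfield = padic_field p ty
  for p :: nat and ty :: "'c::{alg_closed_field,field_char_0,complete_space} itself" +
  fixes E :: "'c set"
  assumes finite_extension_E: "finite_extension_of_Qp E"
begin

lemma E_subfield: "is_subfield E" and Qp_subset_E: "Qp \<subseteq> E"
  using finite_extension_E by (auto simp: finite_extension_of_Qp_def)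

lemmas E_closed = is_subfield_closed[OF E_subfield]

lemma fps_over_Qp_E: "f \<in> fps_over Qp \<Longrightarrow> f \<in> fps_over E"
  using Qp_subset_E by (auto simp: fps_over_def)

lemma finite_Delta: "finite (Delta p :: 'c set)"
  unfolding Delta_def using p_ge_2 by (intro roots_of_unity_card_prod) simp

lemma Delta_subset_E: "\<sigma> \<in> Delta p \<Longrightarrow> \<sigma> \<in> E"
  using roots_of_unity_in_Qp Qp_subset_E by blast

lemma Delta_group:
  fixes \<sigma> \<tau> :: 'c
  shows "1 \<in> (Delta p :: 'c set)" "\<sigma> \<in> Delta p \<Longrightarrow> \<tau> \<in> Delta p \<Longrightarrow> \<sigma> * \<tau> \<in> Delta p"
    "\<sigma> \<in> Delta p \<Longrightarrow> \<tau> \<in> Delta p \<Longrightarrow> \<sigma> / \<tau> \<in> Delta p" "\<sigma> \<in> Delta p \<Longrightarrow> \<sigma> \<noteq> 0"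
  using p_ge_2 by (auto simp: Delta_def power_mult_distrib power_divide power_0_left)

lemma H_ring_simps:
  "x \<otimes>\<^bsub>H_ring p E\<^esub> y = dist_mult p x y" "x \<oplus>\<^bsub>H_ring p E\<^esub> y = (\<lambda>\<sigma>. x \<sigma> + y \<sigma>)"
  "\<one>\<^bsub>H_ring p E\<^esub> = of_series 1" "\<zero>\<^bsub>H_ring p E\<^esub> = (\<lambda>_. 0)"
  by (simp_all add: H_ring_def)

text \<open>
  Membership may be checked separately on each of the finitely many components, although the exponent of growth
  is common to all of them: take the sum of the exponents.
\<close>

lemma H_carrier_iff:
  "F \<in> carrier (H_ring p E) \<longleftrightarrow>
    (\<forall>\<sigma>. \<sigma> \<notin> Delta p \<longrightarrow> F \<sigma> = 0) \<and> (\<forall>\<sigma>. F \<sigma> \<in> fps_over E \<and> poly_growth (F \<sigma>))"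
proof
  assume "F \<in> carrier (H_ring p E)"
  then obtain h where h: "F \<in> H_set p E h"
    by (auto simp: H_ring_def)
  have "poly_growth (F \<sigma>)" if \<sigma>: "\<sigma> \<in> Delta p" for \<sigma>
  proof -
    obtain B where B: "\<And>n. n \<ge> 1 \<Longrightarrow> vnorm (fps_nth (F \<sigma>) n) / real n powr h \<le> B"
      using h \<sigma> unfolding H_set_def by blast
    show ?thesis
    proof (rule coeff_bound_imp_poly_growth)
      fix n :: nat assume n: "n \<ge> 1"
      have B0: "0 \<le> B"
        by (rule order_trans[OF _ B[OF n]]) simp
      have "vnorm (fps_nth (F \<sigma>) n) \<le> B * real n powr h"
        using B[OF n] n by (simp add: divide_le_eq)
      also have "real n powr h \<le> real n powr real (nat \<lceil>h\<rceil>)"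
        using n by (intro powr_mono real_nat_ceiling_ge) simp
      also have "\<dots> = real n ^ nat \<lceil>h\<rceil>"
        using n by (simp add: powr_realpow)
      finally show "vnorm (fps_nth (F \<sigma>) n) \<le> B * real n ^ nat \<lceil>h\<rceil>"
        using B0 by (simp add: mult_left_mono)
    qed
  qed
  then show "(\<forall>\<sigma>. \<sigma> \<notin> Delta p \<longrightarrow> F \<sigma> = 0) \<and> (\<forall>\<sigma>. F \<sigma> \<in> fps_over E \<and> poly_growth (F \<sigma>))"
    using h poly_growth_0 by (auto simp: H_set_def E_dist_def fps_over_def) metis
next
  assume F: "(\<forall>\<sigma>. \<sigma> \<notin> Delta p \<longrightarrow> F \<sigma> = 0) \<and> (\<forall>\<sigma>. F \<sigma> \<in> fps_over E \<and> poly_growth (F \<sigma>))"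
  have "\<exists>B h. \<forall>n\<ge>1. vnorm (fps_nth (F \<sigma>) n) \<le> B * real n ^ h" for \<sigma>
    using F by (metis poly_growth_imp_coeff_bound)
  then obtain B h where Bh: "\<And>\<sigma> n. n \<ge> 1 \<Longrightarrow> vnorm (fps_nth (F \<sigma>) n) \<le> B \<sigma> * real n ^ h \<sigma>"
    by metis
  define k where "k = (\<Sum>\<sigma>\<in>Delta p. h \<sigma>)"
  have "vnorm (fps_nth (F \<sigma>) n) / real n powr real k \<le> B \<sigma>" if \<sigma>: "\<sigma> \<in> Delta p" and n: "n \<ge> 1" for \<sigma> n
  proof -
    have B0: "0 \<le> B \<sigma>"
      using Bh[of 1 \<sigma>] by simp (meson order_trans zero_le_dist)
    have "h \<sigma> \<le> k"
      unfolding k_def using finite_Delta \<sigma> by (intro member_le_sum) auto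
    then have "B \<sigma> * real n ^ h \<sigma> \<le> B \<sigma> * real n ^ k"
      using n B0 by (intro mult_left_mono power_increasing) auto
    then have "vnorm (fps_nth (F \<sigma>) n) \<le> B \<sigma> * real n ^ k"
      using Bh[OF n, of \<sigma>] by linarith
    then show ?thesis
      using n by (simp add: powr_realpow divide_le_eq)
  qed
  then have "F \<in> H_set p E (real k)"
    using F by (auto simp: H_set_def E_dist_def fps_over_def)
  then show "F \<in> carrier (H_ring p E)"
    by (auto simp: H_ring_def)
qed

lemma dist_mult_closed:
  assumes "F \<in> carrier (H_ring p E)" "G \<in> carrier (H_ring p E)"
  shows "dist_mult p F G \<in> carrier (H_ring p E)"
  using assms unfolding H_carrier_iff dist_mult_def
  by (auto intro!: fps_over_sum fps_over_closed poly_growth_sum poly_growth_mult poly_growth_0 E_subfield)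

lemma dist_mult_comm: "dist_mult p F G = dist_mult p G F" for F G :: "'c dist"
proof
  fix \<sigma>
  show "dist_mult p F G \<sigma> = dist_mult p G F \<sigma>"
  proof (cases "\<sigma> \<in> Delta p")
    case True
    have "(\<Sum>\<tau>\<in>Delta p. F \<tau> * G (\<sigma> / \<tau>)) = (\<Sum>\<tau>\<in>Delta p. G \<tau> * F (\<sigma> / \<tau>))"
      using True Delta_group(3,4)
      by (intro sum.reindex_bij_witness[of _ "\<lambda>\<tau>. \<sigma> / \<tau>" "\<lambda>\<tau>. \<sigma> / \<tau>"]) (auto simp: mult.commute)
    then show ?thesis by (simp add: dist_mult_def)
  qed (simp add: dist_mult_def)
qed

lemma dist_mult_assoc:
  "dist_mult p (dist_mult p F G) K = dist_mult p F (dist_mult p G K)" for F G K :: "'c dist"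
proof
  fix \<sigma>
  show "dist_mult p (dist_mult p F G) K \<sigma> = dist_mult p F (dist_mult p G K) \<sigma>"
  proof (cases "\<sigma> \<in> Delta p")
    case True
    have "(\<Sum>\<tau>\<in>Delta p. (\<Sum>\<rho>\<in>Delta p. F \<rho> * G (\<tau> / \<rho>)) * K (\<sigma> / \<tau>)) =
        (\<Sum>\<rho>\<in>Delta p. \<Sum>\<tau>\<in>Delta p. F \<rho> * (G (\<tau> / \<rho>) * K (\<sigma> / \<tau>)))"
      unfolding sum_distrib_right by (subst sum.swap) (simp add: mult.assoc)
    also have "\<dots> = (\<Sum>\<rho>\<in>Delta p. \<Sum>\<mu>\<in>Delta p. F \<rho> * (G \<mu> * K (\<sigma> / \<rho> / \<mu>)))"
    proof (rule sum.cong[OF refl])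
      fix \<rho> :: 'c assume \<rho>: "\<rho> \<in> Delta p"
      show "(\<Sum>\<tau>\<in>Delta p. F \<rho> * (G (\<tau> / \<rho>) * K (\<sigma> / \<tau>))) =
          (\<Sum>\<mu>\<in>Delta p. F \<rho> * (G \<mu> * K (\<sigma> / \<rho> / \<mu>)))"
        using \<rho> Delta_group
        by (intro sum.reindex_bij_witness[of _ "\<lambda>\<mu>. \<rho> * \<mu>" "\<lambda>\<tau>. \<tau> / \<rho>"]) auto
    qed
    finally show ?thesis
      using True Delta_group(3) by (simp add: dist_mult_def sum_distrib_left)
  qed (simp add: dist_mult_def)
qed

lemma dist_mult_of_series:
  fixes F :: "'c dist"
  assumes "\<And>\<sigma>. \<sigma> \<notin> Delta p \<Longrightarrow> F \<sigma> = 0"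
  shows "dist_mult p (of_series f) F = (\<lambda>\<sigma>. f * F \<sigma>)"
proof
  fix \<sigma>
  show "dist_mult p (of_series f) F \<sigma> = f * F \<sigma>"
  proof (cases "\<sigma> \<in> Delta p")
    case True
    have "(\<Sum>\<tau>\<in>Delta p. of_series f \<tau> * F (\<sigma> / \<tau>)) = (\<Sum>\<tau>\<in>Delta p. if \<tau> = (1 :: 'c) then f * F \<sigma> else 0)"
      by (intro sum.cong) (auto simp: of_series_def)
    also have "\<dots> = f * F \<sigma>"
      using finite_Delta Delta_group(1) by simp
    finally show ?thesis
      using True by (simp add: dist_mult_def)
  qed (simp add: dist_mult_def assms)
qed

lemma of_series_closed:
  "f \<in> fps_over E \<Longrightarrow> poly_growth f \<Longrightarrow> of_series f \<in> carrier (H_ring p E)"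
  using Delta_group(1)
  by (auto simp: H_carrier_iff of_series_def intro: fps_over_closed E_subfield poly_growth_0)

lemma dist_scale_closed:
  "c \<in> E \<Longrightarrow> F \<in> carrier (H_ring p E) \<Longrightarrow> dist_scale c F \<in> carrier (H_ring p E)"
  by (auto simp: H_carrier_iff dist_scale_def
      intro: fps_over_closed E_subfield poly_growth_mult poly_growth_const)

lemma H_ring_cring: "cring (H_ring p E)"
proof (rule cringI)
  show "abelian_group (H_ring p E)"
  proof (rule abelian_groupI)
    fix F assume F: "F \<in> carrier (H_ring p E)"
    then have "dist_scale (- 1) F \<in> carrier (H_ring p E)"
      by (intro dist_scale_closed E_closed)
    moreover have "dist_scale (- 1) F \<oplus>\<^bsub>H_ring p E\<^esub> F = \<zero>\<^bsub>H_ring p E\<^esub>"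
      by (simp add: H_ring_simps dist_scale_def fun_eq_iff flip: fps_const_neg)
    ultimately show "\<exists>G\<in>carrier (H_ring p E). G \<oplus>\<^bsub>H_ring p E\<^esub> F = \<zero>\<^bsub>H_ring p E\<^esub>"
      by blast
  qed (auto simp: H_ring_simps H_carrier_iff add_ac
      intro: fps_over_closed E_subfield poly_growth_add poly_growth_0)
  show "comm_monoid (H_ring p E)"
  proof (rule comm_monoidI)
    show "\<one>\<^bsub>H_ring p E\<^esub> \<in> carrier (H_ring p E)"
      unfolding H_ring_simps by (intro of_series_closed fps_over_closed E_subfield poly_growth_1)
    show "\<one>\<^bsub>H_ring p E\<^esub> \<otimes>\<^bsub>H_ring p E\<^esub> F = F" if "F \<in> carrier (H_ring p E)" for F
      using that by (simp add: H_ring_simps dist_mult_of_series H_carrier_iff)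
    show "F \<otimes>\<^bsub>H_ring p E\<^esub> G = G \<otimes>\<^bsub>H_ring p E\<^esub> F" for F G
      unfolding H_ring_simps by (rule dist_mult_comm)
  qed (auto simp: H_ring_simps dist_mult_assoc dist_mult_closed)
  show "(F \<oplus>\<^bsub>H_ring p E\<^esub> G) \<otimes>\<^bsub>H_ring p E\<^esub> K =
      F \<otimes>\<^bsub>H_ring p E\<^esub> K \<oplus>\<^bsub>H_ring p E\<^esub> G \<otimes>\<^bsub>H_ring p E\<^esub> K" for F G K
    by (auto simp: H_ring_simps dist_mult_def distrib_right sum.distrib)
qed

sublocale H: cring "H_ring p E"
  by (rule H_ring_cring)

sublocale Frac: cring "FracH p E"
  unfolding FracH_def by (rule H.total_fractions_cring)

sublocale frac_hom: ring_hom_cring "H_ring p E" "FracH p E" "to_frac p E"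
proof
  have "to_frac p E = (\<lambda>F. fraction (H_ring p E) F \<one>\<^bsub>H_ring p E\<^esub>)"
    by (simp add: to_frac_def H_ring_simps fun_eq_iff)
  then show "to_frac p E \<in> ring_hom (H_ring p E) (FracH p E)"
    unfolding FracH_def using H.fraction_one_ring_hom by simp
qed

lemma dist_scale_mult:
  fixes F G :: "'c dist"
  shows "dist_scale c F \<otimes>\<^bsub>H_ring p E\<^esub> G = dist_scale c (F \<otimes>\<^bsub>H_ring p E\<^esub> G)"
    and "F \<otimes>\<^bsub>H_ring p E\<^esub> dist_scale c G = dist_scale c (F \<otimes>\<^bsub>H_ring p E\<^esub> G)"
  by (auto simp: H_ring_simps dist_mult_def dist_scale_def sum_distrib_left mult_ac fun_eq_iff)

lemma dist_scale_scale: "dist_scale c (dist_scale d F) = dist_scale (c * d) F" for F :: "'c dist"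
  by (simp add: dist_scale_def mult.assoc fun_eq_iff flip: fps_const_mult)

lemma dist_scale_1 [simp]: "dist_scale 1 F = F" for F :: "'c dist"
  by (simp add: dist_scale_def)

text \<open>
  Scalars are distributed over a product, one to each factor; this lets the sign \<open>a\<close> be shared out among the
  indices \<open>i\<close>.
\<close>

lemma dist_scale_finprod:
  assumes "finite I" "\<And>i. i \<in> I \<Longrightarrow> F i \<in> carrier (H_ring p E)" "\<And>i. i \<in> I \<Longrightarrow> c i \<in> E"
  shows "dist_scale (\<Prod>i\<in>I. c i) (\<Otimes>\<^bsub>H_ring p E\<^esub>i\<in>I. F i) =
    (\<Otimes>\<^bsub>H_ring p E\<^esub>i\<in>I. dist_scale (c i) (F i))"
  using assms
proof (induction I rule: finite_induct)
  case (insert j I)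
  have "(\<Otimes>\<^bsub>H_ring p E\<^esub>i\<in>insert j I. F i) = F j \<otimes>\<^bsub>H_ring p E\<^esub> (\<Otimes>\<^bsub>H_ring p E\<^esub>i\<in>I. F i)"
    by (rule H.finprod_insert) (use insert in auto)
  moreover have "(\<Otimes>\<^bsub>H_ring p E\<^esub>i\<in>insert j I. dist_scale (c i) (F i)) =
      dist_scale (c j) (F j) \<otimes>\<^bsub>H_ring p E\<^esub> (\<Otimes>\<^bsub>H_ring p E\<^esub>i\<in>I. dist_scale (c i) (F i))"
    by (rule H.finprod_insert) (use insert in \<open>auto intro: dist_scale_closed\<close>)
  moreover have "(\<Otimes>\<^bsub>H_ring p E\<^esub>i\<in>I. dist_scale (c i) (F i)) =
      dist_scale (\<Prod>i\<in>I. c i) (\<Otimes>\<^bsub>H_ring p E\<^esub>i\<in>I. F i)"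
    using insert by simp
  ultimately show ?case
    using insert.hyps by (simp add: dist_scale_mult dist_scale_scale mult.commute)
qed simp

lemma Tw_eq: "Tw u n F = (\<lambda>\<sigma>. fps_const (\<sigma> powi n) * subst_gamma (u powi n) (F \<sigma>))" for u :: 'c
  by (simp add: Tw_def subst_gamma_def)

context
  fixes u :: 'c
  assumes u: "u \<in> one_units p"
begin

lemma twist_unit: "vnorm (u powi n - 1) \<le> 1 / real p" "u powi n \<in> E"
  using one_unitsD[OF one_units_powi[OF u, of n]] Qp_subset_E by auto

text \<open>
  The component at \<open>\<sigma>\<close> is multiplied by a power of \<open>\<sigma>\<close>, which lies in \<open>E\<close> because \<open>\<rat>\<^sub>p\<close> contains the
  \<open>(p-1)\<close>-st roots of unity, and undergoes a substitution that preserves growth; the infinite sums stay in \<open>E\<close>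
  because \<open>E\<close> is closed.
\<close>

lemma Tw_closed:
  assumes "F \<in> carrier (H_ring p E)"
  shows "Tw u n F \<in> carrier (H_ring p E)"
proof -
  have F: "\<sigma> \<notin> Delta p \<Longrightarrow> F \<sigma> = 0" "F \<sigma> \<in> fps_over E" "poly_growth (F \<sigma>)" for \<sigma>
    using assms by (auto simp: H_carrier_iff)
  have powi: "\<sigma> powi n \<in> E" if "\<sigma> \<in> Delta p" for \<sigma>
    using is_subfield_power[OF E_subfield] Delta_subset_E[OF that] E_closed(7)
    by (auto simp: power_int_def)
  have "subst_gamma (u powi n) (F \<sigma>) \<in> fps_over E" for \<sigma>
  proof -
    obtain C where "gauss_le (2/3) C (F \<sigma>)"
      using poly_growth_tame[OF F(3)] by blast
    from subst_gamma_over[OF twist_unit(1) this E_subfield] show ?thesis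
      using finite_extension_closed[OF finite_extension_E] twist_unit(2) F(2) by blast
  qed
  moreover have "poly_growth (subst_gamma (u powi n) (F \<sigma>))" for \<sigma>
    by (rule poly_growth_subst_gamma[OF twist_unit(1) F(3)])
  ultimately have "fps_const (\<sigma> powi n) * subst_gamma (u powi n) (F \<sigma>) \<in> fps_over E \<and>
      poly_growth (fps_const (\<sigma> powi n) * subst_gamma (u powi n) (F \<sigma>))" for \<sigma>
    using F(1)[of \<sigma>] powi[of \<sigma>]
    by (cases "\<sigma> \<in> Delta p")
      (auto intro: fps_over_closed E_subfield poly_growth_mult poly_growth_const poly_growth_0)
  then show ?thesis
    using F(1) by (simp add: H_carrier_iff Tw_eq)
qed

lemma Tw_add:
  assumes "F \<in> carrier (H_ring p E)" "G \<in> carrier (H_ring p E)"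
  shows "Tw u n (F \<oplus>\<^bsub>H_ring p E\<^esub> G) = Tw u n F \<oplus>\<^bsub>H_ring p E\<^esub> Tw u n G"
proof
  fix \<sigma>
  obtain B C where "gauss_le (2/3) B (F \<sigma>)" "gauss_le (2/3) C (G \<sigma>)"
    using assms poly_growth_tame unfolding H_carrier_iff by meson
  from subst_gamma_add[OF twist_unit(1) this]
  show "Tw u n (F \<oplus>\<^bsub>H_ring p E\<^esub> G) \<sigma> = (Tw u n F \<oplus>\<^bsub>H_ring p E\<^esub> Tw u n G) \<sigma>"
    by (simp add: Tw_eq H_ring_simps distrib_left)
qed

lemma Tw_scale:
  assumes "F \<in> carrier (H_ring p E)"
  shows "Tw u n (dist_scale c F) = dist_scale c (Tw u n F)"
proof
  fix \<sigma>
  obtain B where "gauss_le (2/3) B (F \<sigma>)"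
    using assms poly_growth_tame unfolding H_carrier_iff by meson
  from subst_gamma_mult[OF twist_unit(1) gauss_le_const[OF order_refl] this, of n c]
  show "Tw u n (dist_scale c F) \<sigma> = dist_scale c (Tw u n F) \<sigma>"
    by (simp add: Tw_eq dist_scale_def mult.left_commute)
qed

text \<open>
  The substitution is multiplicative on each component, and the factor \<open>\<sigma>\<^sup>n\<close> splits as \<open>\<tau>\<^sup>n (\<sigma>/\<tau>)\<^sup>n\<close> in each term of the
  convolution.
\<close>

lemma Tw_mult:
  assumes "F \<in> carrier (H_ring p E)" "G \<in> carrier (H_ring p E)"
  shows "Tw u n (F \<otimes>\<^bsub>H_ring p E\<^esub> G) = Tw u n F \<otimes>\<^bsub>H_ring p E\<^esub> Tw u n G"
proof
  fix \<sigma>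
  let ?T = "subst_gamma (u powi n)"
  have tame: "\<exists>B. gauss_le (2/3) B (F \<tau>)" "\<exists>C. gauss_le (2/3) C (G \<tau>)" for \<tau>
    using assms poly_growth_tame unfolding H_carrier_iff by meson+
  show "Tw u n (F \<otimes>\<^bsub>H_ring p E\<^esub> G) \<sigma> = (Tw u n F \<otimes>\<^bsub>H_ring p E\<^esub> Tw u n G) \<sigma>"
  proof (cases "\<sigma> \<in> Delta p")
    case True
    have T_mult: "?T (F \<tau> * G \<rho>) = ?T (F \<tau>) * ?T (G \<rho>)" for \<tau> \<rho>
      using tame subst_gamma_mult[OF twist_unit(1)] by meson
    have "\<exists>B. gauss_le (2/3) B (F \<tau> * G \<rho>)" for \<tau> \<rho>
      using tame(1)[of \<tau>] tame(2)[of \<rho>] gauss_le_mult by fastforce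
    then have "?T (\<Sum>\<tau>\<in>Delta p. F \<tau> * G (\<sigma> / \<tau>)) = (\<Sum>\<tau>\<in>Delta p. ?T (F \<tau>) * ?T (G (\<sigma> / \<tau>)))"
      using subst_gamma_sum[OF twist_unit(1), of "Delta p" "\<lambda>\<tau>. F \<tau> * G (\<sigma> / \<tau>)"] by (simp add: T_mult)
    moreover have "fps_const (\<sigma> powi n) * (?T (F \<tau>) * ?T (G (\<sigma> / \<tau>))) =
        (fps_const (\<tau> powi n) * ?T (F \<tau>)) * (fps_const ((\<sigma> / \<tau>) powi n) * ?T (G (\<sigma> / \<tau>)))"
      if "\<tau> \<in> Delta p" for \<tau>
    proof -
      have "\<sigma> = \<tau> * (\<sigma> / \<tau>)"
        using Delta_group(4)[OF that] by simp
      then have "\<sigma> powi n = \<tau> powi n * (\<sigma> / \<tau>) powi n"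
        by (metis power_int_mult_distrib)
      then have "fps_const (\<sigma> powi n) = fps_const (\<tau> powi n) * fps_const ((\<sigma> / \<tau>) powi n)"
        by (simp only: fps_const_mult)
      then show ?thesis
        by (simp only: mult_ac)
    qed
    ultimately show ?thesis
      unfolding Tw_eq H_ring_simps dist_mult_def if_P[OF True]
      by (simp only: sum_distrib_left cong: sum.cong)
  qed (simp add: Tw_eq H_ring_simps dist_mult_def)
qed

lemma log_pm_closed: "log_pm p u b s \<in> carrier (H_ring p E)"
proof -
  have "poly_growth (fps_infprod (\<lambda>n. log_factor p u a (case s of Plus \<Rightarrow> 2 * n | Minus \<Rightarrow> 2 * n - 1)))
     \<and> fps_infprod (\<lambda>n. log_factor p u a (case s of Plus \<Rightarrow> 2 * n | Minus \<Rightarrow> 2 * n - 1)) \<in> fps_over Qp" for a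
    by (intro conjI log_series[OF u]) (auto split: sign.split)
  then show ?thesis
    unfolding log_pm_def
    by (intro of_series_closed fps_over_prod poly_growth_prod E_subfield fps_over_Qp_E) auto
qed

end

lemma Lambda_E_closed:
  assumes "F \<in> Lambda_E p E"
  shows "F \<in> carrier (H_ring p E)"
proof -
  obtain c G where F: "F = dist_scale c G" "c \<in> E" "G \<in> Lambda_int p E"
    using assms by (auto simp: Lambda_E_def)
  have "poly_growth (G \<sigma>)" for \<sigma>
    by (rule coeff_bound_imp_poly_growth[of _ 1 0]) (use F(3) in \<open>simp add: Lambda_int_def\<close>)
  then have "G \<in> carrier (H_ring p E)"
    using F(3) by (auto simp: H_carrier_iff Lambda_int_def E_dist_def fps_over_def)
  then show ?thesis
    unfolding F(1) by (intro dist_scale_closed F(2))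
qed

end

section \<open>The sum over all sign vectors\<close>

definition pair_sign :: "sign \<Rightarrow> sign \<Rightarrow> 'c::field" where
  "pair_sign a b = (if a = Minus \<and> b = Minus then -1 else 1)"

lemma sign_coeff_eq_prod: "sign_coeff m s t = (\<Prod>i<r_hi m. pair_sign (s i) (t i))"
  unfolding sign_coeff_def pair_sign_def
  by (subst prod.inter_filter [symmetric]) (simp_all add: lessThan_def)

theorem corollary6p9:
  fixes p :: nat
    and iinf :: "qbar \<Rightarrow> complex"
    and ip :: "qbar \<Rightarrow> 'c::{alg_closed_field,field_char_0,complete_space}"
    and k N :: nat and \<epsilon> :: "int \<Rightarrow> complex" and f :: "complex \<Rightarrow> complex"
    and K \<ff> :: "qbar set" and \<psi>inf :: "complex \<Rightarrow> complex" and \<psi> :: "qbar set \<Rightarrow> complex"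
    and D :: nat and \<epsilon>K :: "int \<Rightarrow> complex"
    and \<alpha> :: complex and E :: "'c set" and u :: 'c
    and m :: nat
    and Nf :: "nat \<Rightarrow> nat" and \<epsilon>f :: "nat \<Rightarrow> int \<Rightarrow> complex" and fi :: "nat \<Rightarrow> complex \<Rightarrow> complex"
    and \<phi> :: "nat \<Rightarrow> (qbar \<Rightarrow> qbar) \<Rightarrow> 'c" and \<rho> :: "nat \<Rightarrow> (qbar \<Rightarrow> qbar) \<Rightarrow> 'c^2^2"
    and \<Omega> :: "nat \<Rightarrow> sign \<Rightarrow> complex"
    and Lroot :: "nat \<Rightarrow> complex \<Rightarrow> 'c dist" and Lpm :: "nat \<Rightarrow> sign \<Rightarrow> 'c dist"
    and Leta :: "'c frac_dist" and t :: "nat \<Rightarrow> sign"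
  assumes p: "prime p" "odd p"
    and Cp: "padic_complex_field p TYPE('c)"
    and embeddings: "field_embedding iinf" "field_embedding ip"
    and f: "newform k N \<epsilon> f" "k \<ge> 2" "\<not> p dvd N"
    and K: "imaginary_quadratic K" "inert K p" "quadratic_character_of K D \<epsilon>K"
    and CM: "hecke_character iinf K \<ff> \<psi>inf \<psi>" "same_L_function K \<ff> \<psi> f"
    and \<alpha>: "\<alpha> \<in> hecke_roots p k \<epsilon>"
    and E: "finite_extension_of_Qp E" "contains_finite_idele_values iinf ip K \<ff> \<psi>inf \<psi> E"
      "to_padic iinf ip \<alpha> \<in> E"
    and u: "topological_generator p u"
    and m: "m \<ge> 2"
    and fi: "\<And>i. i < r_hi m \<Longrightarrow> newform (weight_i k m i) (Nf i) (\<epsilon>f i) (fi i)"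
      "\<And>i. i < r_hi m \<Longrightarrow> \<not> p dvd Nf i"
      "\<And>i. i < r_hi m \<Longrightarrow> fourier_coeff (fi i) p = 0"
      "\<And>i. i < r_hi m \<Longrightarrow> hecke_roots p (weight_i k m i) (\<epsilon>f i) = range (alpha_i p k m \<alpha> i)"
    and V_fi:
      "\<And>i. i < r_hi m \<Longrightarrow>
         attached_representation p iinf ip E (weight_i k m i) (Nf i) (\<epsilon>f i) (fi i) (\<rho> i)"
      "\<And>i. i < r_hi m \<Longrightarrow> galois_character_of_hecke iinf ip E K \<ff> \<psi> (m - 2 * i) (\<phi> i)"
      "\<And>i. i < r_hi m \<Longrightarrow> isomorphic_to_twisted_induced E (\<rho> i) K (\<phi> i)
         (\<lambda>\<sigma>. gal_char iinf ip D \<epsilon>K \<sigma> ^ i * gal_char iinf ip N \<epsilon> \<sigma> powi (int i - int (r_lo m)))"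
    and periods: "\<And>i s. i < r_hi m \<Longrightarrow> \<Omega> i s \<noteq> 0"
    and Lroot: "\<And>i \<beta>. i < r_hi m \<Longrightarrow> \<beta> \<in> hecke_roots p (weight_i k m i) (\<epsilon>f i) \<Longrightarrow>
      is_padic_L p iinf ip u E (weight_i k m i) (fi i) (\<Omega> i) \<beta> (Lroot i \<beta>)"
    and Lpm: "\<And>i. i < r_hi m \<Longrightarrow>
      pollack_decomposition p iinf ip u E (weight_i k m i) (\<epsilon>f i) (Lroot i) (Lpm i)"
    and Leta: "even m \<Longrightarrow> is_kubota_leopoldt p iinf ip u E
      (if even (r_lo m) then 1 else D) (if even (r_lo m) then (\<lambda>_. 1) else \<epsilon>K) Leta"
    and t: "t \<in> Signs m"
  shows "L_V_root p u E k m \<alpha> Lroot Leta t =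
    (\<Oplus>\<^bsub>FracH p E\<^esub>s\<in>Signs m.
       to_frac p E (dist_scale (sign_coeff m s t) (ell_V p iinf ip u E k m \<alpha> s))
         \<otimes>\<^bsub>FracH p E\<^esub> L_V_pm p u E k m Lpm Leta s)"
proof -
  interpret padic_subfield p "TYPE('c)" E
    using p(1) Cp E(1) by unfold_locales
  let ?H = "H_ring p E" and ?S = "FracH p E" and ?\<iota> = "to_frac p E"
  let ?I = "{..<r_hi m}"
  let ?T = "\<lambda>i. Tw u (int (twist_i k m i))"
  have u1: "u \<in> one_units p"
    using u by (rule topological_generator_one_unit)
  have \<alpha>_range: "\<alpha> \<in> range iinf"
    using embeddings(1) p(1) f(3) _ \<alpha>
    by (rule hecke_root_in_range) (use f(1) in \<open>simp add: newform_def\<close>)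
  define ell where "ell i s = ?T i (ell_i p iinf ip u k m \<alpha> i s)" for i s
  define A where "A i s = ?T i (Lpm i s)" for i s
  define e :: "nat \<Rightarrow> sign \<Rightarrow> 'c" where "e i s = pair_sign s (t i)" for i s
  have e_E: "e i s \<in> E" for i s
    by (auto simp: e_def pair_sign_def intro: E_closed)
  have alpha_E: "to_padic iinf ip (alpha_i p k m \<alpha> i Plus) \<in> E" for i
    unfolding to_padic_alpha_i[OF embeddings \<alpha>_range]
    using E(3) by (auto intro!: E_closed is_subfield_power is_subfield_of_nat E_subfield)
  have ell_i_closed: "ell_i p iinf ip u k m \<alpha> i s \<in> carrier ?H" for i s
    by (cases s) (auto simp: ell_i_def intro: log_pm_closed[OF u1] dist_scale_closed alpha_E)
  then have ell_closed: "ell i s \<in> carrier ?H" for i s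
    unfolding ell_def by (rule Tw_closed[OF u1])
  have Lpm_closed: "Lpm i s \<in> carrier ?H" if "i \<in> ?I" for i s
    using Lpm[of i] that by (cases s) (auto simp: pollack_decomposition_def intro: Lambda_E_closed)
  then have A_closed: "A i s \<in> carrier ?H" if "i \<in> ?I" for i s
    unfolding A_def using that by (intro Tw_closed[OF u1])

  have decomposition: "?T i (Lroot i (alpha_i p k m \<alpha> i (t i))) =
      dist_scale (e i Plus) (ell i Plus) \<otimes>\<^bsub>?H\<^esub> A i Plus \<oplus>\<^bsub>?H\<^esub>
      dist_scale (e i Minus) (ell i Minus) \<otimes>\<^bsub>?H\<^esub> A i Minus" if i: "i \<in> ?I" for i
  proof -
    let ?c = "to_padic iinf ip (alpha_i p k m \<alpha> i Plus)"
    let ?log = "log_pm p u (weight_i k m i - 1)"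
    note closed = Lpm_closed[OF i] log_pm_closed[OF u1] ell_i_closed
    \<comment> \<open>The sign of the root at t i is the sign that the minus part acquires.\<close>
    have root: "to_padic iinf ip (alpha_i p k m \<alpha> i (t i)) = e i Minus * ?c"
      using to_padic_minus[OF embeddings alpha_i_in_range[OF embeddings(1) \<alpha>_range]]
      by (cases "t i") (simp_all add: e_def pair_sign_def alpha_i_Minus)
    have "alpha_i p k m \<alpha> i (t i) \<in> hecke_roots p (weight_i k m i) (\<epsilon>f i)"
      using fi(4)[of i] i by auto
    then have "Lroot i (alpha_i p k m \<alpha> i (t i)) =
        Lpm i Plus \<otimes>\<^bsub>?H\<^esub> ?log Plus \<oplus>\<^bsub>?H\<^esub>
        dist_scale (e i Minus * ?c) (Lpm i Minus \<otimes>\<^bsub>?H\<^esub> ?log Minus)"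
      using Lpm[of i] i unfolding pollack_decomposition_def root[symmetric] by blast
    also have "\<dots> = ell_i p iinf ip u k m \<alpha> i Plus \<otimes>\<^bsub>?H\<^esub> Lpm i Plus \<oplus>\<^bsub>?H\<^esub>
        dist_scale (e i Minus) (ell_i p iinf ip u k m \<alpha> i Minus \<otimes>\<^bsub>?H\<^esub> Lpm i Minus)"
      using closed by (simp add: ell_i_def dist_scale_mult dist_scale_scale H.m_comm)
    finally have "?T i (Lroot i (alpha_i p k m \<alpha> i (t i))) = ell i Plus \<otimes>\<^bsub>?H\<^esub> A i Plus \<oplus>\<^bsub>?H\<^esub>
        dist_scale (e i Minus) (ell i Minus \<otimes>\<^bsub>?H\<^esub> A i Minus)"
      using closed e_E
      by (simp add: Tw_add[OF u1] Tw_mult[OF u1] Tw_scale[OF u1] dist_scale_closed ell_def A_def)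
    moreover have "e i Plus = 1"
      by (simp add: e_def pair_sign_def)
    ultimately show ?thesis
      by (simp add: dist_scale_mult)
  qed

  define G where "G i s = ?\<iota> (dist_scale (e i s) (ell i s)) \<otimes>\<^bsub>?S\<^esub> ?\<iota> (A i s)" for i s
  define W where "W = (if even m then Leta else \<one>\<^bsub>?S\<^esub>)"
  have W: "W \<in> carrier ?S"
    using Leta by (auto simp: W_def is_kubota_leopoldt_def)
  have scaled_closed: "dist_scale (e i s) (ell i s) \<in> carrier ?H" for i s
    by (intro dist_scale_closed e_E ell_closed)
  have G_closed: "G i s \<in> carrier ?S" if "i \<in> ?I" for i s
    unfolding G_def using A_closed[OF that] scaled_closed by simp
  have factor: "?\<iota> (?T i (Lroot i (alpha_i p k m \<alpha> i (t i)))) = G i Plus \<oplus>\<^bsub>?S\<^esub> G i Minus"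
    if "i \<in> ?I" for i
    unfolding decomposition[OF that] G_def using A_closed[OF that] scaled_closed by simp
  have "(UNIV :: sign set) = {Plus, Minus}"
    using sign.exhaust by auto
  then have "finite (UNIV :: sign set)"
    by (metis finite.emptyI finite.insertI)
  then have finite_Signs: "finite (Signs m)"
    unfolding Signs_def by (intro finite_PiE) auto
  have prod_G_closed: "(\<Otimes>\<^bsub>?S\<^esub>i\<in>?I. G i (s i)) \<in> carrier ?S" for s
    using G_closed by (intro Frac.finprod_closed) auto
  have summand: "(\<Otimes>\<^bsub>?S\<^esub>i\<in>?I. G i (s i)) \<otimes>\<^bsub>?S\<^esub> W =
      ?\<iota> (dist_scale (sign_coeff m s t) (ell_V p iinf ip u E k m \<alpha> s)) \<otimes>\<^bsub>?S\<^esub>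
        L_V_pm p u E k m Lpm Leta s" for s
  proof -
    have "(\<Otimes>\<^bsub>?S\<^esub>i\<in>?I. G i (s i)) = (\<Otimes>\<^bsub>?S\<^esub>i\<in>?I. ?\<iota> (dist_scale (e i (s i)) (ell i (s i)))) \<otimes>\<^bsub>?S\<^esub>
        (\<Otimes>\<^bsub>?S\<^esub>i\<in>?I. ?\<iota> (A i (s i)))"
      unfolding G_def using scaled_closed A_closed by (intro Frac.finprod_multf) auto
    also have "(\<Otimes>\<^bsub>?S\<^esub>i\<in>?I. ?\<iota> (dist_scale (e i (s i)) (ell i (s i)))) =
        ?\<iota> (\<Otimes>\<^bsub>?H\<^esub>i\<in>?I. dist_scale (e i (s i)) (ell i (s i)))"
      using scaled_closed by (subst frac_hom.hom_finprod) (auto simp: comp_def)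
    also have "(\<Otimes>\<^bsub>?H\<^esub>i\<in>?I. dist_scale (e i (s i)) (ell i (s i))) =
        dist_scale (sign_coeff m s t) (ell_V p iinf ip u E k m \<alpha> s)"
      unfolding sign_coeff_eq_prod ell_V_def e_def[symmetric] ell_def[symmetric]
      by (rule dist_scale_finprod [symmetric]) (auto intro: ell_closed e_E)
    finally have eq: "(\<Otimes>\<^bsub>?S\<^esub>i\<in>?I. G i (s i)) =
        ?\<iota> (dist_scale (sign_coeff m s t) (ell_V p iinf ip u E k m \<alpha> s)) \<otimes>\<^bsub>?S\<^esub>
        (\<Otimes>\<^bsub>?S\<^esub>i\<in>?I. ?\<iota> (A i (s i)))" .
    have "dist_scale (sign_coeff m s t) (ell_V p iinf ip u E k m \<alpha> s) \<in> carrier ?H"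
    proof (rule dist_scale_closed)
      show "sign_coeff m s t \<in> E"
        unfolding sign_coeff_def by (intro is_subfield_power E_subfield E_closed)
      show "ell_V p iinf ip u E k m \<alpha> s \<in> carrier ?H"
        unfolding ell_V_def ell_def[symmetric] by (intro H.finprod_closed) (auto intro: ell_closed)
    qed
    moreover have "(\<Otimes>\<^bsub>?S\<^esub>i\<in>?I. ?\<iota> (A i (s i))) \<in> carrier ?S"
      using A_closed by (intro Frac.finprod_closed) auto
    ultimately show ?thesis
      unfolding eq L_V_pm_def A_def[symmetric] W_def[symmetric] using W
      by (intro Frac.m_assoc) auto
  qed
  have "L_V_root p u E k m \<alpha> Lroot Leta t = (\<Otimes>\<^bsub>?S\<^esub>i\<in>?I. G i Plus \<oplus>\<^bsub>?S\<^esub> G i Minus) \<otimes>\<^bsub>?S\<^esub> W"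
    unfolding L_V_root_def W_def[symmetric] using G_closed factor
    by (subst Frac.finprod_cong'[OF refl]) auto
  also have "(\<Otimes>\<^bsub>?S\<^esub>i\<in>?I. G i Plus \<oplus>\<^bsub>?S\<^esub> G i Minus) =
      (\<Oplus>\<^bsub>?S\<^esub>s\<in>Signs m. \<Otimes>\<^bsub>?S\<^esub>i\<in>?I. G i (s i))"
    unfolding Signs_def by (rule Frac.finprod_add_expand) (auto intro: G_closed)
  also have "\<dots> \<otimes>\<^bsub>?S\<^esub> W = (\<Oplus>\<^bsub>?S\<^esub>s\<in>Signs m. (\<Otimes>\<^bsub>?S\<^esub>i\<in>?I. G i (s i)) \<otimes>\<^bsub>?S\<^esub> W)"
    using finite_Signs W prod_G_closed by (intro Frac.finsum_ldistr) auto
  also have "\<dots> = (\<Oplus>\<^bsub>?S\<^esub>s\<in>Signs m.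
      ?\<iota> (dist_scale (sign_coeff m s t) (ell_V p iinf ip u E k m \<alpha> s)) \<otimes>\<^bsub>?S\<^esub>
        L_V_pm p u E k m Lpm Leta s)"
    unfolding summand ..
  finally show ?thesis .
qed

end
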